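(* Fix $\epsilon\in[0,\epsilon_\circ]$. Let $U$ be an upper semicontinuous viscosity subsolution and $V$ a lower semicontinuous viscosity supersolution of $F^\epsilon_\kappa[\varphi]=0$ on $[0,T)\times\mathbb{R}$. Assume that $U$ and $V$ have linear growth and that $U\le V$ on $\{T\}\times\mathbb{R}$. Then $U\le V$ on $[0,T]\times\mathbb{R}$.
   Context: Let $T>0$. Standing assumptions: $f\in C^2_b(\mathbb{R})$ with $\inf f>0$; $\sigma:\mathbb{R}\to\mathbb{R}$ bounded and Lipschitz with $\inf\sigma>0$; $\bar\gamma:\mathbb{R}\to\mathbb{R}$ bounded continuous with $\iota\le\bar\gamma\le1/f-\iota$ for some $\iota>0$. Let $K>0$, $x_K\ge K$, and let $\hat g_K:\mathbb{R}\to\mathbb{R}$ be uniformly continuous and affine on $[x_K,\infty)$ and on $(-\infty,-x_K]$. $\epsilon_\circ\in(0,1)$ and $\kappa:\mathbb{R}\to\mathbb{R}$ satisfy: $\kappa\in C^\infty$ with bounded derivatives of all orders, $\inf\kappa>0$, $\kappa=|\hat g_K|+1$ on $(-\infty,-x_K]\cup[x_K,\infty)$, and $-1/\epsilon_\circ<\partial_x\kappa<1/\epsilon_\circ$. For $\epsilon\ge0$: $D^\epsilon_\kappa(x):=\{x'\in\mathbb{R}:(x-x')/\kappa(x')\in[-\epsilon,\epsilon]\}$, and $F^\epsilon_\kappa(t,x,q,M):=\min_{x'\in D^\epsilon_\kappa(x)}\min\Big\{-q-\frac{\sigma^2(x')M}{2(1-f(x')M)},\ \bar\gamma(x')-M\Big\}$,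 with $F^\epsilon_\kappa[\varphi](t,x):=F^\epsilon_\kappa(t,x,\partial_t\varphi(t,x),\partial^2_{xx}\varphi(t,x))$. (For $\epsilon=0$, $D^0_\kappa(x)=\{x\}$ and $F^0_\kappa[\varphi]=\min\{-\partial_t\varphi-\frac{\sigma^2\partial^2_{xx}\varphi}{2(1-f\partial^2_{xx}\varphi)},\bar\gamma-\partial^2_{xx}\varphi\}$.) *)

theory Defs
  imports "HOL-Analysis.Analysis"
begin

definition usc_on :: "(real \<times> real) set \<Rightarrow> (real \<times> real \<Rightarrow> real) \<Rightarrow> bool" where
  "usc_on S u \<longleftrightarrow> (\<forall>z\<in>S. \<forall>e>0. \<exists>d>0. \<forall>w\<in>S. dist w z < d \<longrightarrow> u w < u z + e)"

definition lsc_on :: "(real \<times> real) set \<Rightarrow> (real \<times> real \<Rightarrow> real) \<Rightarrow> bool" where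
  "lsc_on S u \<longleftrightarrow> (\<forall>z\<in>S. \<forall>e>0. \<exists>d>0. \<forall>w\<in>S. dist w z < d \<longrightarrow> u z - e < u w)"

definition linear_growth :: "real \<Rightarrow> (real \<times> real \<Rightarrow> real) \<Rightarrow> bool" where
  "linear_growth T u \<longleftrightarrow> (\<exists>C. \<forall>t x. 0 \<le> t \<and> t \<le> T \<longrightarrow> \<bar>u (t, x)\<bar> \<le> C * (1 + \<bar>x\<bar>))"

definition C12_test ::
  "(real \<times> real \<Rightarrow> real) \<Rightarrow> (real \<times> real \<Rightarrow> real) \<Rightarrow> (real \<times> real \<Rightarrow> real)
     \<Rightarrow> (real \<times> real \<Rightarrow> real) \<Rightarrow> bool" where
  "C12_test \<phi> \<phi>t \<phi>x \<phi>xx \<longleftrightarrow>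
     continuous_on UNIV \<phi> \<and> continuous_on UNIV \<phi>t \<and> continuous_on UNIV \<phi>x \<and> continuous_on UNIV \<phi>xx \<and>
     (\<forall>t x. ((\<lambda>s. \<phi> (s, x)) has_real_derivative \<phi>t (t, x)) (at t)) \<and>
     (\<forall>t x. ((\<lambda>y. \<phi> (t, y)) has_real_derivative \<phi>x (t, x)) (at x)) \<and>
     (\<forall>t x. ((\<lambda>y. \<phi>x (t, y)) has_real_derivative \<phi>xx (t, x)) (at x))"

definition Dset :: "(real \<Rightarrow> real) \<Rightarrow> real \<Rightarrow> real \<Rightarrow> real set" where
  "Dset \<kappa> \<epsilon> x = {x'. (x - x') / \<kappa> x' \<in> {-\<epsilon>..\<epsilon>}}"

(* F^eps_kappa(t,x,q,M); the min over D is taken as an infimum in the extended reals *)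
definition Fop ::
  "(real \<Rightarrow> real) \<Rightarrow> (real \<Rightarrow> real) \<Rightarrow> (real \<Rightarrow> real) \<Rightarrow> (real \<Rightarrow> real) \<Rightarrow> real
     \<Rightarrow> real \<Rightarrow> real \<Rightarrow> real \<Rightarrow> real \<Rightarrow> ereal" where
  "Fop f \<sigma> \<gamma> \<kappa> \<epsilon> t x q M =
     (INF x'\<in>Dset \<kappa> \<epsilon> x.
        ereal (min (- q - (\<sigma> x')\<^sup>2 * M / (2 * (1 - f x' * M))) (\<gamma> x' - M)))"

definition visc_sub ::
  "(real \<Rightarrow> real) \<Rightarrow> (real \<Rightarrow> real) \<Rightarrow> (real \<Rightarrow> real) \<Rightarrow> (real \<Rightarrow> real) \<Rightarrow> real \<Rightarrow> real
     \<Rightarrow> (real \<times> real \<Rightarrow> real) \<Rightarrow> bool" where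
  "visc_sub f \<sigma> \<gamma> \<kappa> \<epsilon> T U \<longleftrightarrow>
     (\<forall>\<phi> \<phi>t \<phi>x \<phi>xx t x. C12_test \<phi> \<phi>t \<phi>x \<phi>xx \<and> 0 \<le> t \<and> t < T \<and>
        (\<exists>r>0. \<forall>s y. 0 \<le> s \<and> s < T \<and> dist (s, y) (t, x) < r \<longrightarrow>
                 U (s, y) - \<phi> (s, y) \<le> U (t, x) - \<phi> (t, x))
        \<longrightarrow> Fop f \<sigma> \<gamma> \<kappa> \<epsilon> t x (\<phi>t (t, x)) (\<phi>xx (t, x)) \<le> 0)"

definition visc_super ::
  "(real \<Rightarrow> real) \<Rightarrow> (real \<Rightarrow> real) \<Rightarrow> (real \<Rightarrow> real) \<Rightarrow> (real \<Rightarrow> real) \<Rightarrow> real \<Rightarrow> real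
     \<Rightarrow> (real \<times> real \<Rightarrow> real) \<Rightarrow> bool" where
  "visc_super f \<sigma> \<gamma> \<kappa> \<epsilon> T V \<longleftrightarrow>
     (\<forall>\<phi> \<phi>t \<phi>x \<phi>xx t x. C12_test \<phi> \<phi>t \<phi>x \<phi>xx \<and> 0 \<le> t \<and> t < T \<and>
        (\<exists>r>0. \<forall>s y. 0 \<le> s \<and> s < T \<and> dist (s, y) (t, x) < r \<longrightarrow>
                 V (s, y) - \<phi> (s, y) \<ge> V (t, x) - \<phi> (t, x))
        \<longrightarrow> Fop f \<sigma> \<gamma> \<kappa> \<epsilon> t x (\<phi>t (t, x)) (\<phi>xx (t, x)) \<ge> 0)"

definition smooth_bounded_derivs :: "(real \<Rightarrow> real) \<Rightarrow> bool" where
  "smooth_bounded_derivs k \<longleftrightarrow>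
     (\<forall>n. (\<forall>x. (deriv ^^ n) k differentiable at x) \<and> (\<exists>B. \<forall>x. \<bar>(deriv ^^ Suc n) k x\<bar> \<le> B))"

end

theory Submission
  imports Defs
begin

text \<open>
  The operator is jointly concave in \<open>(q, M)\<close> on the set where the gamma constraint holds, so instead of
  doubling variables one regularises the supersolution by convolution. Writing \<open>H\<close> for
  \<open>\<sigma>\<^sup>2 M / (2 (1 - f M))\<close>, convexity of \<open>H\<close> in \<open>M\<close> turns the supersolution property into a family of linear
  inequalities \<open>- q - a M \<ge> c\<close> with constant \<open>a \<ge> 0\<close>; these pass to convolutions because
  viscosity supersolutions of the heat equation dominate smooth heat flows started below them.
  Since \<open>M \<mapsto> M / (1 - f M)\<close> is bounded below the constraint, moving the coefficients from
  \<open>x'\<close> to a nearby point costs an error uniform in \<open>M\<close>. The constraint also makes \<open>V\<close>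
  semiconcave in space and \<open>V - C t\<close> nonincreasing in time, which keeps the convolution below \<open>V\<close>
  up to a small error. Mixing the convolution \<open>W\<close> with a strict quadratic supersolution \<open>\<psi>\<close> gives the
  smooth strict supersolution \<open>(1 - l) W + l \<psi>\<close>, which is an admissible test function for \<open>U\<close> at a
  maximum point of the difference.
\<close>

section \<open>Parabolic subjets of lower semicontinuous functions\<close>


text \<open>Only \<open>V\<close> is regularised: a smooth strict supersolution can be tested
  against \<open>U\<close> directly. All estimates are made for one fixed \<open>x'\<close> at a
  time, with a margin common to the whole shaken set, so the minimum over \<open>Dset\<close> does
  no harm; what has to be controlled is that a convolution at \<open>x0\<close> samples points
  \<open>x\<close> whose sets \<open>Dset \<kappa> \<epsilon> x\<close> differ from that of
  \<open>x0\<close>. The equation runs backward in time: a supersolution at an early time dominates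
  the heat flow started below it at a later time. Hence all regularisation looks forward in time,
  and contact at \<open>t = 0\<close> is as good as interior contact. The fixed-time estimates are
  kept apart from the time convolution because semiconcavity makes \<open>V\<close> continuous in
  space, while in time only semicontinuity and one-sided growth are available. The constants are
  chosen in the order gap, weight \<open>l\<close>, tolerance \<open>\<omega>\<close> and radius
  \<open>R\<close>, width \<open>h\<close>: the mollified inequality is uniform only for
  \<open>\<bar>x0\<bar> \<le> R\<close>, and the quadratic growth of \<open>\<psi>\<close> is what
  lets \<open>R\<close> be fixed before \<open>h\<close>.\<close>

text \<open>Only \<open>q = \<partial>\<^sub>t\<phi>\<close> and \<open>M = \<partial>\<^sub>x\<^sub>x\<phi>\<close> are recorded, as the operator does not see the slope. At
  \<open>t = 0\<close> the contact is one-sided in time.\<close>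

definition subjet :: "real \<Rightarrow> (real \<times> real \<Rightarrow> real) \<Rightarrow> real \<Rightarrow> real \<Rightarrow> real \<Rightarrow> real \<Rightarrow> bool" where
  "subjet T V t x q M \<longleftrightarrow> 0 \<le> t \<and> t < T \<and>
     (\<exists>\<phi> \<phi>t \<phi>x \<phi>xx. C12_test \<phi> \<phi>t \<phi>x \<phi>xx \<and> \<phi>t (t, x) = q \<and> \<phi>xx (t, x) = M \<and>
        (\<exists>r>0. \<forall>s y. 0 \<le> s \<and> s < T \<and> dist (s, y) (t, x) < r \<longrightarrow>
                 V (s, y) - \<phi> (s, y) \<ge> V (t, x) - \<phi> (t, x)))"

lemma visc_super_subjet:
  assumes "visc_super f \<sigma> \<gamma> \<kappa> \<epsilon> T V" "subjet T V t x q M"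
  shows "Fop f \<sigma> \<gamma> \<kappa> \<epsilon> t x q M \<ge> 0"
  using assms unfolding visc_super_def subjet_def by blast

lemma lsc_on_subset: "lsc_on S V \<Longrightarrow> R \<subseteq> S \<Longrightarrow> lsc_on R V"
  unfolding lsc_on_def by blast

lemma lsc_onD: "lsc_on S V \<Longrightarrow> z \<in> S \<Longrightarrow> e > 0 \<Longrightarrow> \<exists>d>0. \<forall>w\<in>S. dist w z < d \<longrightarrow> V z - e < V w"
  unfolding lsc_on_def by blast

text \<open>Without a minimiser every \<open>z\<close> in \<open>K\<close> has a competitor
  \<open>w z\<close> of smaller value, and \<open>V\<close> stays above \<open>V (w z)\<close> near
  \<open>z\<close>. Among finitely many such neighbourhoods covering \<open>K\<close>, the smallest
  \<open>V (w z)\<close> is attained in \<open>K\<close>, hence lies above another of these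
  values.\<close>

lemma lsc_on_attains_inf:
  assumes lsc: "lsc_on S V" and K: "compact K" "K \<subseteq> S" "K \<noteq> {}"
  shows "\<exists>z\<in>K. \<forall>w\<in>K. V z \<le> V w"
proof (rule ccontr)
  assume "\<not> ?thesis"
  then have "\<forall>z\<in>K. \<exists>w\<in>K. V w < V z" by (meson not_le)
  then obtain w where w: "\<And>z. z \<in> K \<Longrightarrow> w z \<in> K \<and> V (w z) < V z" by metis
  have "\<forall>z\<in>K. \<exists>d>0. \<forall>v\<in>S. dist v z < d \<longrightarrow> V (w z) < V v"
  proof
    fix z assume z: "z \<in> K"
    then have "z \<in> S" "V z - V (w z) > 0" using w K by auto
    then obtain d where "d > 0" "\<forall>v\<in>S. dist v z < d \<longrightarrow> V z - (V z - V (w z)) < V v"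
      using lsc unfolding lsc_on_def by blast
    then show "\<exists>d>0. \<forall>v\<in>S. dist v z < d \<longrightarrow> V (w z) < V v" by auto
  qed
  then obtain d where d: "\<And>z. z \<in> K \<Longrightarrow> d z > 0 \<and> (\<forall>v\<in>S. dist v z < d z \<longrightarrow> V (w z) < V v)" by metis
  have "K \<subseteq> (\<Union>z\<in>K. ball z (d z))" using d by force
  then obtain F where F: "F \<subseteq> K" "finite F" "K \<subseteq> (\<Union>z\<in>F. ball z (d z))"
    using compactE_image[OF K(1), of K "\<lambda>z. ball z (d z)"] by auto
  have "F \<noteq> {}" using F K by auto
  define m where "m = Min ((\<lambda>z. V (w z)) ` F)"
  have "m \<in> (\<lambda>z. V (w z)) ` F" unfolding m_def using F \<open>F \<noteq> {}\<close> by (intro Min_in) auto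
  then obtain z where z: "z \<in> F" "m = V (w z)" by auto
  have "w z \<in> K" using w[of z] z F by auto
  then obtain y where y: "y \<in> F" "w z \<in> ball y (d y)" using F by auto
  then have "V (w y) < V (w z)" using d[of y] F(1) K(2) \<open>w z \<in> K\<close> by (metis dist_commute mem_ball subsetD)
  moreover have "m \<le> V (w y)" unfolding m_def using y F by (intro Min_le) auto
  ultimately show False using z by simp
qed

lemma lsc_on_diff:
  assumes "lsc_on S V" "continuous_on UNIV \<phi>"
  shows "lsc_on S (\<lambda>z. V z - \<phi> z)"
  unfolding lsc_on_def
proof (intro ballI allI impI)
  fix z e assume z: "z \<in> S" and e: "(e::real) > 0"
  obtain d1 where d1: "d1 > 0" "\<forall>w\<in>S. dist w z < d1 \<longrightarrow> V z - e/2 < V w"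
    using assms(1) z e unfolding lsc_on_def by (meson half_gt_zero)
  obtain d2 where d2: "d2 > 0" "\<forall>w. dist w z < d2 \<longrightarrow> dist (\<phi> w) (\<phi> z) < e/2"
    using assms(2) e unfolding continuous_on_iff by (metis UNIV_I half_gt_zero)
  show "\<exists>d>0. \<forall>w\<in>S. dist w z < d \<longrightarrow> V z - \<phi> z - e < V w - \<phi> w"
  proof (intro exI[of _ "min d1 d2"] conjI ballI impI)
    fix w assume w: "w \<in> S" "dist w z < min d1 d2"
    have "V z - e/2 < V w" using d1 w by auto
    moreover have "\<bar>\<phi> w - \<phi> z\<bar> < e/2" using d2(2)[rule_format, of w] w(2) by (simp add: dist_real_def)
    ultimately show "V z - \<phi> z - e < V w - \<phi> w" by linarith
  qed (use d1 d2 in auto)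
qed

text \<open>The source of all contact points: the minimum of \<open>V - \<phi>\<close> over the box
  is negative, so it avoids every face on which the difference is nonnegative. The bottom face is
  exempt when \<open>p = 0\<close>, since a subjet at time 0 competes only with later times.\<close>

lemma box_min_subjet:
  assumes lsc: "lsc_on ({0..<T} \<times> UNIV) V" and C: "C12_test \<phi> \<phi>t \<phi>x \<phi>xx"
    and pb: "0 \<le> p" "b < T"
    and z0: "p \<le> ti" "ti \<le> b" "l \<le> xi" "xi \<le> u" "V (ti, xi) - \<phi> (ti, xi) < 0"
    and B: "\<And>x. l \<le> x \<Longrightarrow> x \<le> u \<Longrightarrow> V (b, x) - \<phi> (b, x) \<ge> 0"
    and P: "p = 0 \<or> (\<forall>x. l \<le> x \<and> x \<le> u \<longrightarrow> V (p, x) - \<phi> (p, x) \<ge> 0)"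
    and L: "\<And>t. p \<le> t \<Longrightarrow> t \<le> b \<Longrightarrow> V (t, l) - \<phi> (t, l) \<ge> 0"
    and U: "\<And>t. p \<le> t \<Longrightarrow> t \<le> b \<Longrightarrow> V (t, u) - \<phi> (t, u) \<ge> 0"
  shows "\<exists>t x. p \<le> t \<and> t < b \<and> l < x \<and> x < u \<and> subjet T V t x (\<phi>t (t, x)) (\<phi>xx (t, x))"
proof -
  have lsc': "lsc_on ({0..<T} \<times> UNIV) (\<lambda>z. V z - \<phi> z)"
    using C unfolding C12_test_def by (intro lsc_on_diff lsc) auto
  have "compact ({p..b} \<times> {l..u})" by (intro compact_Times) auto
  moreover have "{p..b} \<times> {l..u} \<subseteq> {0..<T} \<times> UNIV" using pb by auto
  moreover have in0: "(ti, xi) \<in> {p..b} \<times> {l..u}" using z0 by auto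
  ultimately obtain z where z: "z \<in> {p..b} \<times> {l..u}" "\<forall>w\<in>{p..b} \<times> {l..u}. V z - \<phi> z \<le> V w - \<phi> w"
    using lsc_on_attains_inf[OF lsc', of "{p..b} \<times> {l..u}"] by blast
  obtain t x where tx: "z = (t, x)" by (cases z)
  have neg: "V (t, x) - \<phi> (t, x) < 0" using bspec[OF z(2) in0] z0(5) unfolding tx by linarith
  have b1: "p \<le> t" "t < b" using z tx neg B[of x] by (auto simp: order.order_iff_strict)
  have b2: "l < x" using z tx neg L[of t] by (auto simp: order.order_iff_strict)
  have b3: "x < u" using z tx neg U[of t] by (auto simp: order.order_iff_strict)
  have b4: "p = 0 \<or> p < t" using P b1 b2 b3 neg by (auto simp: order.order_iff_strict)
  \<comment> \<open>For \<open>p = 0\<close> the distance to the bottom face is replaced by the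
    default 1: competitors satisfy \<open>0 \<le> s\<close> and so remain in the box.\<close>
  define r where "r = Min {b - t, x - l, u - x, (if p = 0 then 1 else t - p)}"
  have r: "r > 0" "r \<le> b - t" "r \<le> x - l" "r \<le> u - x" "p = 0 \<or> r \<le> t - p"
    using b1 b2 b3 b4 unfolding r_def by auto
  have "V (s, y) - \<phi> (s, y) \<ge> V (t, x) - \<phi> (t, x)" if s: "0 \<le> s" "s < T" "dist (s, y) (t, x) < r" for s y
  proof -
    have "\<bar>s - t\<bar> < r" using s(3) dist_fst_le[of "(s,y)" "(t,x)"] by (simp add: dist_real_def)
    moreover have "\<bar>y - x\<bar> < r" using s(3) dist_snd_le[of "(s,y)" "(t,x)"] by (simp add: dist_real_def)
    ultimately have "(s, y) \<in> {p..b} \<times> {l..u}" using r s by auto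
    then show ?thesis using z tx by auto
  qed
  then have "subjet T V t x (\<phi>t (t, x)) (\<phi>xx (t, x))"
    unfolding subjet_def using r(1) C b1 pb by (intro conjI exI[of _ \<phi>] exI[of _ \<phi>t] exI[of _ \<phi>x] exI[of _ \<phi>xx] exI[of _ r]) auto
  then show ?thesis using b1 b2 b3 by auto
qed

text \<open>A failure of concavity leaves room under a chord for a parabola with second derivative
  \<open>G + 2 * \<eta>\<close>, which would produce a subjet with \<open>M > G\<close>. Subjets
  live in space-time, so a penalty in time confines the contact to times near
  \<open>t0\<close>.\<close>

lemma subjet_semiconcave:
  assumes lsc: "lsc_on ({0..<T} \<times> UNIV) V"
    and jet: "\<And>t x q M. subjet T V t x q M \<Longrightarrow> M \<le> G"
    and t0: "0 \<le> t0" "t0 < T"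
  shows "concave_on UNIV (\<lambda>x. V (t0, x) - G / 2 * x\<^sup>2)"
proof -
  define w where "w = (\<lambda>x. V (t0, x) - G / 2 * x\<^sup>2)"
  have main: "(1 - \<mu>) * w x1 + \<mu> * w x2 \<le> w ((1 - \<mu>) * x1 + \<mu> * x2)"
    if \<mu>: "0 < \<mu>" "\<mu> < 1" and x12: "x1 < x2" for \<mu> x1 x2
  proof (rule ccontr)
    define z where "z = (1 - \<mu>) * x1 + \<mu> * x2"
    define g where "g = (1 - \<mu>) * w x1 + \<mu> * w x2 - w z"
    assume "\<not> ?thesis"
    then have g: "g > 0" by (simp add: g_def z_def)
    have zx: "z - x1 = \<mu> * (x2 - x1)" "x2 - z = (1 - \<mu>) * (x2 - x1)" by (auto simp: z_def algebra_simps)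
    then have z: "x1 < z" "z < x2" using \<mu> x12
       by (metis diff_gt_0_iff_gt mult_pos_pos)+
    define s where "s = (w x2 - w x1) / (x2 - x1)"
    \<comment> \<open>The parabola with this coefficient vanishes at \<open>x1\<close> and
      \<open>x2\<close> and dips by exactly \<open>g / 4\<close> at \<open>z\<close>. Together with
      the lowering of the chord by \<open>g / 4\<close>, half of the defect \<open>g\<close> is left
      at \<open>z\<close>.\<close>
    define \<eta> where "\<eta> = g / 4 / ((z - x1) * (x2 - z))"
    have \<eta>: "\<eta> > 0" "\<eta> * ((z - x1) * (z - x2)) = - g / 4"
      proof -
      have p: "(z - x1) * (x2 - z) > 0" using z by simp
      show "\<eta> > 0" using g p by (simp add: \<eta>_def)
      have "\<eta> * ((z - x1) * (x2 - z)) = g / 4" using p nonzero_eq_divide_eq[of "(z - x1) * (x2 - z)" \<eta> "g / 4"] \<eta>_def by linarith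
      then show "\<eta> * ((z - x1) * (z - x2)) = - g / 4" by (simp add: algebra_simps)
    qed
    obtain d1 where d1: "d1 > 0" "\<forall>v\<in>{0..<T} \<times> UNIV. dist v (t0, x1) < d1 \<longrightarrow> V (t0, x1) - g/4 < V v"
      using lsc_onD[OF lsc, of "(t0, x1)" "g/4"] t0 g by auto
    obtain d2 where d2: "d2 > 0" "\<forall>v\<in>{0..<T} \<times> UNIV. dist v (t0, x2) < d2 \<longrightarrow> V (t0, x2) - g/4 < V v"
      using lsc_onD[OF lsc, of "(t0, x2)" "g/4"] t0 g by auto
    \<comment> \<open>Within time \<open>d\<close> of \<open>t0\<close>, lower semicontinuity costs
      at most \<open>g / 4\<close> at \<open>x1\<close> and \<open>x2\<close>, which is the amount
      by which the chord in \<open>\<phi>0\<close> is lowered.\<close>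
    define d where "d = Min {d1 / 2, d2 / 2, (T - t0) / 2}"
    have d: "d > 0" "d < d1" "d < d2" "t0 + d < T" using d1 d2 t0 by (auto simp: d_def min_def field_simps)
    define p where "p = max 0 (t0 - d)"
    define \<phi>0 where "\<phi>0 = (\<lambda>v::real\<times>real. w x1 - g/4 + (snd v - x1) * s + G / 2 * (snd v)\<^sup>2 + \<eta> * ((snd v - x1) * (snd v - x2)))"
    have p: "0 \<le> p" "p \<le> t0" using t0 d by (auto simp: p_def)
    have "\<exists>y\<in>{p..t0+d} \<times> {x1..x2}. \<forall>v\<in>{p..t0+d} \<times> {x1..x2}. V y - \<phi>0 y \<le> V v - \<phi>0 v"
    proof (rule lsc_on_attains_inf)
      show "lsc_on ({0..<T} \<times> UNIV) (\<lambda>y. V y - \<phi>0 y)"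
        unfolding \<phi>0_def by (intro lsc_on_diff lsc continuous_intros)
      show "compact ({p..t0+d} \<times> {x1..x2})" by (intro compact_Times) auto
    qed (use p d x12 in auto)
    then obtain bd where bd: "\<forall>v\<in>{p..t0+d} \<times> {x1..x2}. bd \<le> V v - \<phi>0 v" by auto
    define Kc where "Kc = \<bar>bd\<bar> / d\<^sup>2"
    have Kc: "Kc \<ge> 0" "Kc * d\<^sup>2 = \<bar>bd\<bar>" using d by (auto simp: Kc_def)
    define \<phi> where "\<phi> = (\<lambda>v. \<phi>0 v - Kc * (fst v - t0)\<^sup>2)"
    define \<phi>t where "\<phi>t = (\<lambda>v::real\<times>real. - Kc * (2 * (fst v - t0)))"
    define \<phi>x where "\<phi>x = (\<lambda>v::real\<times>real. s + G * snd v + \<eta> * (2 * snd v - x1 - x2))"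
    define \<phi>xx where "\<phi>xx = (\<lambda>v::real\<times>real. G + 2 * \<eta>)"
    have C: "C12_test \<phi> \<phi>t \<phi>x \<phi>xx"
      unfolding C12_test_def \<phi>_def \<phi>0_def \<phi>t_def \<phi>x_def \<phi>xx_def
      by (auto intro!: continuous_intros derivative_eq_intros simp: algebra_simps power2_eq_square)
    have e1: "V (t, x1) - \<phi> (t, x1) \<ge> 0" if "p \<le> t" "t \<le> t0 + d" for t
    proof -
      have "\<bar>t - t0\<bar> < d1" using that d t0 by (auto simp: p_def)
      then have "V (t0, x1) - g/4 < V (t, x1)" using d1(2)[rule_format, of "(t,x1)"] that p d by (auto simp: dist_Pair_Pair dist_real_def)
      moreover have "\<phi> (t, x1) \<le> \<phi>0 (t, x1)" using Kc by (simp add: \<phi>_def)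
      moreover have "\<phi>0 (t, x1) = V (t0, x1) - g/4" by (simp add: \<phi>0_def w_def)
      ultimately show ?thesis by linarith
    qed
    have e2: "V (t, x2) - \<phi> (t, x2) \<ge> 0" if "p \<le> t" "t \<le> t0 + d" for t
    proof -
      have "\<bar>t - t0\<bar> < d2" using that d t0 by (auto simp: p_def)
      then have "V (t0, x2) - g/4 < V (t, x2)" using d2(2)[rule_format, of "(t,x2)"] that p d by (auto simp: dist_Pair_Pair dist_real_def)
      moreover have "\<phi> (t, x2) \<le> \<phi>0 (t, x2)" using Kc by (simp add: \<phi>_def)
      moreover have "(x2 - x1) * s = w x2 - w x1" using x12 by (simp add: s_def)
      then have "\<phi>0 (t, x2) = V (t0, x2) - g/4" by (simp add: \<phi>0_def w_def)
      ultimately show ?thesis by linarith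
    qed
    have e3: "V (t, x) - \<phi> (t, x) \<ge> 0" if "p \<le> t" "t \<le> t0 + d" "\<bar>t - t0\<bar> = d" "x1 \<le> x" "x \<le> x2" for t x
    proof -
      have "bd \<le> V (t, x) - \<phi>0 (t, x)" using bd that by auto
      moreover have "\<phi> (t, x) = \<phi>0 (t, x) - \<bar>bd\<bar>" using that(3) Kc(2) by (simp add: \<phi>_def) (metis power2_abs)
      ultimately show ?thesis by linarith
    qed
    have e4: "V (t0, z) - \<phi> (t0, z) < 0"
    proof -
      have "(z - x1) * s = \<mu> * (w x2 - w x1)" using x12 zx by (simp add: s_def)
      then have "\<phi>0 (t0, z) = w x1 - g/4 + \<mu> * (w x2 - w x1) + G / 2 * z\<^sup>2 - g/4"
        using \<eta> by (simp add: \<phi>0_def)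
      moreover have "V (t0, z) = w z + G / 2 * z\<^sup>2" by (simp add: w_def)
      moreover have "w z = (1 - \<mu>) * w x1 + \<mu> * w x2 - g" by (simp add: g_def)
      ultimately show ?thesis using g by (simp add: \<phi>_def algebra_simps)
    qed
    have "\<exists>t x. p \<le> t \<and> t < t0 + d \<and> x1 < x \<and> x < x2 \<and> subjet T V t x (\<phi>t (t, x)) (\<phi>xx (t, x))"
    proof (rule box_min_subjet[OF lsc C, where ti = t0 and xi = z])
      show "p = 0 \<or> (\<forall>x. x1 \<le> x \<and> x \<le> x2 \<longrightarrow> 0 \<le> V (p, x) - \<phi> (p, x))"
      proof (cases "t0 - d \<le> 0")
        case False
        then show ?thesis using e3[of p] p d by (auto simp: p_def)
      qed (simp add: p_def)
    qed (use p d z e1 e2 e3 e4 in auto)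
    then obtain t x where "subjet T V t x (\<phi>t (t, x)) (G + 2 * \<eta>)" unfolding \<phi>xx_def by blast
    from jet[OF this] \<eta>(1) show False by simp
  qed
  have "concave_on UNIV w"
    unfolding concave_on_def
  proof (rule convex_onI)
    fix \<mu> x y :: real assume "0 < \<mu>" "\<mu> < 1"
    then show "- w ((1 - \<mu>) *\<^sub>R x + \<mu> *\<^sub>R y) \<le> (1 - \<mu>) * - w x + \<mu> * - w y"
    using linorder_less_linear[of x y]
    proof (elim disjE)
      assume "x < y"
      then show ?thesis using main[of \<mu> x y] \<open>0 < \<mu>\<close> \<open>\<mu> < 1\<close> by simp
    next
      assume "x = y"
      then show ?thesis by (simp add: algebra_simps)
    next
      assume "y < x"
      then show ?thesis using main[of "1 - \<mu>" y x] \<open>0 < \<mu>\<close> \<open>\<mu> < 1\<close> by (simp add: add.commute)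
    qed
  qed auto
  then show ?thesis by (simp add: w_def)
qed

text \<open>The roles of time and space are exchanged: the test function has slope
  \<open>C0 + \<eta>\<close> in time and is penalised in space. The hypothesis bounds
  \<open>q\<close> for every \<open>M\<close>, so the large negative second derivative of the
  penalty does no harm.\<close>

lemma subjet_time_growth:
  assumes lsc: "lsc_on ({0..<T} \<times> UNIV) V"
    and jet: "\<And>t x q M. subjet T V t x q M \<Longrightarrow> q \<le> C0"
    and t: "0 \<le> t0" "t0 \<le> t1" "t1 < T"
  shows "V (t1, x0) \<le> V (t0, x0) + C0 * (t1 - t0)"
proof (rule ccontr)
  define g where "g = V (t1, x0) - V (t0, x0) - C0 * (t1 - t0)"
  assume "\<not> ?thesis"
  then have g: "g > 0" and t01: "t0 < t1" using t by (auto simp: g_def order.order_iff_strict)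
  \<comment> \<open>The excess slope gains \<open>g / 4\<close> between \<open>t0\<close> and
    \<open>t1\<close>. Another \<open>g / 4\<close> raises the line at \<open>t0\<close>, a third
    one pays for lower semicontinuity at \<open>t1\<close>, and a quarter of the defect
    remains.\<close>
  define \<eta> where "\<eta> = g / 4 / (t1 - t0)"
  have \<eta>: "\<eta> > 0" "\<eta> * (t1 - t0) = g / 4" 
  proof -
    show "\<eta> > 0" using g t01 by (simp add: \<eta>_def)
    show "\<eta> * (t1 - t0) = g / 4" using t01 nonzero_eq_divide_eq[of "t1 - t0" \<eta> "g / 4"] \<eta>_def by linarith
  qed
  obtain d1 where d1: "d1 > 0" "\<forall>v\<in>{0..<T} \<times> UNIV. dist v (t1, x0) < d1 \<longrightarrow> V (t1, x0) - g/4 < V v"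
    using lsc_onD[OF lsc, of "(t1, x0)" "g/4"] t g by auto
  define d where "d = d1 / 2"
  have d: "d > 0" "d < d1" using d1 by (auto simp: d_def)
  define \<phi>0 where "\<phi>0 = (\<lambda>v::real\<times>real. V (t0, x0) + g/4 + (C0 + \<eta>) * (fst v - t0))"
  have "\<exists>y\<in>{0..t1} \<times> {x0-d..x0+d}. \<forall>v\<in>{0..t1} \<times> {x0-d..x0+d}. V y - \<phi>0 y \<le> V v - \<phi>0 v"
  proof (rule lsc_on_attains_inf)
    show "lsc_on ({0..<T} \<times> UNIV) (\<lambda>y. V y - \<phi>0 y)"
      unfolding \<phi>0_def by (intro lsc_on_diff lsc continuous_intros)
    show "compact ({0..t1} \<times> {x0-d..x0+d})" by (intro compact_Times) auto
  qed (use t d in auto)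
  then obtain bd where bd: "\<forall>v\<in>{0..t1} \<times> {x0-d..x0+d}. bd \<le> V v - \<phi>0 v" by auto
  define Kc where "Kc = \<bar>bd\<bar> / d\<^sup>2"
  have Kc: "Kc \<ge> 0" "Kc * d\<^sup>2 = \<bar>bd\<bar>" using d by (auto simp: Kc_def)
  define \<phi> where "\<phi> = (\<lambda>v. \<phi>0 v - Kc * (snd v - x0)\<^sup>2)"
  define \<phi>t where "\<phi>t = (\<lambda>v::real\<times>real. C0 + \<eta>)"
  define \<phi>x where "\<phi>x = (\<lambda>v::real\<times>real. - Kc * (2 * (snd v - x0)))"
  define \<phi>xx where "\<phi>xx = (\<lambda>v::real\<times>real. - Kc * 2)"
  have C: "C12_test \<phi> \<phi>t \<phi>x \<phi>xx"
    unfolding C12_test_def \<phi>_def \<phi>0_def \<phi>t_def \<phi>x_def \<phi>xx_def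
    by (auto intro!: continuous_intros derivative_eq_intros simp: algebra_simps power2_eq_square)
  have side: "V (t, x) - \<phi> (t, x) \<ge> 0" if "0 \<le> t" "t \<le> t1" "\<bar>x - x0\<bar> = d" for t x
  proof -
    have "(t, x) \<in> {0..t1} \<times> {x0-d..x0+d}" using that by (auto simp: abs_if split: if_splits)
    then have "bd \<le> V (t, x) - \<phi>0 (t, x)" using bd by blast
    moreover have "\<phi> (t, x) = \<phi>0 (t, x) - \<bar>bd\<bar>" using that(3) Kc(2) by (simp add: \<phi>_def) (metis power2_abs)
    ultimately show ?thesis by linarith
  qed
  have top: "V (t1, x) - \<phi> (t1, x) \<ge> 0" if "x0 - d \<le> x" "x \<le> x0 + d" for x
  proof -
    have "\<bar>x - x0\<bar> < d1" using that d by auto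
    then have "V (t1, x0) - g/4 < V (t1, x)" using d1(2)[rule_format, of "(t1,x)"] t by (auto simp: dist_Pair_Pair dist_real_def)
    moreover have "\<phi> (t1, x) \<le> \<phi>0 (t1, x)" using Kc by (simp add: \<phi>_def)
    moreover have "\<phi>0 (t1, x) = V (t0, x0) + g/4 + C0 * (t1 - t0) + g/4" using \<eta> by (simp add: \<phi>0_def algebra_simps)
    ultimately show ?thesis using g unfolding g_def by argo
  qed
  \<comment> \<open>The box reaches back to time 0 instead of starting at \<open>t0\<close>, which
    puts it in the case where the bottom face is exempt.\<close>
  have "\<exists>t x. 0 \<le> t \<and> t < t1 \<and> x0 - d < x \<and> x < x0 + d \<and> subjet T V t x (\<phi>t (t, x)) (\<phi>xx (t, x))"
  proof (rule box_min_subjet[OF lsc C, where ti = t0 and xi = x0])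
    show "V (t0, x0) - \<phi> (t0, x0) < 0" using g by (simp add: \<phi>_def \<phi>0_def)
  qed (use t d top in \<open>auto intro!: side[simplified]\<close>)
  then obtain t x where "subjet T V t x (C0 + \<eta>) (\<phi>xx (t, x))" unfolding \<phi>t_def by blast
  from jet[OF this] \<eta>(1) show False by simp
qed

section \<open>Comparison with short heat flows\<close>

text \<open>The two constants have different duties: \<open>K\<close> merely sizes the comparison
  box and may change from step to step, whereas \<open>B\<close> measures the error of a heat step
  and has to stay fixed under iteration.\<close>

definition C4_bdd :: "real \<Rightarrow> real \<Rightarrow> (real \<Rightarrow> real) \<Rightarrow> (real \<Rightarrow> real) \<Rightarrow> bool" where
  "C4_bdd K B g g2 \<longleftrightarrow> (\<exists>g1 g3 g4. (\<forall>x. (g has_real_derivative g1 x) (at x)) \<and>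
     (\<forall>x. (g1 has_real_derivative g2 x) (at x)) \<and> (\<forall>x. (g2 has_real_derivative g3 x) (at x)) \<and>
     (\<forall>x. (g3 has_real_derivative g4 x) (at x)) \<and> continuous_on UNIV g4 \<and>
     (\<forall>x. \<bar>g x\<bar> \<le> K \<and> \<bar>g2 x\<bar> \<le> K \<and> \<bar>g4 x\<bar> \<le> B))"

text \<open>Comparison with the classical subsolution \<open>g + a (t1 - t) g'' - a\<^sup>2 (t1 - t)\<^sup>2 B / 2\<close>, made strict and
  coercive by a multiple of \<open>x\<^sup>2 + (2 a + 1) (t1 - t)\<close>.\<close>

lemma heat_step:
  assumes lsc: "lsc_on ({0..<T} \<times> UNIV) V" and a: "a \<ge> 0"
    and jet: "\<And>t x q M. subjet T V t x q M \<Longrightarrow> - q - a * M \<ge> 0"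
    and nonneg: "\<And>t x. 0 \<le> t \<Longrightarrow> t < T \<Longrightarrow> V (t, x) \<ge> 0"
    and g: "C4_bdd K B g g2" and t: "t1 < T" "0 \<le> \<theta>" "\<theta> \<le> t1"
    and le: "\<And>x. g x \<le> V (t1, x)"
  shows "g x0 + a * \<theta> * g2 x0 - a\<^sup>2 * \<theta>\<^sup>2 * B / 2 \<le> V (t1 - \<theta>, x0)"
proof -
  obtain g1 g3 g4 where g1: "\<And>x. (g has_real_derivative g1 x) (at x)"
    and g2: "\<And>x. (g1 has_real_derivative g2 x) (at x)" and g3: "\<And>x. (g2 has_real_derivative g3 x) (at x)"
    and g4: "\<And>x. (g3 has_real_derivative g4 x) (at x)" and c4: "continuous_on UNIV g4"
    and bd: "\<And>x. \<bar>g x\<bar> \<le> K" "\<And>x. \<bar>g2 x\<bar> \<le> K" "\<And>x. \<bar>g4 x\<bar> \<le> B"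
    using g unfolding C4_bdd_def by blast
  have cont: "continuous_on UNIV g" "continuous_on UNIV g1" "continuous_on UNIV g2" "continuous_on UNIV g3"
    by (rule DERIV_continuous_on, rule has_field_derivative_at_within, rule g1 g2 g3 g4)+
  have K: "K \<ge> 0" and B: "B \<ge> 0" using bd[of 0] abs_ge_zero order_trans by blast+
  define v where "v = (\<lambda>t x. g x + a * (t1 - t) * g2 x - a\<^sup>2 * (t1 - t)\<^sup>2 * B / 2)"
  have main: "v (t1 - \<theta>) x0 - \<delta> * (x0\<^sup>2 + (2 * a + 1) * t1) \<le> V (t1 - \<theta>, x0)" if \<delta>: "\<delta> > 0" for \<delta>
  proof (rule ccontr)
    assume neg: "\<not> ?thesis"
    define \<phi> where "\<phi> = (\<lambda>z. v (fst z) (snd z) - \<delta> * ((snd z)\<^sup>2 + (2 * a + 1) * (t1 - fst z)))"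
    define \<phi>t where "\<phi>t = (\<lambda>z::real\<times>real. - a * g2 (snd z) + a\<^sup>2 * (t1 - fst z) * B + \<delta> * (2 * a + 1))"
    define \<phi>x where "\<phi>x = (\<lambda>z::real\<times>real. g1 (snd z) + a * (t1 - fst z) * g3 (snd z) - \<delta> * (2 * snd z))"
    define \<phi>xx where "\<phi>xx = (\<lambda>z::real\<times>real. g2 (snd z) + a * (t1 - fst z) * g4 (snd z) - \<delta> * 2)"
    have cc: "continuous_on UNIV (\<lambda>z::real\<times>real. h (snd z))" if "continuous_on UNIV h" for h :: "real \<Rightarrow> real"
      using continuous_on_compose2[OF that continuous_on_snd[OF continuous_on_id]] by auto
    have C: "C12_test \<phi> \<phi>t \<phi>x \<phi>xx"
      unfolding C12_test_def
    proof (intro conjI allI)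
      show "continuous_on UNIV \<phi>" "continuous_on UNIV \<phi>t" "continuous_on UNIV \<phi>x" "continuous_on UNIV \<phi>xx"
        unfolding \<phi>_def \<phi>t_def \<phi>x_def \<phi>xx_def v_def
        by (auto intro!: continuous_on_add continuous_on_diff continuous_on_mult continuous_on_power continuous_on_divide continuous_on_minus continuous_on_const continuous_on_fst continuous_on_snd continuous_on_id cc[OF cont(1)] cc[OF cont(2)] cc[OF cont(3)] cc[OF cont(4)] cc[OF c4])
      fix t x
      show "((\<lambda>s. \<phi> (s, x)) has_real_derivative \<phi>t (t, x)) (at t)"
        unfolding \<phi>_def \<phi>t_def v_def fst_conv snd_conv
        by (auto intro!: derivative_eq_intros simp: field_simps power2_eq_square)
      show "((\<lambda>y. \<phi> (t, y)) has_real_derivative \<phi>x (t, x)) (at x)"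
        unfolding \<phi>_def \<phi>x_def v_def fst_conv snd_conv
        by (rule DERIV_cong, (rule g1 g3 derivative_intros)+) simp
      show "((\<lambda>y. \<phi>x (t, y)) has_real_derivative \<phi>xx (t, x)) (at x)"
        unfolding \<phi>x_def \<phi>xx_def fst_conv snd_conv
        by (rule DERIV_cong, (rule g2 g4 derivative_intros)+) simp
    qed
    \<comment> \<open>Large enough that \<open>\<delta> * l\<^sup>2\<close> exceeds the supremum of
      \<open>v\<close>, so that the test function is at most \<open>0 \<le> V\<close> on the lateral
      faces.\<close>
    define l where "l = \<bar>x0\<bar> + sqrt ((K + a * t1 * K) / \<delta>) + 1"
    have pos: "(K + a * t1 * K) / \<delta> \<ge> 0" using K a t \<delta> by auto
    have l: "l \<ge> 0" "\<bar>x0\<bar> \<le> l" "sqrt ((K + a * t1 * K) / \<delta>) \<le> l" using pos by (auto simp: l_def)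
    have l2: "K + a * t1 * K \<le> \<delta> * l\<^sup>2"
    proof -
      have "(K + a * t1 * K) / \<delta> \<le> l\<^sup>2" using l(3) pos real_sqrt_le_iff sqrt_le_D by blast
      then show ?thesis using \<delta> by (simp add: field_simps)
    qed
    have vb: "v t x \<le> K + a * t1 * K" if "0 \<le> t" "t \<le> t1" for t x
    proof -
      have "a * (t1 - t) * g2 x \<le> a * t1 * K"
      proof -
        have "a * (t1 - t) * g2 x \<le> a * (t1 - t) * K" using a that bd(2)[of x] by (intro mult_left_mono) auto
        also have "\<dots> \<le> a * t1 * K" using a that K by (intro mult_right_mono mult_left_mono) auto
        finally show ?thesis .
      qed
      moreover have "a\<^sup>2 * (t1 - t)\<^sup>2 * B / 2 \<ge> 0" using B by auto
      moreover have "g x \<le> K" using bd(1)[of x] by auto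
      ultimately show ?thesis unfolding v_def by linarith
    qed
    have side: "V (t, x) - \<phi> (t, x) \<ge> 0" if "0 \<le> t" "t \<le> t1" "\<bar>x\<bar> = l" for t x
    proof -
      have "x\<^sup>2 = l\<^sup>2" using that(3) by (metis power2_abs)
      moreover have "\<delta> * ((2 * a + 1) * (t1 - t)) \<ge> 0" using \<delta> a that by auto
      ultimately have "\<phi> (t, x) \<le> 0" using vb[OF that(1,2), of x] l2 by (simp add: \<phi>_def distrib_left)
      then show ?thesis using nonneg[of t x] that t by linarith
    qed
    have top: "V (t1, x) - \<phi> (t1, x) \<ge> 0" for x
      using le[of x] \<delta> by (simp add: \<phi>_def v_def) (smt (verit) zero_le_power2 mult_nonneg_nonneg)
    have in0: "V (t1 - \<theta>, x0) - \<phi> (t1 - \<theta>, x0) < 0"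
    proof -
      have "\<delta> * ((2 * a + 1) * \<theta>) \<le> \<delta> * ((2 * a + 1) * t1)" using \<delta> a t by (intro mult_left_mono) auto
      then show ?thesis using neg by (simp add: \<phi>_def algebra_simps)
    qed
    have "\<exists>t x. 0 \<le> t \<and> t < t1 \<and> - l < x \<and> x < l \<and> subjet T V t x (\<phi>t (t, x)) (\<phi>xx (t, x))"
      by (rule box_min_subjet[OF lsc C, where ti = "t1 - \<theta>" and xi = x0]) (use t l side top in0 in auto)
    then obtain t x where tx: "0 \<le> t" "t < t1" "subjet T V t x (\<phi>t (t, x)) (\<phi>xx (t, x))" by blast
    from jet[OF tx(3)] have "0 \<le> - \<phi>t (t, x) - a * \<phi>xx (t, x)" .
    \<comment> \<open>\<open>B\<close> stems from the quadratic correction in \<open>v\<close> and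
      offsets \<open>g4 \<ge> - B\<close>; the final \<open>- \<delta>\<close> is what the time
      slope \<open>2 * a + 1\<close> leaves after the second derivative of the square has used
      \<open>2 * a\<close>.\<close>
    also have "\<dots> = - (a\<^sup>2 * (t1 - t)) * (B + g4 x) - \<delta>"
      by (simp add: \<phi>t_def \<phi>xx_def algebra_simps power2_eq_square)
    also have "\<dots> < 0"
    proof -
      have "a\<^sup>2 * (t1 - t) * (B + g4 x) \<ge> 0" using tx bd(3)[of x] by (intro mult_nonneg_nonneg) (auto simp: abs_le_iff)
      then show ?thesis using \<delta> by simp
    qed
    finally show False by simp
  qed
  have "v (t1 - \<theta>) x0 \<le> V (t1 - \<theta>, x0)"
  proof (rule field_le_epsilon)
    fix e :: real assume e: "e > 0"
    define Q where "Q = x0\<^sup>2 + (2 * a + 1) * t1 + 1"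
    have Q: "Q > 0" using a t by (auto simp: Q_def intro!: add_nonneg_pos)
    have "v (t1 - \<theta>) x0 - e / Q * (x0\<^sup>2 + (2 * a + 1) * t1) \<le> V (t1 - \<theta>, x0)" using main[of "e/Q"] e Q by simp
    moreover have "e / Q * (x0\<^sup>2 + (2 * a + 1) * t1) \<le> e / Q * Q" using e Q by (intro mult_left_mono) (auto simp: Q_def)
    ultimately show "v (t1 - \<theta>) x0 \<le> V (t1 - \<theta>, x0) + e" using Q by simp
  qed
  then show ?thesis by (simp add: v_def)
qed

section \<open>Kernels and discrete diffusion\<close>


text \<open>The class of integrands for compactly supported kernels. Continuity would be too much to
  ask: jointly in time and space \<open>V\<close> is only semicontinuous, and it is cut off at the
  ends of the time interval.\<close>

definition locally_bdd_borel :: "('a::euclidean_space \<Rightarrow> real) \<Rightarrow> bool" where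
  "locally_bdd_borel u \<longleftrightarrow> u \<in> borel_measurable borel \<and> (\<forall>R. \<exists>C. \<forall>z. norm z \<le> R \<longrightarrow> \<bar>u z\<bar> \<le> C)"

lemma locally_bdd_borel_continuous:
  assumes "continuous_on UNIV u" shows "locally_bdd_borel u"
  unfolding locally_bdd_borel_def
proof (intro conjI allI)
  show "u \<in> borel_measurable borel" using assms by (rule borel_measurable_continuous_onI)
  fix R
  have "compact (u ` cball 0 R)" using assms by (intro compact_continuous_image) (auto intro: continuous_on_subset)
  then have "bounded (u ` cball 0 R)" by (rule compact_imp_bounded)
  then show "\<exists>C. \<forall>z. norm z \<le> R \<longrightarrow> \<bar>u z\<bar> \<le> C" unfolding bounded_iff by (metis image_eqI mem_cball_0 real_norm_def)
qed

lemma integrable_times_kernel: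
  assumes u: "locally_bdd_borel u" and k: "continuous_on UNIV k" "\<And>z. R < norm z \<Longrightarrow> k z = 0"
  shows "integrable lborel (\<lambda>z. u z * k z)"
proof -
  obtain C where C: "\<And>z. norm z \<le> R \<Longrightarrow> \<bar>u z\<bar> \<le> C" using u unfolding locally_bdd_borel_def by blast
  obtain C' where C': "\<And>z. norm z \<le> R \<Longrightarrow> \<bar>k z\<bar> \<le> C'"
    using locally_bdd_borel_continuous[OF k(1)] unfolding locally_bdd_borel_def by blast
  show ?thesis
  proof (rule integrableI_bounded_set[where A = "cball 0 R" and B = "C * C'"])
    show "(\<lambda>z. u z * k z) \<in> borel_measurable lborel"
      using u borel_measurable_continuous_onI[OF k(1)] unfolding locally_bdd_borel_def by auto
    show "emeasure lborel (cball (0::'a) R) < \<infinity>" using emeasure_lborel_cball_finite[of "0::'a" R] by simp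
    show "AE z in lborel. z \<in> cball 0 R \<longrightarrow> norm (u z * k z) \<le> C * C'"
    proof (intro AE_I2 impI)
      fix z :: 'a assume "z \<in> cball 0 R"
      then have "\<bar>u z\<bar> \<le> C" "\<bar>k z\<bar> \<le> C'" using C C' by auto
      then show "norm (u z * k z) \<le> C * C'" by (auto simp: abs_mult intro!: mult_mono)
    qed
  qed (use k(2) in auto)
qed

text \<open>One constant serves all kernels supported in a given ball, so continuity and
  differentiation under the integral reduce to uniform smallness of a kernel.\<close>

lemma integral_times_kernel_bound:
  assumes u: "locally_bdd_borel u"
  obtains C where "C \<ge> 0" "\<And>k e. continuous_on UNIV k \<Longrightarrow> (\<And>z. R < norm z \<Longrightarrow> k z = 0) \<Longrightarrow> (\<And>z. \<bar>k z\<bar> \<le> e) \<Longrightarrow>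
     \<bar>LBINT z. u z * k z\<bar> \<le> C * e"
proof -
  obtain C where C: "\<And>z. norm z \<le> R \<Longrightarrow> \<bar>u z\<bar> \<le> C" using u unfolding locally_bdd_borel_def by blast
  define m where "m = measure lborel (cball (0::'a) R)"
  show thesis
  proof (rule that[of "\<bar>C\<bar> * m"])
    show "\<bar>C\<bar> * m \<ge> 0" by (simp add: m_def)
    fix k :: "'a \<Rightarrow> real" and e assume k: "continuous_on UNIV k" "\<And>z. R < norm z \<Longrightarrow> k z = 0" "\<And>z. \<bar>k z\<bar> \<le> e"
    have e: "e \<ge> 0" using k(3) abs_ge_zero order_trans by blast
    have int: "integrable lborel (\<lambda>z. u z * k z)" using integrable_times_kernel[OF u k(1,2)] .
    have fin: "integrable lborel (\<lambda>z. indicat_real (cball (0::'a) R) z * (\<bar>C\<bar> * e))"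
      using emeasure_lborel_cball_finite[of "0::'a" R]
      by (intro integrable_mult_left integrable_real_indicator) (auto simp: less_top)
    have "\<bar>LBINT z. u z * k z\<bar> \<le> (LBINT z. \<bar>u z * k z\<bar>)" by (rule integral_abs_bound)
    also have "\<dots> \<le> (LBINT z. indicat_real (cball (0::'a) R) z * (\<bar>C\<bar> * e))"
    proof (rule integral_mono)
      show "integrable lborel (\<lambda>z. \<bar>u z * k z\<bar>)" using int by simp
      show "integrable lborel (\<lambda>z. indicat_real (cball (0::'a) R) z * (\<bar>C\<bar> * e))" by (rule fin)
      fix z :: 'a
      show "\<bar>u z * k z\<bar> \<le> indicat_real (cball 0 R) z * (\<bar>C\<bar> * e)"
      proof (cases "norm z \<le> R")
        case True
        then have "\<bar>u z\<bar> \<le> \<bar>C\<bar>" using C[of z] by auto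
        then show ?thesis using True k(3)[of z] by (auto simp: abs_mult intro!: mult_mono)
      qed (use k(2) in auto)
    qed
    also have "\<dots> = \<bar>C\<bar> * m * e" by (simp add: m_def)
    finally show "\<bar>LBINT z. u z * k z\<bar> \<le> \<bar>C\<bar> * m * e" .
  qed
qed

text \<open>Uniform continuity on the compact product of the two balls; outside the second ball both
  kernels vanish.\<close>

lemma uniform_param_continuity:
  fixes \<phi> :: "'b::heine_borel \<Rightarrow> 'a::euclidean_space \<Rightarrow> real"
  assumes cont: "continuous_on UNIV (\<lambda>pz. \<phi> (fst pz) (snd pz))"
    and supp: "\<And>p z. dist p p0 \<le> 1 \<Longrightarrow> R < norm z \<Longrightarrow> \<phi> p z = 0" and e: "e > 0"
  shows "\<exists>d>0. d \<le> 1 \<and> (\<forall>p z. dist p p0 < d \<longrightarrow> \<bar>\<phi> p z - \<phi> p0 z\<bar> \<le> e)"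
proof -
  have "compact (cball p0 1 \<times> cball (0::'a) R)" by (intro compact_Times) auto
  then have "uniformly_continuous_on (cball p0 1 \<times> cball 0 R) (\<lambda>pz. \<phi> (fst pz) (snd pz))"
    using cont by (intro compact_uniformly_continuous) (auto intro: continuous_on_subset)
  then obtain d where d: "d > 0" "\<And>v w. v \<in> cball p0 1 \<times> cball 0 R \<Longrightarrow> w \<in> cball p0 1 \<times> cball 0 R \<Longrightarrow> dist w v < d \<Longrightarrow>
      dist (\<phi> (fst w) (snd w)) (\<phi> (fst v) (snd v)) < e"
    using e unfolding uniformly_continuous_on_def by metis
  show ?thesis
  proof (intro exI[of _ "min d 1"] conjI allI impI)
    fix p z assume p: "dist p p0 < min d 1"
    show "\<bar>\<phi> p z - \<phi> p0 z\<bar> \<le> e"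
    proof (cases "norm z \<le> R")
      case True
      then have "dist (\<phi> p z) (\<phi> p0 z) < e"
        using d(2)[of "(p0, z)" "(p, z)"] p by (auto simp: dist_Pair_Pair dist_commute)
      then show ?thesis by (simp add: dist_real_def)
    next
      case False
      then show ?thesis using supp[of p z] supp[of p0 z] p e by simp
    qed
  qed (use d in auto)
qed

lemma continuous_slice:
  assumes "continuous_on UNIV (\<lambda>pz. \<phi> (fst pz) (snd pz))" shows "continuous_on UNIV (\<phi> p)"
  using continuous_on_compose2[OF assms, of UNIV "\<lambda>z. (p, z)"] by (simp add: continuous_intros)

lemma continuous_on_param_integral:
  fixes \<phi> :: "'b::heine_borel \<Rightarrow> 'a::euclidean_space \<Rightarrow> real"
  assumes u: "locally_bdd_borel u"
    and cont: "continuous_on UNIV (\<lambda>pz. \<phi> (fst pz) (snd pz))"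
    and supp: "\<And>p0. \<exists>R. \<forall>p z. dist p p0 \<le> 1 \<longrightarrow> R < norm z \<longrightarrow> \<phi> p z = 0"
  shows "continuous_on UNIV (\<lambda>p. LBINT z. u z * \<phi> p z)"
  unfolding continuous_on_iff
proof (intro ballI allI impI)
  fix p0 :: 'b and e :: real assume e: "e > 0"
  obtain R where R: "\<And>p z. dist p p0 \<le> 1 \<Longrightarrow> R < norm z \<Longrightarrow> \<phi> p z = 0" using supp[of p0] by blast
  obtain C where C: "C \<ge> 0" "\<And>k e. continuous_on UNIV k \<Longrightarrow> (\<And>z. R < norm z \<Longrightarrow> k z = 0) \<Longrightarrow> (\<And>z. \<bar>k z\<bar> \<le> e) \<Longrightarrow>
     \<bar>LBINT z. u z * k z\<bar> \<le> C * e"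
    using integral_times_kernel_bound[OF u, of R] by blast
  \<comment> \<open>\<open>C\<close> may be 0, hence the division by \<open>C + 1\<close>.\<close>
  have eC: "e / (C + 1) > 0" using e C by simp
  then obtain d where d: "d > 0" "d \<le> 1" "\<And>p z. dist p p0 < d \<Longrightarrow> \<bar>\<phi> p z - \<phi> p0 z\<bar> \<le> e / (C + 1)"
    using uniform_param_continuity[of \<phi> p0 R, OF cont R eC] by blast
  show "\<exists>d>0. \<forall>x'\<in>UNIV. dist x' p0 < d \<longrightarrow> dist (LBINT z. u z * \<phi> x' z) (LBINT z. u z * \<phi> p0 z) < e"
  proof (intro exI[of _ d] conjI ballI impI)
    fix p assume p: "dist p p0 < d"
    have cs: "continuous_on UNIV (\<phi> p)" "continuous_on UNIV (\<phi> p0)" using continuous_slice[OF cont] by auto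
    have "(LBINT z. u z * \<phi> p z) - (LBINT z. u z * \<phi> p0 z) = (LBINT z. u z * (\<phi> p z - \<phi> p0 z))"
      unfolding right_diff_distrib
      by (intro Bochner_Integration.integral_diff[symmetric] integrable_times_kernel[OF u _ R] cs) (use p d in auto)
    moreover have "\<bar>LBINT z. u z * (\<phi> p z - \<phi> p0 z)\<bar> \<le> C * (e / (C + 1))"
      by (rule C(2)) (use cs p d R in \<open>auto intro!: continuous_intros\<close>)
    moreover have "C * (e / (C + 1)) < e" using C(1) e by (simp add: field_simps)
    ultimately show "dist (LBINT z. u z * \<phi> p z) (LBINT z. u z * \<phi> p0 z) < e"
      by (simp add: dist_real_def)
  qed (use d in auto)
qed

lemma DERIV_param_integral:
  fixes \<phi> \<phi>' :: "real \<Rightarrow> 'a::euclidean_space \<Rightarrow> real"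
  assumes u: "locally_bdd_borel u"
    and cont: "continuous_on UNIV (\<lambda>pz. \<phi> (fst pz) (snd pz))" "continuous_on UNIV (\<lambda>pz. \<phi>' (fst pz) (snd pz))"
    and der: "\<And>x z. ((\<lambda>x. \<phi> x z) has_real_derivative \<phi>' x z) (at x)"
    and supp: "\<exists>R. \<forall>p z. dist p x0 \<le> 1 \<longrightarrow> R < norm z \<longrightarrow> \<phi> p z = 0 \<and> \<phi>' p z = 0"
  shows "((\<lambda>x. LBINT z. u z * \<phi> x z) has_real_derivative (LBINT z. u z * \<phi>' x0 z)) (at x0)"
  unfolding has_field_derivative_def has_derivative_at_alt
proof (intro conjI allI impI)
  show "bounded_linear ((*) (LBINT z. u z * \<phi>' x0 z))" by (rule bounded_linear_mult_right)
  fix e :: real assume e: "e > 0"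
  obtain R where R: "\<And>p z. dist p x0 \<le> 1 \<Longrightarrow> R < norm z \<Longrightarrow> \<phi> p z = 0" "\<And>p z. dist p x0 \<le> 1 \<Longrightarrow> R < norm z \<Longrightarrow> \<phi>' p z = 0"
    using supp by blast
  obtain C where C: "C \<ge> 0" "\<And>k e. continuous_on UNIV k \<Longrightarrow> (\<And>z. R < norm z \<Longrightarrow> k z = 0) \<Longrightarrow> (\<And>z. \<bar>k z\<bar> \<le> e) \<Longrightarrow>
     \<bar>LBINT z. u z * k z\<bar> \<le> C * e"
    using integral_times_kernel_bound[OF u, of R] by blast
  have eC: "e / (C + 1) > 0" using e C by simp
  then obtain d where d: "d > 0" "d \<le> 1" "\<And>p z. dist p x0 < d \<Longrightarrow> \<bar>\<phi>' p z - \<phi>' x0 z\<bar> \<le> e / (C + 1)"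
    using uniform_param_continuity[of \<phi>' x0 R, OF cont(2) R(2) eC] by blast
  show "\<exists>d>0. \<forall>y. norm (y - x0) < d \<longrightarrow>
           norm ((LBINT z. u z * \<phi> y z) - (LBINT z. u z * \<phi> x0 z) - (LBINT z. u z * \<phi>' x0 z) * (y - x0))
           \<le> e * norm (y - x0)"
  proof (intro exI[of _ d] conjI allI impI)
    fix y assume "norm (y - x0) < d"
    then have y: "dist y x0 < d" by (simp add: dist_norm)
    \<comment> \<open>The error of the linear approximation is again an integral of \<open>u\<close>
      against a compactly supported kernel, namely \<open>k\<close>, which the mean value inequality
      makes small uniformly in \<open>z\<close>.\<close>
    define k where "k = (\<lambda>z. \<phi> y z - \<phi> x0 z - \<phi>' x0 z * (y - x0))"
    have cs: "continuous_on UNIV (\<phi> y)" "continuous_on UNIV (\<phi> x0)" "continuous_on UNIV (\<phi>' x0)"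
      using continuous_slice[OF cont(1)] continuous_slice[OF cont(2)] by auto
    have i1: "integrable lborel (\<lambda>z. u z * \<phi> y z)" by (rule integrable_times_kernel[OF u cs(1) R(1)]) (use y d in auto)
    have i2: "integrable lborel (\<lambda>z. u z * \<phi> x0 z)" by (rule integrable_times_kernel[OF u cs(2) R(1)]) auto
    have i3: "integrable lborel (\<lambda>z. u z * \<phi>' x0 z)" by (rule integrable_times_kernel[OF u cs(3) R(2)]) auto
    have "(LBINT z. u z * k z) = (LBINT z. u z * \<phi> y z - u z * \<phi> x0 z - (u z * \<phi>' x0 z) * (y - x0))"
      by (simp add: k_def algebra_simps)
    also have "\<dots> = (LBINT z. u z * \<phi> y z) - (LBINT z. u z * \<phi> x0 z) - (LBINT z. u z * \<phi>' x0 z) * (y - x0)"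
      using i1 i2 i3 by simp
    finally have eq: "(LBINT z. u z * k z) = \<dots>" .
    have kb: "\<bar>k z\<bar> \<le> e / (C + 1) * \<bar>y - x0\<bar>" for z
    proof -
      have "norm (\<phi> y z - \<phi>' x0 z * y - (\<phi> x0 z - \<phi>' x0 z * x0)) \<le> e / (C + 1) * norm (y - x0)"
      proof (rule field_differentiable_bound[of "ball x0 d" "\<lambda>x. \<phi> x z - \<phi>' x0 z * x" "\<lambda>x. \<phi>' x z - \<phi>' x0 z"])
        fix x assume x: "x \<in> ball x0 d"
        show "((\<lambda>x. \<phi> x z - \<phi>' x0 z * x) has_field_derivative \<phi>' x z - \<phi>' x0 z) (at x within ball x0 d)"
          by (rule has_field_derivative_at_within) (auto intro!: derivative_eq_intros der)
        show "norm (\<phi>' x z - \<phi>' x0 z) \<le> e / (C + 1)" using d(3)[of x z] x by (simp add: dist_commute)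
      qed (use y d in \<open>auto simp: dist_commute\<close>)
      then show ?thesis by (simp add: k_def algebra_simps)
    qed
    have "\<bar>LBINT z. u z * k z\<bar> \<le> C * (e / (C + 1) * \<bar>y - x0\<bar>)"
    proof (rule C(2)[OF _ _ kb])
      show "continuous_on UNIV k" unfolding k_def using cs by (intro continuous_intros)
      show "k z = 0" if "R < norm z" for z using that R y d by (simp add: k_def)
    qed
    also have "\<dots> \<le> e * \<bar>y - x0\<bar>"
    proof -
      have "C * (e / (C + 1)) \<le> e" using C(1) e by (simp add: field_simps)
      then show ?thesis by (metis abs_ge_zero mult.assoc mult_right_mono)
    qed
    finally show "norm ((LBINT z. u z * \<phi> y z) - (LBINT z. u z * \<phi> x0 z) - (LBINT z. u z * \<phi>' x0 z) * (y - x0))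
           \<le> e * norm (y - x0)" unfolding eq real_norm_def .
  qed (use d in auto)
qed

text \<open>Evenness removes first-order terms, so that semiconcavity yields a one-sided bound on
  averages. Four derivatives are carried because the second gives the mollified second derivative
  and the fourth controls the error of heat steps applied to an average.\<close>

definition kernel4 :: "real \<Rightarrow> (real \<Rightarrow> real) \<Rightarrow> (real \<Rightarrow> real) \<Rightarrow> (real \<Rightarrow> real) \<Rightarrow> (real \<Rightarrow> real) \<Rightarrow> (real \<Rightarrow> real) \<Rightarrow> bool" where
  "kernel4 h \<rho> \<rho>1 \<rho>2 \<rho>3 \<rho>4 \<longleftrightarrow> h > 0 \<and> (\<forall>y. \<rho> y \<ge> 0) \<and> (\<forall>y. \<rho> (- y) = \<rho> y) \<and>
     (\<forall>y. h < \<bar>y\<bar> \<longrightarrow> \<rho> y = 0 \<and> \<rho>1 y = 0 \<and> \<rho>2 y = 0 \<and> \<rho>3 y = 0 \<and> \<rho>4 y = 0) \<and>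
     (\<forall>y. (\<rho> has_real_derivative \<rho>1 y) (at y)) \<and> (\<forall>y. (\<rho>1 has_real_derivative \<rho>2 y) (at y)) \<and>
     (\<forall>y. (\<rho>2 has_real_derivative \<rho>3 y) (at y)) \<and> (\<forall>y. (\<rho>3 has_real_derivative \<rho>4 y) (at y)) \<and>
     continuous_on UNIV \<rho>4 \<and> (LBINT y. \<rho> y) = 1"

lemma DERIV_max_0_power:
  "((\<lambda>z::real. (max 0 z) ^ (n + 2)) has_real_derivative real (n + 2) * (max 0 z) ^ (n + 1)) (at z)"
proof (cases "z = 0")
  case False
  have "((\<lambda>z::real. max 0 z) has_real_derivative (if z > 0 then 1 else 0)) (at z)"
  proof (cases "z > 0")
    case True
    have "((\<lambda>z. z) has_real_derivative 1) (at z)" by simp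
    then show ?thesis using True
      by (auto intro: has_field_derivative_transform_within_open[of "\<lambda>z. z" _ _ "{0<..}"])
  next
    case False
    with \<open>z \<noteq> 0\<close> have "z < 0" by simp
    have "((\<lambda>z. 0) has_real_derivative 0) (at z)" by simp
    then show ?thesis using \<open>z < 0\<close> False
      by (auto intro: has_field_derivative_transform_within_open[of "\<lambda>z. 0" _ _ "{..<0}"])
  qed
  from DERIV_power[OF this, of "n + 2"] show ?thesis using False by (cases "z > 0") simp_all
next
  case True
  have "((\<lambda>h. ((max 0 (0 + h)) ^ (n + 2) - (max 0 0) ^ (n + 2)) / h) \<longlongrightarrow> (0::real)) (at 0)"
  proof (rule Lim_null_comparison[where g = "\<lambda>h. \<bar>h\<bar> ^ (n + 1)"])
    have "norm ((max 0 h ^ (n + 2)) / h) \<le> \<bar>h\<bar> ^ (n + 1)" for h :: real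
    proof (cases "h > 0")
      case False
      then have "max 0 h ^ (n + 2) = 0" by simp
      then show ?thesis by (simp only: div_0 norm_zero zero_le_power abs_ge_zero)
    qed (auto simp: field_simps)
    then show "\<forall>\<^sub>F h in at (0::real). norm (((max 0 (0 + h)) ^ (n + 2) - (max 0 0) ^ (n + 2)) / h) \<le> \<bar>h\<bar> ^ (n + 1)"
      by simp
    show "((\<lambda>h. \<bar>h\<bar> ^ (n + 1)) \<longlongrightarrow> (0::real)) (at 0)" by (auto intro!: tendsto_eq_intros)
  qed
  then show ?thesis using True by (simp add: DERIV_def)
qed

text \<open>A normalised sixth power of the truncated parabola
  \<open>max 0 (h\<^sup>2 - y\<^sup>2)\<close>: after four differentiations every term still
  contains a factor \<open>m y ^ 2\<close>, so the fourth derivative is continuous across the edge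
  of the support.\<close>

lemma kernel4_exists:
  assumes h: "h > 0" shows "\<exists>\<rho> \<rho>1 \<rho>2 \<rho>3 \<rho>4. kernel4 h \<rho> \<rho>1 \<rho>2 \<rho>3 \<rho>4"
proof -
  define m where "m = (\<lambda>y. max 0 (h\<^sup>2 - y\<^sup>2))"
  have dm: "((\<lambda>y. m y ^ (n + 2)) has_real_derivative real (n + 2) * m y ^ (n + 1) * (- 2 * y)) (at y)" for n y
    unfolding m_def
    by (rule DERIV_chain2[OF DERIV_max_0_power]) (auto intro!: derivative_eq_intros)
  have m6: "((\<lambda>y. m y ^ 6) has_real_derivative 6 * m y ^ 5 * (- 2 * y)) (at y)" for y using dm[of 4 y] by simp
  have m5: "((\<lambda>y. m y ^ 5) has_real_derivative 5 * m y ^ 4 * (- 2 * y)) (at y)" for y using dm[of 3 y] by simp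
  have m4: "((\<lambda>y. m y ^ 4) has_real_derivative 4 * m y ^ 3 * (- 2 * y)) (at y)" for y using dm[of 2 y] by simp
  have m3: "((\<lambda>y. m y ^ 3) has_real_derivative 3 * m y ^ 2 * (- 2 * y)) (at y)" for y using dm[of 1 y] by (simp add: numeral_3_eq_3 numeral_2_eq_2)
  have cm: "continuous_on UNIV m" unfolding m_def by (intro continuous_intros)
  have m0: "m y = 0" if "h < \<bar>y\<bar>" for y
    using that h power_mono[of h "\<bar>y\<bar>" 2] by (simp add: m_def)
  have int: "integrable lborel (\<lambda>y. 1 * m y ^ 6)"
    by (rule integrable_times_kernel[where R = h])
       (use m0 cm in \<open>auto intro!: continuous_intros locally_bdd_borel_continuous\<close>)
  define Z where "Z = (LBINT y. m y ^ 6)"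
  \<comment> \<open>The normalising constant is positive because the parabola is at least
    \<open>h\<^sup>2 / 2\<close> on the middle half of the support.\<close>
  have "(LBINT y. indicat_real {-h/2..h/2} y * (h\<^sup>2/2) ^ 6) \<le> Z"
    unfolding Z_def
  proof (rule integral_mono)
    show "integrable lborel (\<lambda>y. m y ^ 6)" using int by simp
    show "integrable lborel (\<lambda>y. indicat_real {-h/2..h/2} y * (h\<^sup>2/2) ^ 6)"
      by (intro integrable_mult_left integrable_real_indicator) (simp_all add: emeasure_lborel_Icc_eq)
    fix y
    have "m y \<ge> 0" by (simp add: m_def)
    moreover have "h\<^sup>2/2 \<le> m y" if "y \<in> {-h/2..h/2}"
    proof -
      have "\<bar>y\<bar> \<le> h / 2" using that by auto
      then have "y\<^sup>2 \<le> (h/2)\<^sup>2" using h abs_le_square_iff[of y "h/2"] by simp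
      then have "y\<^sup>2 \<le> h\<^sup>2 / 4" by (simp add: power_divide)
      then have "h\<^sup>2 / 2 \<le> h\<^sup>2 - y\<^sup>2" using zero_le_power2[of h] by linarith
      then show ?thesis unfolding m_def by linarith
    qed
    ultimately show "indicat_real {-h/2..h/2} y * (h\<^sup>2/2) ^ 6 \<le> m y ^ 6"
      by (cases "y \<in> {-h/2..h/2}") (auto intro!: power_mono)
  qed
  moreover have "(LBINT y. indicat_real {-h/2..h/2} y * (h\<^sup>2/2) ^ 6) = h * (h\<^sup>2/2) ^ 6"
    using h by simp
  moreover have "h * (h\<^sup>2/2) ^ 6 > 0" using h by simp
  ultimately have Z: "Z > 0" by linarith
  define \<rho> where "\<rho> = (\<lambda>y. m y ^ 6 / Z)"
  define \<rho>1 where "\<rho>1 = (\<lambda>y. - 12 * (m y ^ 5 * y) / Z)"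
  define \<rho>2 where "\<rho>2 = (\<lambda>y. (120 * (m y ^ 4 * y ^ 2) - 12 * m y ^ 5) / Z)"
  define \<rho>3 where "\<rho>3 = (\<lambda>y. (- 960 * (m y ^ 3 * y ^ 3) + 360 * (m y ^ 4 * y)) / Z)"
  define \<rho>4 where "\<rho>4 = (\<lambda>y. (5760 * (m y ^ 2 * y ^ 4) - 5760 * (m y ^ 3 * y ^ 2) + 360 * m y ^ 4) / Z)"
  have "kernel4 h \<rho> \<rho>1 \<rho>2 \<rho>3 \<rho>4"
    unfolding kernel4_def
  proof (intro conjI allI impI)
    show "h > 0" by fact
    show "\<rho> y \<ge> 0" for y using Z by (simp add: \<rho>_def)
    show "\<rho> (- y) = \<rho> y" for y by (simp add: \<rho>_def m_def)
    fix y :: real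
    show "h < \<bar>y\<bar> \<Longrightarrow> \<rho> y = 0" "h < \<bar>y\<bar> \<Longrightarrow> \<rho>1 y = 0" "h < \<bar>y\<bar> \<Longrightarrow> \<rho>2 y = 0" "h < \<bar>y\<bar> \<Longrightarrow> \<rho>3 y = 0" "h < \<bar>y\<bar> \<Longrightarrow> \<rho>4 y = 0"
      using m0[of y] by (auto simp: \<rho>_def \<rho>1_def \<rho>2_def \<rho>3_def \<rho>4_def)
    show "(\<rho> has_real_derivative \<rho>1 y) (at y)" unfolding \<rho>_def \<rho>1_def
      by (rule DERIV_cong, rule DERIV_cdivide, rule m6) simp
    show "(\<rho>1 has_real_derivative \<rho>2 y) (at y)" unfolding \<rho>1_def \<rho>2_def
      by (rule DERIV_cong, rule DERIV_cdivide, (rule m5 derivative_intros)+) (simp add: power2_eq_square)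
    show "(\<rho>2 has_real_derivative \<rho>3 y) (at y)" unfolding \<rho>2_def \<rho>3_def
      by (rule DERIV_cong, rule DERIV_cdivide, (rule m5 m4 derivative_intros)+) (simp add: power2_eq_square power3_eq_cube algebra_simps)
    show "(\<rho>3 has_real_derivative \<rho>4 y) (at y)" unfolding \<rho>3_def \<rho>4_def
      by (rule DERIV_cong, rule DERIV_cdivide, (rule m4 m3 derivative_intros)+) (simp add: power2_eq_square power3_eq_cube power4_eq_xxxx algebra_simps)
    show "continuous_on UNIV \<rho>4" unfolding \<rho>4_def using Z by (auto intro!: continuous_intros cm)
    show "(LBINT y. \<rho> y) = 1" unfolding \<rho>_def using Z by (simp add: Z_def[symmetric])
  qed
  then show ?thesis by blast
qed

section \<open>Random-walk approximation of the heat flow\<close>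

text \<open>One step of the symmetric random walk with step length \<open>d\<close>. With
  \<open>d = sqrt (2 * a * \<theta>)\<close> it imitates the flow generated by \<open>a\<close>
  times the second derivative over time \<open>\<theta>\<close>; it preserves sup bounds on all
  derivatives and commutes with convolution.\<close>

definition diffuse :: "real \<Rightarrow> (real \<Rightarrow> real) \<Rightarrow> real \<Rightarrow> real" where
  "diffuse d g x = (g (x + d) + g (x - d)) / 2"

text \<open>Symmetry cancels the first-order term, leaving the mean of two second-order Lagrange
  remainders.\<close>

lemma taylor_symmetric2:
  assumes "\<And>x. (g has_real_derivative g1 x) (at x)" "\<And>x. (g1 has_real_derivative g2 x) (at x)" "\<And>x. \<bar>g2 x\<bar> \<le> B"
  shows "\<bar>diffuse d g x - g x\<bar> \<le> d\<^sup>2 * B / 2"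
proof (cases "d = 0")
  case False
  define D where "D = (\<lambda>m::nat. if m = 0 then g else if m = 1 then g1 else g2)"
  have ex: "\<exists>t. g (x + e) = g x + g1 x * e + g2 t / 2 * e\<^sup>2" if "e \<noteq> 0" for e
  proof -
    have "\<exists>t. (if x + e < x then x + e < t \<and> t < x else x < t \<and> t < x + e) \<and>
       g (x + e) = (\<Sum>m<2. D m x / fact m * (x + e - x) ^ m) + D 2 t / fact 2 * (x + e - x) ^ 2"
    proof (rule Taylor[of 2 D g "min x (x+e)" "max x (x+e)"])
      show "\<forall>m t. m < 2 \<and> min x (x + e) \<le> t \<and> t \<le> max x (x + e) \<longrightarrow> DERIV (D m) t :> D (Suc m) t"
        using assms by (auto simp: D_def less_2_cases_iff)
    qed (use that in \<open>auto simp: D_def\<close>)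
    then show ?thesis by (auto simp: D_def numeral_2_eq_2)
  qed
  obtain t s where "g (x + d) = g x + g1 x * d + g2 t / 2 * d\<^sup>2" "g (x + (-d)) = g x + g1 x * (-d) + g2 s / 2 * (-d)\<^sup>2"
    using ex[of d] ex[of "-d"] False by auto
  then have "diffuse d g x - g x = d\<^sup>2 * ((g2 t + g2 s) / 4)" by (simp add: diffuse_def field_simps)
  moreover have "\<bar>(g2 t + g2 s) / 4\<bar> \<le> B / 2" using assms(3)[of t] assms(3)[of s] by auto
  then have "\<bar>d\<^sup>2 * ((g2 t + g2 s) / 4)\<bar> \<le> d\<^sup>2 * (B / 2)" unfolding abs_mult abs_power2 by (rule mult_left_mono) simp
  ultimately show ?thesis by linarith
qed (use assms(3)[of 0] in \<open>simp add: diffuse_def\<close>)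

lemma taylor_symmetric4:
  assumes "C4_bdd K B g g2"
  shows "\<bar>diffuse d g x - g x - d\<^sup>2 / 2 * g2 x\<bar> \<le> d ^ 4 * B / 24"
proof -
  obtain g1 g3 g4 where g: "\<And>x. (g has_real_derivative g1 x) (at x)" "\<And>x. (g1 has_real_derivative g2 x) (at x)"
    "\<And>x. (g2 has_real_derivative g3 x) (at x)" "\<And>x. (g3 has_real_derivative g4 x) (at x)" "\<And>x. \<bar>g4 x\<bar> \<le> B"
    using assms unfolding C4_bdd_def by blast
  show ?thesis
  proof (cases "d = 0")
    case False
    define D where "D = (\<lambda>m::nat. if m = 0 then g else if m = 1 then g1 else if m = 2 then g2 else if m = 3 then g3 else g4)"
    have ex: "\<exists>t. g (x + e) = g x + g1 x * e + g2 x / 2 * e\<^sup>2 + g3 x / 6 * e ^ 3 + g4 t / 24 * e ^ 4" if "e \<noteq> 0" for e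
    proof -
      have "\<exists>t. (if x + e < x then x + e < t \<and> t < x else x < t \<and> t < x + e) \<and>
         g (x + e) = (\<Sum>m<4. D m x / fact m * (x + e - x) ^ m) + D 4 t / fact 4 * (x + e - x) ^ 4"
      proof (rule Taylor[of 4 D g "min x (x+e)" "max x (x+e)"])
        have "DERIV (D m) t :> D (Suc m) t" if "m < 4" for m t
        proof -
          have "m = 0 \<or> m = 1 \<or> m = 2 \<or> m = 3" using that by auto
          then show ?thesis using g by (auto simp: D_def)
        qed
        then show "\<forall>m t. m < 4 \<and> min x (x + e) \<le> t \<and> t \<le> max x (x + e) \<longrightarrow> DERIV (D m) t :> D (Suc m) t"
          by blast
      qed (use that in \<open>auto simp: D_def\<close>)
      then show ?thesis by (auto simp: D_def eval_nat_numeral)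
    qed
    obtain t s where "g (x + d) = g x + g1 x * d + g2 x / 2 * d\<^sup>2 + g3 x / 6 * d ^ 3 + g4 t / 24 * d ^ 4"
      "g (x + (-d)) = g x + g1 x * (-d) + g2 x / 2 * (-d)\<^sup>2 + g3 x / 6 * (-d) ^ 3 + g4 s / 24 * (-d) ^ 4"
      using ex[of d] ex[of "-d"] False by auto
    then have "diffuse d g x - g x - d\<^sup>2 / 2 * g2 x = d ^ 4 * ((g4 t + g4 s) / 48)" by (simp add: diffuse_def field_simps)
    moreover have "\<bar>(g4 t + g4 s) / 48\<bar> \<le> B / 24" using g(5)[of t] g(5)[of s] by auto
    then have "\<bar>d ^ 4\<bar> * \<bar>(g4 t + g4 s) / 48\<bar> \<le> \<bar>d ^ 4\<bar> * (B / 24)" by (rule mult_left_mono) simp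
    then have "\<bar>d ^ 4 * ((g4 t + g4 s) / 48)\<bar> \<le> d ^ 4 * (B / 24)" unfolding abs_mult[symmetric] by simp
    ultimately show ?thesis by linarith
  qed (simp add: diffuse_def)
qed

lemma C4_bdd_diffuse:
  assumes "C4_bdd K B g g2" shows "C4_bdd K B (diffuse d g) (diffuse d g2)"
proof -
  obtain g1 g3 g4 where g: "\<And>x. (g has_real_derivative g1 x) (at x)" "\<And>x. (g1 has_real_derivative g2 x) (at x)"
    "\<And>x. (g2 has_real_derivative g3 x) (at x)" "\<And>x. (g3 has_real_derivative g4 x) (at x)" "continuous_on UNIV g4"
    and bd: "\<And>x. \<bar>g x\<bar> \<le> K" "\<And>x. \<bar>g2 x\<bar> \<le> K" "\<And>x. \<bar>g4 x\<bar> \<le> B"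
    using assms unfolding C4_bdd_def by blast
  have D: "(diffuse d p has_real_derivative diffuse d q x) (at x)" if "\<And>x. (p has_real_derivative q x) (at x)" for p q x
    unfolding diffuse_def[abs_def]
    by (rule DERIV_cong[OF DERIV_cdivide[OF DERIV_add[OF DERIV_chain2[OF that] DERIV_chain2[OF that]]]])
       (auto intro!: derivative_eq_intros)
  have b: "\<bar>diffuse d p x\<bar> \<le> c" if "\<And>x. \<bar>p x\<bar> \<le> c" for p c x
    using that[of "x+d"] that[of "x-d"] by (auto simp: diffuse_def)
  have c: "continuous_on UNIV (diffuse d g4)"
    unfolding diffuse_def[abs_def] by (intro continuous_intros continuous_on_compose2[OF g(5)]) auto
  show ?thesis unfolding C4_bdd_def
    by (intro exI[of _ "diffuse d g1"] exI[of _ "diffuse d g3"] exI[of _ "diffuse d g4"] conjI allI D g c b bd)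
qed

lemma C4_bdd_minus_const:
  assumes "C4_bdd K B g g2" shows "C4_bdd (K + \<bar>c\<bar>) B (\<lambda>x. g x - c) g2"
proof -
  obtain g1 g3 g4 where g: "\<And>x. (g has_real_derivative g1 x) (at x)" "\<And>x. (g1 has_real_derivative g2 x) (at x)"
    "\<And>x. (g2 has_real_derivative g3 x) (at x)" "\<And>x. (g3 has_real_derivative g4 x) (at x)" "continuous_on UNIV g4"
    and bd: "\<And>x. \<bar>g x\<bar> \<le> K" "\<And>x. \<bar>g2 x\<bar> \<le> K" "\<And>x. \<bar>g4 x\<bar> \<le> B"
    using assms unfolding C4_bdd_def by blast
  have d1: "((\<lambda>x. g x - c) has_real_derivative g1 x) (at x)" for x using DERIV_diff[OF g(1) DERIV_const[of c]] by simp
  have b1: "\<bar>g x - c\<bar> \<le> K + \<bar>c\<bar>" for x using bd(1)[of x] by linarith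
  have b2: "\<bar>g2 x\<bar> \<le> K + \<bar>c\<bar>" for x using bd(2)[of x] by linarith
  show ?thesis unfolding C4_bdd_def using d1 g b1 b2 bd by blast
qed

lemma C4_bdd_diffuse_iterate: "C4_bdd K B g g2 \<Longrightarrow> C4_bdd K B ((diffuse d ^^ n) g) ((diffuse d ^^ n) g2)"
  by (induction n) (auto intro: C4_bdd_diffuse)

text \<open>\<open>diffuse\<close> does not increase the bound \<open>B\<close> on the fourth derivative, so \<open>n\<close> steps of length \<open>S / n\<close>
  lose only \<open>O(1 / n)\<close> in total.\<close>

lemma heat_step_iterate:
  assumes lsc: "lsc_on ({0..<T} \<times> UNIV) V" and a: "a \<ge> 0"
    and jet: "\<And>t x q M. subjet T V t x q M \<Longrightarrow> - q - a * M \<ge> 0"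
    and nonneg: "\<And>t x. 0 \<le> t \<Longrightarrow> t < T \<Longrightarrow> V (t, x) \<ge> 0"
    and g: "C4_bdd K B g g2" and t: "t1 < T" "0 \<le> \<theta>"
    and le: "\<And>x. g x \<le> V (t1, x)"
  shows "real n * \<theta> \<le> t1 \<Longrightarrow>
    (diffuse (sqrt (2 * a * \<theta>)) ^^ n) g x - real n * (a\<^sup>2 * \<theta>\<^sup>2 * B) \<le> V (t1 - real n * \<theta>, x)"
proof (induction n arbitrary: x)
  case 0
  then show ?case using le by simp
next
  case (Suc n)
  define d where "d = sqrt (2 * a * \<theta>)"
  have d2: "d\<^sup>2 = 2 * a * \<theta>" using a t by (simp add: d_def)
  then have d4: "d ^ 4 = (2 * a * \<theta>)\<^sup>2" by (metis power2_eq_square power4_eq_xxxx mult.assoc)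
  have B: "B \<ge> 0" using g unfolding C4_bdd_def by (meson abs_ge_zero order_trans)
  define c where "c = real n * (a\<^sup>2 * \<theta>\<^sup>2 * B)"
  define G where "G = (\<lambda>x. (diffuse d ^^ n) g x - c)"
  define G2 where "G2 = (diffuse d ^^ n) g2"
  have CG: "C4_bdd (K + \<bar>c\<bar>) B G G2" unfolding G_def G2_def by (intro C4_bdd_minus_const C4_bdd_diffuse_iterate g)
  have nt: "real n * \<theta> \<le> t1" "\<theta> \<le> t1 - real n * \<theta>" using Suc.prems t by (auto simp: algebra_simps)
  have "G x + a * \<theta> * G2 x - a\<^sup>2 * \<theta>\<^sup>2 * B / 2 \<le> V (t1 - real n * \<theta> - \<theta>, x)"
  proof (rule heat_step[OF lsc a jet nonneg CG])
    show "t1 - real n * \<theta> < T" using t mult_nonneg_nonneg[of "real n" \<theta>] by linarith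
    show "G x \<le> V (t1 - real n * \<theta>, x)" for x using Suc.IH[OF nt(1)] by (simp add: G_def c_def d_def)
  qed (use t nt in auto)
  moreover have "diffuse d G x \<le> G x + d\<^sup>2 / 2 * G2 x + d ^ 4 * B / 24" using taylor_symmetric4[OF CG, of d x] by linarith
  \<comment> \<open>The Taylor error of one random-walk step is
    \<open>a\<^sup>2 * \<theta>\<^sup>2 * B / 6\<close>; added to the
    \<open>a\<^sup>2 * \<theta>\<^sup>2 * B / 2\<close> lost in \<open>heat_step\<close> it stays
    below \<open>a\<^sup>2 * \<theta>\<^sup>2 * B\<close>.\<close>
  moreover have "d ^ 4 * B / 24 \<le> a\<^sup>2 * \<theta>\<^sup>2 * B / 2" unfolding d4 using B by (simp add: power_mult_distrib field_simps)
  moreover have "diffuse d G x = (diffuse d ^^ Suc n) g x - c" by (simp add: G_def diffuse_def field_simps)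
  moreover have "t1 - real (Suc n) * \<theta> = t1 - real n * \<theta> - \<theta>" by (simp add: algebra_simps)
  moreover have "a * \<theta> * G2 x = d\<^sup>2 / 2 * G2 x" using d2 by simp
  moreover have "real (Suc n) * (a\<^sup>2 * \<theta>\<^sup>2 * B) = c + a\<^sup>2 * \<theta>\<^sup>2 * B" by (simp add: c_def algebra_simps)
  ultimately show ?case unfolding d_def[symmetric] by (simp only:)
qed

text \<open>A first-order expansion in the total time \<open>real n * \<theta>\<close> whose error
  does not depend on the number of steps. It is meant for the average against the fixed kernel, so
  that \<open>B\<close> here is unrelated to the possibly huge bound for the datum of the
  walk.\<close>

lemma diffuse_iterate_lower:
  assumes G: "C4_bdd K B G G2" and a: "a \<ge> 0" "\<theta> \<ge> 0"
  shows "G x + a * (real n * \<theta>) * G2 x - a\<^sup>2 * (real n * \<theta>)\<^sup>2 * B \<le> (diffuse (sqrt (2 * a * \<theta>)) ^^ n) G x"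
proof (induction n arbitrary: x)
  case (Suc n)
  define d where "d = sqrt (2 * a * \<theta>)"
  have d2: "d\<^sup>2 = 2 * a * \<theta>" using a by (simp add: d_def)
  then have d4: "d ^ 4 = (2 * a * \<theta>)\<^sup>2" by (metis power2_eq_square power4_eq_xxxx mult.assoc)
  have B: "B \<ge> 0" using G unfolding C4_bdd_def by (meson abs_ge_zero order_trans)
  define H where "H = (\<lambda>x. G x + a * (real n * \<theta>) * G2 x - a\<^sup>2 * (real n * \<theta>)\<^sup>2 * B)"
  have "diffuse d H x \<le> diffuse d ((diffuse d ^^ n) G) x"
    using Suc.IH[of "x+d"] Suc.IH[of "x-d"] unfolding diffuse_def[of d H] diffuse_def[of d "(diffuse d ^^ n) G"] unfolding H_def d_def by argo
  moreover have "diffuse d H x = diffuse d G x + a * (real n * \<theta>) * diffuse d G2 x - a\<^sup>2 * (real n * \<theta>)\<^sup>2 * B"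
    by (simp add: diffuse_def H_def field_simps)
  moreover have "diffuse d G x \<ge> G x + a * \<theta> * G2 x - a\<^sup>2 * \<theta>\<^sup>2 * B"
  proof -
    have "d ^ 4 * B / 24 \<le> a\<^sup>2 * \<theta>\<^sup>2 * B" unfolding d4 using B by (simp add: power_mult_distrib field_simps)
    moreover have "d\<^sup>2 / 2 * G2 x = a * \<theta> * G2 x" using d2 by simp
    ultimately show ?thesis using taylor_symmetric4[OF G, of d x] by linarith
  qed
  moreover have "a * (real n * \<theta>) * diffuse d G2 x \<ge> a * (real n * \<theta>) * (G2 x - a * \<theta> * B)"
  proof (rule mult_left_mono)
    obtain G3 G4 where "\<And>x. (G2 has_real_derivative G3 x) (at x)" "\<And>x. (G3 has_real_derivative G4 x) (at x)" "\<And>x. \<bar>G4 x\<bar> \<le> B"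
      using G unfolding C4_bdd_def by blast
    from taylor_symmetric2[OF this, of d x] show "G2 x - a * \<theta> * B \<le> diffuse d G2 x" using d2 by (simp add: abs_le_iff)
  qed (use a in auto)
  \<comment> \<open>Passing from \<open>n\<^sup>2\<close> to \<open>(n + 1)\<^sup>2\<close> provides
    \<open>2 * n + 1\<close> units of error, of which the induction step spends
    \<open>n + 1\<close>.\<close>
  moreover have "a * (real n * \<theta>) * (G2 x - a * \<theta> * B) + (a * \<theta> * G2 x - a\<^sup>2 * \<theta>\<^sup>2 * B) - a\<^sup>2 * (real n * \<theta>)\<^sup>2 * B
     \<ge> a * (real (Suc n) * \<theta>) * G2 x - a\<^sup>2 * (real (Suc n) * \<theta>)\<^sup>2 * B"
  proof -
    have "a * (real n * \<theta>) * (G2 x - a * \<theta> * B) + (a * \<theta> * G2 x - a\<^sup>2 * \<theta>\<^sup>2 * B) - a\<^sup>2 * (real n * \<theta>)\<^sup>2 * B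
      - (a * (real (Suc n) * \<theta>) * G2 x - a\<^sup>2 * (real (Suc n) * \<theta>)\<^sup>2 * B) = a\<^sup>2 * \<theta>\<^sup>2 * B * real n"
      by (simp add: algebra_simps power2_eq_square)
    moreover have "a\<^sup>2 * \<theta>\<^sup>2 * B * real n \<ge> 0" using B by simp
    ultimately show ?thesis by linarith
  qed
  ultimately have "G x + a * (real (Suc n) * \<theta>) * G2 x - a\<^sup>2 * (real (Suc n) * \<theta>)\<^sup>2 * B \<le> diffuse d ((diffuse d ^^ n) G) x"
    by linarith
  then show ?case by (simp add: d_def)
qed simp



section \<open>Averages over space\<close>

definition compact_kernel :: "real \<Rightarrow> (real \<Rightarrow> real) \<Rightarrow> bool" where
  "compact_kernel h k \<longleftrightarrow> continuous_on UNIV k \<and> (\<forall>y. h < \<bar>y\<bar> \<longrightarrow> k y = 0)"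

lemma kernel4_compact:
  assumes "kernel4 h \<rho> \<rho>1 \<rho>2 \<rho>3 \<rho>4"
  shows "compact_kernel h \<rho>" "compact_kernel h \<rho>1" "compact_kernel h \<rho>2" "compact_kernel h \<rho>3" "compact_kernel h \<rho>4"
proof -
  have c: "continuous_on UNIV p" if "\<And>y. (p has_real_derivative q y) (at y)" for p q :: "real \<Rightarrow> real"
    by (rule DERIV_continuous_on, rule has_field_derivative_at_within, rule that)
  have "continuous_on UNIV \<rho>" by (rule c[of _ \<rho>1]) (use assms in \<open>simp add: kernel4_def\<close>)
  moreover have "continuous_on UNIV \<rho>1" by (rule c[of _ \<rho>2]) (use assms in \<open>simp add: kernel4_def\<close>)
  moreover have "continuous_on UNIV \<rho>2" by (rule c[of _ \<rho>3]) (use assms in \<open>simp add: kernel4_def\<close>)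
  moreover have "continuous_on UNIV \<rho>3" by (rule c[of _ \<rho>4]) (use assms in \<open>simp add: kernel4_def\<close>)
  ultimately show "compact_kernel h \<rho>" "compact_kernel h \<rho>1" "compact_kernel h \<rho>2" "compact_kernel h \<rho>3" "compact_kernel h \<rho>4"
    using assms unfolding compact_kernel_def kernel4_def by blast+
qed

lemma compact_kernel_integrable:
  assumes "locally_bdd_borel u" "compact_kernel h k"
  shows "integrable lborel (\<lambda>y. u y * k y)"
  using integrable_times_kernel[of u k h] assms unfolding compact_kernel_def by auto

lemma compact_kernel_abs: "compact_kernel h k \<Longrightarrow> compact_kernel h (\<lambda>y. \<bar>k y\<bar>)"
  unfolding compact_kernel_def by (auto intro!: continuous_intros)

lemma locally_bdd_borel_translate:
  fixes u :: "'a::euclidean_space \<Rightarrow> real"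
  assumes "locally_bdd_borel u" shows "locally_bdd_borel (\<lambda>y. u (x + y))"
  unfolding locally_bdd_borel_def
proof (intro conjI allI)
  have [measurable]: "u \<in> borel_measurable borel" using assms unfolding locally_bdd_borel_def by simp
  show "(\<lambda>y. u (x + y)) \<in> borel_measurable borel" by measurable
  fix R
  obtain C where C: "\<And>z. norm z \<le> norm x + R \<Longrightarrow> \<bar>u z\<bar> \<le> C" using assms unfolding locally_bdd_borel_def by blast
  have "\<bar>u (x + z)\<bar> \<le> C" if "norm z \<le> R" for z
    using norm_triangle_ineq[of x z] that by (intro C) linarith
  then show "\<exists>C. \<forall>z. norm z \<le> R \<longrightarrow> \<bar>u (x + z)\<bar> \<le> C" by blast
qed

lemma locally_bdd_borel_const [simp]: "locally_bdd_borel (\<lambda>y. c)"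
  by (intro locally_bdd_borel_continuous continuous_intros)

lemma locally_bdd_borel_diff:
  assumes "locally_bdd_borel u" "locally_bdd_borel w" shows "locally_bdd_borel (\<lambda>y. u y - w y)"
  unfolding locally_bdd_borel_def
proof (intro conjI allI)
  show "(\<lambda>y. u y - w y) \<in> borel_measurable borel" using assms unfolding locally_bdd_borel_def by auto
  fix R
  obtain C D where "\<And>z. norm z \<le> R \<Longrightarrow> \<bar>u z\<bar> \<le> C" "\<And>z. norm z \<le> R \<Longrightarrow> \<bar>w z\<bar> \<le> D"
    using assms unfolding locally_bdd_borel_def by metis
  then have "\<bar>u z - w z\<bar> \<le> C + D" if "norm z \<le> R" for z
    using that by (smt (verit))
  then show "\<exists>C. \<forall>z. norm z \<le> R \<longrightarrow> \<bar>u z - w z\<bar> \<le> C" by blast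
qed

lemma compact_kernel_diff_bound:
  assumes u: "locally_bdd_borel u" "locally_bdd_borel w" and k: "compact_kernel h k"
    and le: "\<And>y. \<bar>y\<bar> \<le> h \<Longrightarrow> \<bar>u y - w y\<bar> \<le> e"
  shows "\<bar>(LBINT y. u y * k y) - (LBINT y. w y * k y)\<bar> \<le> e * (LBINT y. \<bar>k y\<bar>)"
proof -
  have "(LBINT y. u y * k y) - (LBINT y. w y * k y) = (LBINT y. (u y - w y) * k y)"
    unfolding left_diff_distrib
    by (intro Bochner_Integration.integral_diff[symmetric] compact_kernel_integrable[OF u(1) k] compact_kernel_integrable[OF u(2) k])
  moreover have "\<bar>LBINT y. (u y - w y) * k y\<bar> \<le> (LBINT y. \<bar>(u y - w y) * k y\<bar>)"
    by (rule integral_abs_bound)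
  moreover have "(LBINT y. \<bar>(u y - w y) * k y\<bar>) \<le> (LBINT y. e * \<bar>k y\<bar>)"
  proof (rule integral_mono)
    show "integrable lborel (\<lambda>y. \<bar>(u y - w y) * k y\<bar>)"
      using compact_kernel_integrable[OF locally_bdd_borel_diff[OF u] k] by simp
    show "integrable lborel (\<lambda>y. e * \<bar>k y\<bar>)"
      by (rule compact_kernel_integrable[OF _ compact_kernel_abs[OF k]]) simp
    show "\<bar>(u y - w y) * k y\<bar> \<le> e * \<bar>k y\<bar>" for y
      using le[of y] k unfolding compact_kernel_def by (cases "\<bar>y\<bar> \<le> h") (auto simp: abs_mult intro!: mult_right_mono)
  qed
  moreover have "(LBINT y. e * \<bar>k y\<bar>) = e * (LBINT y. \<bar>k y\<bar>)" by simp
  ultimately show ?thesis by linarith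
qed

lemma conv_translate:
  "(LBINT y. u (x + y) * k y) = (LBINT y. u y * k (y - x))" for u k :: "real \<Rightarrow> real"
  using lborel_integral_real_affine[of 1 "\<lambda>y. u y * k (y - x)" x] by simp

text \<open>\<open>u\<close> is sampled at \<open>x + y\<close>, so after translation the derivative
  falls on \<open>k (y - x)\<close> and brings a minus sign; two derivatives restore the
  sign.\<close>

lemma DERIV_conv:
  assumes u: "locally_bdd_borel u" and k: "compact_kernel h k" "compact_kernel h k'"
    and der: "\<And>y. (k has_real_derivative k' y) (at y)"
  shows "((\<lambda>x. LBINT y. u (x + y) * k y) has_real_derivative - (LBINT y. u (x + y) * k' y)) (at x)"
proof -
  have c: "continuous_on UNIV k" "continuous_on UNIV k'" using k unfolding compact_kernel_def by auto
  have "((\<lambda>x. LBINT y. u y * k (y - x)) has_real_derivative (LBINT y. u y * (- k' (y - x)))) (at x)"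
  proof (rule DERIV_param_integral[OF u])
    show "continuous_on UNIV (\<lambda>pz. k (snd pz - fst pz))"
      by (intro continuous_on_compose2[OF c(1)] continuous_intros) auto
    show "continuous_on UNIV (\<lambda>pz. - k' (snd pz - fst pz))"
      by (intro continuous_intros continuous_on_compose2[OF c(2)]) auto
    show "((\<lambda>x. k (z - x)) has_real_derivative - k' (z - x)) (at x)" for x z
      by (rule DERIV_cong, rule DERIV_chain2[OF der]) (auto intro!: derivative_eq_intros)
    show "\<exists>R. \<forall>p z. dist p x \<le> 1 \<longrightarrow> R < norm z \<longrightarrow> k (z - p) = 0 \<and> - k' (z - p) = 0"
    proof (intro exI[of _ "\<bar>x\<bar> + 1 + h"] allI impI)
      fix p z :: real assume "dist p x \<le> 1" "\<bar>x\<bar> + 1 + h < norm z"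
      then have "h < \<bar>z - p\<bar>" by (simp add: dist_real_def)
      then show "k (z - p) = 0 \<and> - k' (z - p) = 0" using k unfolding compact_kernel_def by simp
    qed
  qed
  then show ?thesis by (simp add: conv_translate)
qed

lemma conv_bound:
  assumes u: "locally_bdd_borel u" "\<And>y. \<bar>u y\<bar> \<le> K" and k: "compact_kernel h k"
  shows "\<bar>LBINT y. u (x + y) * k y\<bar> \<le> K * (LBINT y. \<bar>k y\<bar>)"
  using compact_kernel_diff_bound[OF locally_bdd_borel_translate[OF u(1)] locally_bdd_borel_const[of 0] k, of x K] u(2) by simp

lemma continuous_conv:
  assumes u: "locally_bdd_borel u" and k: "compact_kernel h k"
  shows "continuous_on UNIV (\<lambda>x. LBINT y. u (x + y) * k y)"
  unfolding conv_translate
proof (rule continuous_on_param_integral[OF u])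
  have c: "continuous_on UNIV k" using k unfolding compact_kernel_def by auto
  show "continuous_on UNIV (\<lambda>pz. k (snd pz - fst pz))"
    by (intro continuous_on_compose2[OF c] continuous_intros) auto
  fix x :: real
  show "\<exists>R. \<forall>p z. dist p x \<le> 1 \<longrightarrow> R < norm z \<longrightarrow> k (z - p) = 0"
  proof (intro exI[of _ "\<bar>x\<bar> + 1 + h"] allI impI)
    fix p z :: real assume "dist p x \<le> 1" "\<bar>x\<bar> + 1 + h < norm z"
    then have "h < \<bar>z - p\<bar>" by (simp add: dist_real_def)
    then show "k (z - p) = 0" using k unfolding compact_kernel_def by simp
  qed
qed

text \<open>All four derivatives fall on the kernel, so the bounds use nothing about
  \<open>u\<close> beyond its supremum.\<close>

lemma C4_bdd_conv:
  assumes u: "locally_bdd_borel u" "\<And>y. \<bar>u y\<bar> \<le> K" and k: "kernel4 h \<rho> \<rho>1 \<rho>2 \<rho>3 \<rho>4"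
  shows "\<exists>K'. C4_bdd K' (K * (LBINT y. \<bar>\<rho>4 y\<bar>)) (\<lambda>x. LBINT y. u (x + y) * \<rho> y) (\<lambda>x. LBINT y. u (x + y) * \<rho>2 y)"
proof -
  note ck = kernel4_compact[OF k]
  have d: "\<And>y. (\<rho> has_real_derivative \<rho>1 y) (at y)" "\<And>y. (\<rho>1 has_real_derivative \<rho>2 y) (at y)"
    "\<And>y. (\<rho>2 has_real_derivative \<rho>3 y) (at y)" "\<And>y. (\<rho>3 has_real_derivative \<rho>4 y) (at y)"
    using k unfolding kernel4_def by auto
  define K' where "K' = max (K * (LBINT y. \<bar>\<rho> y\<bar>)) (K * (LBINT y. \<bar>\<rho>2 y\<bar>))"
  show ?thesis
    unfolding C4_bdd_def
  proof (rule exI[of _ K'], rule exI[of _ "\<lambda>x. - (LBINT y. u (x + y) * \<rho>1 y)"], rule exI[of _ "\<lambda>x. - (LBINT y. u (x + y) * \<rho>3 y)"],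
      rule exI[of _ "\<lambda>x. LBINT y. u (x + y) * \<rho>4 y"], intro conjI allI)
    fix x
    show "((\<lambda>x. LBINT y. u (x + y) * \<rho> y) has_real_derivative - (LBINT y. u (x + y) * \<rho>1 y)) (at x)"
      by (rule DERIV_conv[OF u(1) ck(1,2) d(1)])
    show "((\<lambda>x. - (LBINT y. u (x + y) * \<rho>1 y)) has_real_derivative (LBINT y. u (x + y) * \<rho>2 y)) (at x)"
      using DERIV_minus[OF DERIV_conv[OF u(1) ck(2,3) d(2)]] by simp
    show "((\<lambda>x. LBINT y. u (x + y) * \<rho>2 y) has_real_derivative - (LBINT y. u (x + y) * \<rho>3 y)) (at x)"
      by (rule DERIV_conv[OF u(1) ck(3,4) d(3)])
    show "((\<lambda>x. - (LBINT y. u (x + y) * \<rho>3 y)) has_real_derivative (LBINT y. u (x + y) * \<rho>4 y)) (at x)"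
      using DERIV_minus[OF DERIV_conv[OF u(1) ck(4,5) d(4)]] by simp
    show "continuous_on UNIV (\<lambda>x. LBINT y. u (x + y) * \<rho>4 y)" by (rule continuous_conv[OF u(1) ck(5)])
    show "\<bar>LBINT y. u (x + y) * \<rho> y\<bar> \<le> K'" using conv_bound[OF u ck(1), of x] by (simp add: K'_def)
    show "\<bar>LBINT y. u (x + y) * \<rho>2 y\<bar> \<le> K'" using conv_bound[OF u ck(3), of x] by (simp add: K'_def)
    show "\<bar>LBINT y. u (x + y) * \<rho>4 y\<bar> \<le> K * (LBINT y. \<bar>\<rho>4 y\<bar>)" by (rule conv_bound[OF u ck(5)])
  qed
qed

lemma kernel4_mono:
  assumes k: "kernel4 h \<rho> \<rho>1 \<rho>2 \<rho>3 \<rho>4" and u: "locally_bdd_borel u" "locally_bdd_borel w"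
    and le: "\<And>y. \<bar>y\<bar> \<le> h \<Longrightarrow> u y \<le> w y"
  shows "(LBINT y. u y * \<rho> y) \<le> (LBINT y. w y * \<rho> y)"
proof (rule integral_mono)
  show "u y * \<rho> y \<le> w y * \<rho> y" for y
    using le[of y] k unfolding kernel4_def by (cases "\<bar>y\<bar> \<le> h") (auto intro!: mult_right_mono)
qed (intro compact_kernel_integrable[OF _ kernel4_compact(1)[OF k]] u)+

lemma kernel4_const:
  assumes k: "kernel4 h \<rho> \<rho>1 \<rho>2 \<rho>3 \<rho>4" shows "(LBINT y. c * \<rho> y) = c" "(LBINT y. \<bar>\<rho> y\<bar>) = 1"
  using k unfolding kernel4_def by simp_all

lemma kernel4_reflect:
  assumes k: "kernel4 h \<rho> \<rho>1 \<rho>2 \<rho>3 \<rho>4"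
  shows "(LBINT y. u (- y) * \<rho> y) = (LBINT y. u y * \<rho> y)"
  using lborel_integral_real_affine[of "-1" "\<lambda>y. u y * \<rho> y" 0] k unfolding kernel4_def by simp

text \<open>By evenness of the kernel the average equals that of the symmetrised values
  \<open>(u (x + y) + u (x - y)) / 2\<close>, to which semiconcavity applies.\<close>

lemma kernel4_average_le:
  assumes k: "kernel4 h \<rho> \<rho>1 \<rho>2 \<rho>3 \<rho>4" and u: "locally_bdd_borel u"
    and sc: "\<And>x y. u (x + y) + u (x - y) \<le> 2 * u x + G * y\<^sup>2" and G: "G \<ge> 0"
  shows "(LBINT y. u (x + y) * \<rho> y) \<le> u x + G * h\<^sup>2 / 2"
proof -
  note ck = kernel4_compact(1)[OF k]
  have [measurable]: "u \<in> borel_measurable borel" using u unfolding locally_bdd_borel_def by simp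
  have lb: "locally_bdd_borel (\<lambda>y. u (x - y))"
    unfolding locally_bdd_borel_def
  proof (intro conjI allI)
    show "(\<lambda>y. u (x - y)) \<in> borel_measurable borel" by measurable
    fix R
    obtain C where "\<And>z. norm z \<le> R \<Longrightarrow> \<bar>u (x + z)\<bar> \<le> C"
      using locally_bdd_borel_translate[OF u, of x] unfolding locally_bdd_borel_def by blast
    from this[of "- z" for z] show "\<exists>C. \<forall>z. norm z \<le> R \<longrightarrow> \<bar>u (x - z)\<bar> \<le> C" by (auto intro: exI[of _ C])
  qed
  have i1: "integrable lborel (\<lambda>y. u (x + y) * \<rho> y)" by (rule compact_kernel_integrable[OF locally_bdd_borel_translate[OF u] ck])
  have i2: "integrable lborel (\<lambda>y. u (x - y) * \<rho> y)" by (rule compact_kernel_integrable[OF lb ck])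
  have "(LBINT y. u (x - y) * \<rho> y) = (LBINT y. u (x + y) * \<rho> y)"
    using kernel4_reflect[OF k, of "\<lambda>y. u (x + y)"] by simp
  then have "2 * (LBINT y. u (x + y) * \<rho> y) = (LBINT y. u (x + y) * \<rho> y + u (x - y) * \<rho> y)"
    using i1 i2 by simp
  also have "\<dots> \<le> (LBINT y. (2 * u x + G * h\<^sup>2) * \<rho> y)"
  proof (rule integral_mono)
    show "integrable lborel (\<lambda>y. u (x + y) * \<rho> y + u (x - y) * \<rho> y)" using i1 i2 by simp
    show "integrable lborel (\<lambda>y. (2 * u x + G * h\<^sup>2) * \<rho> y)" by (rule compact_kernel_integrable[OF _ ck]) simp
    fix y
    show "u (x + y) * \<rho> y + u (x - y) * \<rho> y \<le> (2 * u x + G * h\<^sup>2) * \<rho> y"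
    proof (cases "\<bar>y\<bar> \<le> h")
      case True
      then have "y\<^sup>2 \<le> h\<^sup>2" by (metis abs_ge_zero power2_abs power_mono)
      then have "G * y\<^sup>2 \<le> G * h\<^sup>2" using G by (rule mult_left_mono)
      then have "u (x + y) + u (x - y) \<le> 2 * u x + G * h\<^sup>2" using sc[of x y] by linarith
      then have "(u (x + y) + u (x - y)) * \<rho> y \<le> (2 * u x + G * h\<^sup>2) * \<rho> y"
        using k unfolding kernel4_def by (intro mult_right_mono) auto
      then show ?thesis by (simp add: distrib_right)
    next
      case False
      then have "\<rho> y = 0" using k unfolding kernel4_def by auto
      then show ?thesis by simp
    qed
  qed
  also have "\<dots> = 2 * u x + G * h\<^sup>2" by (rule kernel4_const[OF k])
  finally show ?thesis by simp
qed

text \<open>The quantifier order matters: \<open>d\<close> is fixed before the kernel, which is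
  later constructed from a width below \<open>d\<close>.\<close>

lemma kernel4_average_approx:
  assumes u: "continuous_on UNIV u" and e: "e > 0"
  shows "\<exists>d>0. \<forall>\<delta> \<rho> \<rho>1 \<rho>2 \<rho>3 \<rho>4 x. \<delta> \<le> d \<longrightarrow> kernel4 \<delta> \<rho> \<rho>1 \<rho>2 \<rho>3 \<rho>4 \<longrightarrow> \<bar>x - x0\<bar> \<le> h \<longrightarrow>
           \<bar>(LBINT y. u (x + y) * \<rho> y) - u x\<bar> \<le> e"
proof -
  have "uniformly_continuous_on (cball x0 (h + 1)) u"
    using u by (intro compact_uniformly_continuous) (auto intro: continuous_on_subset)
  then obtain d where d: "d > 0" "\<And>v w. v \<in> cball x0 (h + 1) \<Longrightarrow> w \<in> cball x0 (h + 1) \<Longrightarrow> dist w v < d \<Longrightarrow> dist (u w) (u v) < e"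
    using e unfolding uniformly_continuous_on_def by metis
  show ?thesis
  proof (intro exI[of _ "min (d / 2) 1"] conjI allI impI)
    fix \<delta> \<rho> \<rho>1 \<rho>2 \<rho>3 \<rho>4 x
    assume \<delta>: "\<delta> \<le> min (d / 2) 1" and k: "kernel4 \<delta> \<rho> \<rho>1 \<rho>2 \<rho>3 \<rho>4" and x: "\<bar>x - x0\<bar> \<le> h"
    have lu: "locally_bdd_borel (\<lambda>y. u (x + y))" by (intro locally_bdd_borel_translate locally_bdd_borel_continuous u)
    have le: "\<bar>u (x + y) - u x\<bar> \<le> e" if "\<bar>y\<bar> \<le> \<delta>" for y
    proof -
      have "dist (u (x + y)) (u x) < e"
        by (rule d(2)) (use that x \<delta> d(1) in \<open>auto simp: dist_real_def\<close>)
      then show ?thesis by (simp add: dist_real_def)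
    qed
    show "\<bar>(LBINT y. u (x + y) * \<rho> y) - u x\<bar> \<le> e"
      using compact_kernel_diff_bound[OF lu locally_bdd_borel_const[of "u x"] kernel4_compact(1)[OF k] le] unfolding kernel4_const[OF k] by simp
  qed (use d in auto)
qed

text \<open>Continuity in space is a by-product of semiconcavity, since a finite concave function on
  the line is continuous.\<close>

lemma concave_second_difference:
  fixes w :: "real \<Rightarrow> real"
  assumes "concave_on UNIV (\<lambda>x. w x - G / 2 * x\<^sup>2)"
  shows "w (x + y) + w (x - y) \<le> 2 * w x + G * y\<^sup>2" "continuous_on UNIV w"
proof -
  define c where "c = (\<lambda>x. w x - G / 2 * x\<^sup>2)"
  have c: "concave_on UNIV c" using assms by (simp add: c_def)
  have "(1/2) * c (x + y) + (1/2) * c (x - y) \<le> c ((1/2) *\<^sub>R (x + y) + (1/2) *\<^sub>R (x - y))"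
    using c unfolding concave_on_iff by (metis UNIV_I field_sum_of_halves half_gt_zero less_eq_real_def zero_less_one mult.commute)
  moreover have "(1/2) *\<^sub>R (x + y) + (1/2) *\<^sub>R (x - y) = x" by (simp add: field_simps)
  ultimately have "c (x + y) + c (x - y) \<le> 2 * c x" by simp
  moreover have "G / 2 * (x + y)\<^sup>2 + G / 2 * (x - y)\<^sup>2 = G * x\<^sup>2 + G * y\<^sup>2" by (simp add: power2_eq_square field_simps)
  ultimately show "w (x + y) + w (x - y) \<le> 2 * w x + G * y\<^sup>2" unfolding c_def by argo
  have "continuous_on UNIV (\<lambda>x. - c x)"
    by (rule convex_on_continuous) (use c in \<open>simp_all add: concave_on_def\<close>)
  then have "continuous_on UNIV c" using continuous_on_minus[of UNIV "\<lambda>x. - c x"] by simp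
  then have "continuous_on UNIV (\<lambda>x. c x + G / 2 * x\<^sup>2)" by (intro continuous_intros)
  then show "continuous_on UNIV w" by (simp add: c_def)
qed

lemma continuous_diffuse_iterate:
  assumes "continuous_on UNIV g" shows "continuous_on UNIV ((diffuse d ^^ n) g)"
proof (induction n)
  case (Suc n)
  have "continuous_on UNIV (\<lambda>x. ((diffuse d ^^ n) g (x + d) + (diffuse d ^^ n) g (x - d)) / 2)"
    by (intro continuous_intros continuous_on_compose2[OF Suc]) auto
  then show ?case by (simp add: diffuse_def[of d "(diffuse d ^^ n) g", abs_def])
qed (use assms in simp)

text \<open>Both operations are averages over translates, so they commute. This turns a bound on the
  walk of the datum into one on the walk of its average.\<close>

lemma conv_diffuse_iterate:
  assumes g: "continuous_on UNIV g" and k: "compact_kernel h k"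
  shows "(diffuse d ^^ n) (\<lambda>x. LBINT y. g (x + y) * k y) x = (LBINT y. (diffuse d ^^ n) g (x + y) * k y)"
proof (induction n arbitrary: x)
  case (Suc n)
  have int: "integrable lborel (\<lambda>y. (diffuse d ^^ n) g (x + y) * k y)" for x
    by (intro compact_kernel_integrable[OF _ k] locally_bdd_borel_translate locally_bdd_borel_continuous
        continuous_diffuse_iterate g)
  have "(diffuse d ^^ Suc n) (\<lambda>x. LBINT y. g (x + y) * k y) x
      = ((LBINT y. (diffuse d ^^ n) g (x + d + y) * k y) + (LBINT y. (diffuse d ^^ n) g (x - d + y) * k y)) / 2"
    using Suc.IH by (simp add: diffuse_def[of d "(diffuse d ^^ n) (\<lambda>x. LBINT y. g (x + y) * k y)"])
  also have "\<dots> = (LBINT y. ((diffuse d ^^ n) g (x + d + y) * k y + (diffuse d ^^ n) g (x - d + y) * k y) / 2)"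
    using int[of "x + d"] int[of "x - d"] by simp
  also have "\<dots> = (LBINT y. (diffuse d ^^ Suc n) g (x + y) * k y)"
    by (intro Bochner_Integration.integral_cong refl)
       (simp add: diffuse_def[of d "(diffuse d ^^ n) g"] field_simps)
  finally show ?case .
qed simp

section \<open>Mollified linear supersolutions\<close>

text \<open>Heat steps require a bounded \<open>C4_bdd\<close> datum below \<open>V (t1, x)\<close>.
  It is obtained from \<open>V\<close> by truncation, mollification at a second scale
  \<open>\<delta>\<close> and a small lowering. The number of steps tends to infinity with
  \<open>\<delta>\<close> fixed, and only afterwards does the approximation error \<open>e0\<close>
  tend to 0.\<close>

lemma heat_supersolution_mollified:
  assumes lsc: "lsc_on ({0..<T} \<times> UNIV) V" and a: "a \<ge> 0"
    and jet: "\<And>t x q M. subjet T V t x q M \<Longrightarrow> - q - a * M \<ge> 0"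
    and nonneg: "\<And>t x. 0 \<le> t \<Longrightarrow> t < T \<Longrightarrow> V (t, x) \<ge> 0"
    and cont: "\<And>t. 0 \<le> t \<Longrightarrow> t < T \<Longrightarrow> continuous_on UNIV (\<lambda>x. V (t, x))"
    and sc: "\<And>t x y. 0 \<le> t \<Longrightarrow> t < T \<Longrightarrow> V (t, x + y) + V (t, x - y) \<le> 2 * V (t, x) + G * y\<^sup>2" and G: "G \<ge> 0"
    and bdd: "\<And>t y. 0 \<le> t \<Longrightarrow> t < T \<Longrightarrow> \<bar>y\<bar> \<le> h \<Longrightarrow> V (t, x0 + y) \<le> k"
    and ker: "kernel4 h \<rho> \<rho>1 \<rho>2 \<rho>3 \<rho>4"
    and t: "0 \<le> t0" "t0 \<le> t1" "t1 < T"
  shows "(LBINT y. V (t1, x0 + y) * \<rho> y) + a * (t1 - t0) * (LBINT y. V (t1, x0 + y) * \<rho>2 y)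
     - a\<^sup>2 * (t1 - t0)\<^sup>2 * ((k + G) * (LBINT y. \<bar>\<rho>4 y\<bar>)) \<le> (LBINT y. V (t0, x0 + y) * \<rho> y)"
proof (rule field_le_epsilon)
  fix e0 :: real assume e0: "e0 > 0"
  define S where "S = t1 - t0"
  have S: "S \<ge> 0" using t by (simp add: S_def)
  define I2 where "I2 = (LBINT y. \<bar>\<rho>2 y\<bar>)"
  have I2: "I2 \<ge> 0" by (simp add: I2_def)
  \<comment> \<open>Approximating \<open>u\<close> within \<open>e\<close> costs \<open>e\<close> in
    the average and \<open>a * S * (e * I2)\<close> in the second-derivative term; together they are
    exactly \<open>e0\<close>.\<close>
  define e where "e = e0 / (1 + a * S * I2)"
  have den: "1 + a * S * I2 > 0" using a S I2 by (simp add: add_pos_nonneg)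
  have e: "e > 0" "e + a * S * (e * I2) = e0"
  proof -
    show "e > 0" using e0 den by (simp add: e_def)
    have "e * (1 + a * S * I2) = e0" using den nonzero_eq_divide_eq[of "1 + a * S * I2" e e0] e_def by auto
    then show "e + a * S * (e * I2) = e0" by (simp add: algebra_simps)
  qed
  note ck = kernel4_compact[OF ker]
  have h: "h > 0" using ker by (simp add: kernel4_def)
  define u where "u = (\<lambda>x. V (t1, x))"
  define v where "v = (\<lambda>x. V (t0, x))"
  have scu: "u (x + y) + u (x - y) \<le> 2 * u x + G * y\<^sup>2" and cu: "continuous_on UNIV u" for x y
    using sc[of t1 x y] cont[of t1] t unfolding u_def by auto
  have cv: "continuous_on UNIV v"
    using cont[of t0] t unfolding v_def by auto
  have k0: "k \<ge> 0" using bdd[of t1 0] nonneg[of t1 x0] t h by auto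
  \<comment> \<open>Truncation makes the datum bounded without changing it on the window
    \<open>\<bar>y\<bar> \<le> h\<close>; taking the minimum with a constant preserves semiconcavity
    because \<open>G \<ge> 0\<close>.\<close>
  define uk where "uk = (\<lambda>x. min (u x) k)"
  have cuk: "continuous_on UNIV uk" unfolding uk_def by (intro continuous_intros cu)
  have luk: "locally_bdd_borel uk" by (rule locally_bdd_borel_continuous[OF cuk])
  have scuk: "uk (x + y) + uk (x - y) \<le> 2 * uk x + G * y\<^sup>2" for x y
  proof -
    have "G * y\<^sup>2 \<ge> 0" using G by simp
    then show ?thesis using scu[of x y] unfolding uk_def by linarith
  qed
  have ukb: "0 \<le> uk x" "uk x \<le> k" for x using nonneg[of t1 x] t k0 by (auto simp: uk_def u_def)
  have ukeq: "uk (x0 + y) = u (x0 + y)" if "\<bar>y\<bar> \<le> h" for y using bdd[of t1 y] that t by (simp add: uk_def u_def)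
  obtain d where d: "d > 0" "\<And>\<delta> \<eta> \<eta>1 \<eta>2 \<eta>3 \<eta>4 x. \<delta> \<le> d \<Longrightarrow> kernel4 \<delta> \<eta> \<eta>1 \<eta>2 \<eta>3 \<eta>4 \<Longrightarrow> \<bar>x - x0\<bar> \<le> h \<Longrightarrow>
           \<bar>(LBINT y. uk (x + y) * \<eta> y) - uk x\<bar> \<le> e / 2"
    using kernel4_average_approx[OF cuk half_gt_zero[OF e(1)], of x0 h] by metis
  define \<delta> where "\<delta> = min d (min 1 (e / (G + 1)))"
  have \<delta>: "\<delta> > 0" "\<delta> \<le> d" "\<delta> \<le> 1" "G * \<delta>\<^sup>2 \<le> e" "G * \<delta>\<^sup>2 \<le> G"
  proof -
    show pos: "\<delta> > 0" "\<delta> \<le> d" "\<delta> \<le> 1" using d e G by (auto simp: \<delta>_def)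
    have "\<delta> * \<delta> \<le> 1 * \<delta>" using pos by (intro mult_right_mono) auto
    then have sq: "\<delta>\<^sup>2 \<le> \<delta>" by (simp add: power2_eq_square)
    then have "G * \<delta>\<^sup>2 \<le> (G + 1) * (e / (G + 1))" using G pos unfolding \<delta>_def by (intro mult_mono) auto
    then show "G * \<delta>\<^sup>2 \<le> e" using G by simp
    have "\<delta>\<^sup>2 \<le> 1" using sq pos by linarith
    then show "G * \<delta>\<^sup>2 \<le> G" using mult_left_mono[of "\<delta>\<^sup>2" 1 G] G by simp
  qed
  obtain \<eta> \<eta>1 \<eta>2 \<eta>3 \<eta>4 where \<eta>: "kernel4 \<delta> \<eta> \<eta>1 \<eta>2 \<eta>3 \<eta>4" using kernel4_exists[OF \<delta>(1)] by blast
  \<comment> \<open>This is how far an average over width \<open>\<delta>\<close> can exceed a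
    function with second differences bounded by \<open>G * y\<^sup>2\<close>; subtracting it brings
    the datum below \<open>V\<close>.\<close>
  define c where "c = G * \<delta>\<^sup>2 / 2"
  have c: "0 \<le> c" "c \<le> e / 2" "c \<le> G / 2" using G \<delta> by (auto simp: c_def)
  define g where "g = (\<lambda>x. (LBINT y. uk (x + y) * \<eta> y) - c)"
  obtain K' where "C4_bdd K' (k * (LBINT y. \<bar>\<eta>4 y\<bar>)) (\<lambda>x. LBINT y. uk (x + y) * \<eta> y) (\<lambda>x. LBINT y. uk (x + y) * \<eta>2 y)"
    using C4_bdd_conv[OF luk _ \<eta>, of k] ukb by auto
  then obtain K B g2 where Cg: "C4_bdd K B g g2" unfolding g_def using C4_bdd_minus_const by blast
  have gle: "g x \<le> V (t1, x)" for x
  proof -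
    have "(LBINT y. uk (x + y) * \<eta> y) \<le> uk x + c"
      using kernel4_average_le[OF \<eta> luk scuk G, of x] by (simp add: c_def)
    moreover have "uk x \<le> V (t1, x)" by (simp add: uk_def u_def)
    ultimately show ?thesis by (simp add: g_def)
  qed
  have gk: "\<bar>g x\<bar> \<le> k + G" for x
  proof -
    have "\<bar>LBINT y. uk (x + y) * \<eta> y\<bar> \<le> k * 1"
      using conv_bound[OF luk _ kernel4_compact(1)[OF \<eta>], of k x] ukb kernel4_const(2)[OF \<eta>] by auto
    then show ?thesis using c G by (simp add: g_def)
  qed
  have gclose: "\<bar>g (x0 + y) - u (x0 + y)\<bar> \<le> e" if "\<bar>y\<bar> \<le> h" for y
    using d(2)[OF \<delta>(2) \<eta>, of "x0 + y"] ukeq[OF that] that c unfolding g_def by (simp del: le_divide_eq_numeral1)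
  have cg: "continuous_on UNIV g" unfolding g_def
    by (intro continuous_intros continuous_conv[OF luk kernel4_compact(1)[OF \<eta>]])
  have lg: "locally_bdd_borel g" by (rule locally_bdd_borel_continuous[OF cg])
  define Gf where "Gf = (\<lambda>x. LBINT y. g (x + y) * \<rho> y)"
  define G2 where "G2 = (\<lambda>x. LBINT y. g (x + y) * \<rho>2 y)"
  define BG where "BG = (k + G) * (LBINT y. \<bar>\<rho>4 y\<bar>)"
  obtain KG where CG: "C4_bdd KG BG Gf G2"
    using C4_bdd_conv[OF lg gk ker] unfolding Gf_def G2_def BG_def by auto
  \<comment> \<open>\<open>B\<close> belongs to the fine kernel \<open>\<eta>\<close> and blows up
    with \<open>\<delta>\<close>, but it appears divided by the number of steps. The error that
    persists carries \<open>BG\<close>, which depends on the fixed kernel only.\<close>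
  have step: "Gf x0 + a * S * G2 x0 - a\<^sup>2 * S\<^sup>2 * BG \<le> (LBINT y. v (x0 + y) * \<rho> y) + a\<^sup>2 * S\<^sup>2 * B / real (Suc n)" for n
  proof -
    define N where "N = Suc n"
    define \<theta> where "\<theta> = S / real N"
    have \<theta>: "\<theta> \<ge> 0" "real N * \<theta> = S" using S by (auto simp: \<theta>_def N_def)
    define ds where "ds = sqrt (2 * a * \<theta>)"
    have "(diffuse ds ^^ N) g x - real N * (a\<^sup>2 * \<theta>\<^sup>2 * B) \<le> V (t1 - real N * \<theta>, x)" for x
      unfolding ds_def
      by (rule heat_step_iterate[OF lsc a jet nonneg Cg]) (use t \<theta> gle in \<open>auto simp: S_def\<close>)
    moreover have "real N * (a\<^sup>2 * \<theta>\<^sup>2 * B) = a\<^sup>2 * S\<^sup>2 * B / real N"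
    proof -
      have "real N \<noteq> 0" by (simp add: N_def)
      then show ?thesis by (simp add: \<theta>_def power_divide power2_eq_square)
    qed
    moreover have "t1 - real N * \<theta> = t0" using \<theta> by (simp add: S_def)
    ultimately have le: "(diffuse ds ^^ N) g x \<le> v x + a\<^sup>2 * S\<^sup>2 * B / real N" for x by (simp add: v_def algebra_simps)
    have "Gf x0 + a * S * G2 x0 - a\<^sup>2 * S\<^sup>2 * BG \<le> (diffuse ds ^^ N) Gf x0"
      using diffuse_iterate_lower[OF CG a \<theta>(1), of x0 N] \<theta>(2) by (simp add: ds_def)
    also have "\<dots> = (LBINT y. (diffuse ds ^^ N) g (x0 + y) * \<rho> y)"
      unfolding Gf_def by (rule conv_diffuse_iterate[OF cg ck(1)])
    also have "\<dots> \<le> (LBINT y. (v (x0 + y) + a\<^sup>2 * S\<^sup>2 * B / real N) * \<rho> y)"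
      by (intro kernel4_mono[OF ker] locally_bdd_borel_continuous continuous_intros le
          continuous_on_compose2[OF cv] continuous_on_compose2[OF continuous_diffuse_iterate[OF cg]]) auto
    also have "\<dots> = (LBINT y. v (x0 + y) * \<rho> y) + a\<^sup>2 * S\<^sup>2 * B / real N"
    proof -
      have "integrable lborel (\<lambda>y. v (x0 + y) * \<rho> y)"
        by (intro compact_kernel_integrable[OF _ ck(1)] locally_bdd_borel_translate locally_bdd_borel_continuous cv)
      moreover have "integrable lborel (\<lambda>y. a\<^sup>2 * S\<^sup>2 * B / real N * \<rho> y)"
        by (intro compact_kernel_integrable[OF _ ck(1)]) simp
      ultimately show ?thesis using kernel4_const(1)[OF ker, of "a\<^sup>2 * S\<^sup>2 * B / real N"]
        unfolding distrib_right by (subst Bochner_Integration.integral_add) auto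
    qed
    finally show ?thesis by (simp add: N_def)
  qed
  have "(\<lambda>n. (LBINT y. v (x0 + y) * \<rho> y) + a\<^sup>2 * S\<^sup>2 * B / real (Suc n)) \<longlonglongrightarrow> (LBINT y. v (x0 + y) * \<rho> y) + 0"
    by (intro tendsto_intros LIMSEQ_Suc[OF lim_const_over_n])
  then have main: "Gf x0 + a * S * G2 x0 - a\<^sup>2 * S\<^sup>2 * BG \<le> (LBINT y. v (x0 + y) * \<rho> y)"
    using step by (intro LIMSEQ_le_const) auto
  have lu: "locally_bdd_borel (\<lambda>y. u (x0 + y))" "locally_bdd_borel (\<lambda>y. g (x0 + y))"
    by (intro locally_bdd_borel_translate locally_bdd_borel_continuous cu cg)+
  have "\<bar>Gf x0 - (LBINT y. u (x0 + y) * \<rho> y)\<bar> \<le> e"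
    using compact_kernel_diff_bound[OF lu(2,1) ck(1) gclose] kernel4_const(2)[OF ker] by (simp add: Gf_def)
  moreover have G2e: "\<bar>G2 x0 - (LBINT y. u (x0 + y) * \<rho>2 y)\<bar> \<le> e * I2"
    using compact_kernel_diff_bound[OF lu(2,1) ck(3) gclose] by (simp add: G2_def I2_def)
  moreover have "a * S * ((LBINT y. u (x0 + y) * \<rho>2 y) - G2 x0) \<le> a * S * (e * I2)"
    using G2e a S by (intro mult_left_mono) auto
  ultimately show "(LBINT y. V (t1, x0 + y) * \<rho> y) + a * (t1 - t0) * (LBINT y. V (t1, x0 + y) * \<rho>2 y)
     - a\<^sup>2 * (t1 - t0)\<^sup>2 * ((k + G) * (LBINT y. \<bar>\<rho>4 y\<bar>)) \<le> (LBINT y. V (t0, x0 + y) * \<rho> y) + e0"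
    using main e(2) unfolding u_def v_def S_def BG_def by (simp add: right_diff_distrib)
qed



lemma subjet_add_smooth:
  assumes "subjet T (\<lambda>z. V z + P z) t x q M" and P: "C12_test P Pt Px Pxx"
  shows "subjet T V t x (q - Pt (t, x)) (M - Pxx (t, x))"
proof -
  obtain \<phi> \<phi>t \<phi>x \<phi>xx r where t: "0 \<le> t" "t < T" and \<phi>: "C12_test \<phi> \<phi>t \<phi>x \<phi>xx" "\<phi>t (t, x) = q" "\<phi>xx (t, x) = M"
    and r: "r > 0" "\<And>s y. 0 \<le> s \<Longrightarrow> s < T \<Longrightarrow> dist (s, y) (t, x) < r \<Longrightarrow>
                 V (s, y) + P (s, y) - \<phi> (s, y) \<ge> V (t, x) + P (t, x) - \<phi> (t, x)"
    using assms(1) unfolding subjet_def by auto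
  have "C12_test (\<lambda>z. \<phi> z - P z) (\<lambda>z. \<phi>t z - Pt z) (\<lambda>z. \<phi>x z - Px z) (\<lambda>z. \<phi>xx z - Pxx z)"
    using \<phi>(1) P unfolding C12_test_def by (auto intro!: continuous_intros derivative_intros)
  moreover have "V (s, y) - (\<phi> (s, y) - P (s, y)) \<ge> V (t, x) - (\<phi> (t, x) - P (t, x))"
    if "0 \<le> s" "s < T" "dist (s, y) (t, x) < r" for s y using r(2)[OF that] by simp
  ultimately show ?thesis unfolding subjet_def using t \<phi>(2,3) r(1) by fast
qed

text \<open>The moments of \<open>\<rho>2\<close> come without integration by parts: the average of
  a quadratic is computed explicitly as a function of its centre, then differentiated twice and
  compared with \<open>DERIV_conv\<close>.\<close>

lemma kernel4_second_moment:
  assumes k: "kernel4 h \<rho> \<rho>1 \<rho>2 \<rho>3 \<rho>4"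
  shows "(LBINT y. (p0 + p2 * y\<^sup>2) * \<rho>2 y) = 2 * p2"
    "(LBINT y. (p0 + p2 * y\<^sup>2) * \<rho> y) = p0 + p2 * (LBINT y. y\<^sup>2 * \<rho> y)"
    "(LBINT y. y\<^sup>2 * \<rho> y) \<le> h\<^sup>2"
proof -
  note ck = kernel4_compact[OF k]
  have d: "\<And>y. (\<rho> has_real_derivative \<rho>1 y) (at y)" "\<And>y. (\<rho>1 has_real_derivative \<rho>2 y) (at y)"
    using k unfolding kernel4_def by auto
  have int: "integrable lborel (\<lambda>y. u y * \<rho> y)" if "continuous_on UNIV u" for u
    by (rule compact_kernel_integrable[OF locally_bdd_borel_continuous[OF that] ck(1)])
  define m1 where "m1 = (LBINT y. y * \<rho> y)"
  define m2 where "m2 = (LBINT y. y\<^sup>2 * \<rho> y)"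
  define u where "u = (\<lambda>y. p0 + p2 * y\<^sup>2)"
  have lu: "locally_bdd_borel u" unfolding u_def by (intro locally_bdd_borel_continuous continuous_intros)
  have F: "(LBINT y. u (x + y) * \<rho> y) = p0 + p2 * x\<^sup>2 + 2 * p2 * x * m1 + p2 * m2" for x
  proof -
    have "(LBINT y. u (x + y) * \<rho> y) = (LBINT y. (p0 + p2 * x\<^sup>2) * \<rho> y + (2 * p2 * x) * (y * \<rho> y) + p2 * (y\<^sup>2 * \<rho> y))"
      by (intro Bochner_Integration.integral_cong refl) (simp add: u_def power2_eq_square algebra_simps)
    also have "\<dots> = (p0 + p2 * x\<^sup>2) + (2 * p2 * x) * m1 + p2 * m2"
    proof -
      have "integrable lborel (\<lambda>y. (p0 + p2 * x\<^sup>2) * \<rho> y)" by (rule int) (intro continuous_intros)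
      moreover have "integrable lborel (\<lambda>y. (2 * p2 * x) * (y * \<rho> y))"
        by (intro integrable_mult_right int continuous_intros)
      moreover have "integrable lborel (\<lambda>y. p2 * (y\<^sup>2 * \<rho> y))"
        by (intro integrable_mult_right int continuous_intros)
      ultimately show ?thesis using kernel4_const(1)[OF k, of "p0 + p2 * x\<^sup>2"]
        by (simp add: m1_def m2_def)
    qed
    finally show ?thesis by simp
  qed
  have F0: "((\<lambda>x. p0 + p2 * x\<^sup>2 + 2 * p2 * x * m1 + p2 * m2) has_real_derivative - (LBINT y. u (x + y) * \<rho>1 y)) (at x)" for x
    using DERIV_conv[OF lu ck(1,2) d(1), of x] unfolding F .
  have F0': "((\<lambda>x. p0 + p2 * x\<^sup>2 + 2 * p2 * x * m1 + p2 * m2) has_real_derivative 2 * p2 * x + 2 * p2 * m1) (at x)" for x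
    by (auto intro!: derivative_eq_intros)
  have F1: "(LBINT y. u (x + y) * \<rho>1 y) = - (2 * p2 * x + 2 * p2 * m1)" for x
    using DERIV_unique[OF F0 F0', of x] by linarith
  have "((\<lambda>x. - (2 * p2 * x + 2 * p2 * m1)) has_real_derivative - (LBINT y. u (0 + y) * \<rho>2 y)) (at 0)"
    using DERIV_conv[OF lu ck(2,3) d(2), of 0] unfolding F1 .
  moreover have "((\<lambda>x. - (2 * p2 * x + 2 * p2 * m1)) has_real_derivative - (2 * p2)) (at 0)"
    by (auto intro!: derivative_eq_intros)
  ultimately have "- (LBINT y. u (0 + y) * \<rho>2 y) = - (2 * p2)" by (rule DERIV_unique)
  then show "(LBINT y. (p0 + p2 * y\<^sup>2) * \<rho>2 y) = 2 * p2" by (simp add: u_def)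
  show "(LBINT y. (p0 + p2 * y\<^sup>2) * \<rho> y) = p0 + p2 * (LBINT y. y\<^sup>2 * \<rho> y)"
    using F[of 0] by (simp add: u_def m2_def)
  have "(LBINT y. y\<^sup>2 * \<rho> y) \<le> (LBINT y. h\<^sup>2 * \<rho> y)"
    by (intro kernel4_mono[OF k] locally_bdd_borel_continuous continuous_intros) (metis abs_ge_zero power2_abs power_mono)
  then show "(LBINT y. y\<^sup>2 * \<rho> y) \<le> h\<^sup>2" unfolding kernel4_const(1)[OF k] .
qed

text \<open>An explicit polynomial reduces the source to zero. After averaging, the penalty
  \<open>A * (x - x0)\<^sup>2\<close> costs only \<open>A * h\<^sup>2\<close>, whatever happens far
  from \<open>x0\<close>. Of \<open>D\<close> only the existence counts, as the estimate will be
  divided by \<open>t1 - t0\<close> and the latter sent to 0.\<close>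

lemma linear_supersolution_mollified:
  assumes lsc: "lsc_on ({0..<T} \<times> UNIV) V" and a: "a \<ge> 0" and A: "A \<ge> 0"
    and jet: "\<And>t x q M. subjet T V t x q M \<Longrightarrow> c - A * (x - x0)\<^sup>2 \<le> - q - a * M"
    and growth: "\<And>t x. 0 \<le> t \<Longrightarrow> t < T \<Longrightarrow> \<bar>V (t, x)\<bar> \<le> Cg * (1 + \<bar>x\<bar>)"
    and cont: "\<And>t. 0 \<le> t \<Longrightarrow> t < T \<Longrightarrow> continuous_on UNIV (\<lambda>x. V (t, x))"
    and sc: "\<And>t x y. 0 \<le> t \<Longrightarrow> t < T \<Longrightarrow> V (t, x + y) + V (t, x - y) \<le> 2 * V (t, x) + G * y\<^sup>2" and G: "G \<ge> 0"
    and ker: "kernel4 h \<rho> \<rho>1 \<rho>2 \<rho>3 \<rho>4"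
  obtains D where "\<And>t0 t1. 0 \<le> t0 \<Longrightarrow> t0 \<le> t1 \<Longrightarrow> t1 < T \<Longrightarrow>
     (LBINT y. V (t1, x0 + y) * \<rho> y) + a * (t1 - t0) * (LBINT y. V (t1, x0 + y) * \<rho>2 y)
     + (t1 - t0) * (c - A * h\<^sup>2) - D * (t1 - t0)\<^sup>2 \<le> (LBINT y. V (t0, x0 + y) * \<rho> y)"
proof (cases "T > 0")
  case False
  then show thesis by (intro that[of 0]) auto
next
  case True
  note ck = kernel4_compact[OF ker]
  have h: "h > 0" using ker by (simp add: kernel4_def)
  have Cg: "Cg \<ge> 0" using growth[of 0 0] True by simp
  \<comment> \<open>The summands compensate, in this order, the linear growth of \<open>V\<close>,
    the term \<open>c * t\<close>, and the coefficient \<open>- A * t\<close> of the square.\<close>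
  define B where "B = Cg * (2 + \<bar>x0\<bar>) + \<bar>c\<bar> * T + A * T"
  have B: "B \<ge> 0" using Cg A True by (simp add: B_def)
  text \<open>\<open>P\<close> absorbs the source \<open>c - A (x - x0)\<^sup>2\<close>; its caloric part \<open>B (1 + (x - x0)\<^sup>2 + 2a (T - t))\<close> makes \<open>V + P\<close> nonnegative.\<close>
  define P where "P = (\<lambda>z. c * fst z - A * fst z * (snd z - x0)\<^sup>2 + A * a * (fst z)\<^sup>2
      + B * (1 + (snd z - x0)\<^sup>2 + 2 * a * (T - fst z)))"
  define Pt where "Pt = (\<lambda>z. c - A * (snd z - x0)\<^sup>2 + 2 * A * a * fst z - 2 * a * B)"
  define Px where "Px = (\<lambda>z. 2 * (B - A * fst z) * (snd z - x0))"
  define Pxx where "Pxx = (\<lambda>z::real\<times>real. 2 * (B - A * fst z))"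
  have P: "C12_test P Pt Px Pxx"
    unfolding C12_test_def P_def Pt_def Px_def Pxx_def
    by (auto intro!: continuous_intros derivative_eq_intros simp: algebra_simps power2_eq_square)
  define p0 where "p0 = (\<lambda>t. c * t + A * a * t\<^sup>2 + B * (1 + 2 * a * (T - t)))"
  define p2 where "p2 = (\<lambda>t. B - A * t)"
  have Py: "P (t, x0 + y) = p0 t + p2 t * y\<^sup>2" for t y
    by (simp add: P_def p0_def p2_def algebra_simps)
  define m2 where "m2 = (LBINT y. y\<^sup>2 * \<rho> y)"
  have m2: "m2 \<le> h\<^sup>2" unfolding m2_def by (rule kernel4_second_moment(3)[OF ker])
  define k where "k = Cg * (1 + \<bar>x0\<bar> + h) + (\<bar>c\<bar> * T + A * a * T\<^sup>2 + B * (1 + 2 * a * T)) + B * h\<^sup>2"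
  have p2b: "p2 t \<le> B" "p2 t \<ge> Cg * (2 + \<bar>x0\<bar>) + \<bar>c\<bar> * T" if "0 \<le> t" "t < T" for t
  proof -
    have "0 \<le> A * t" "A * t \<le> A * T" using A that by (auto intro: mult_left_mono)
    then show "p2 t \<le> B" "p2 t \<ge> Cg * (2 + \<bar>x0\<bar>) + \<bar>c\<bar> * T" by (auto simp: p2_def B_def)
  qed
  have ct: "\<bar>c * t\<bar> \<le> \<bar>c\<bar> * T" if "0 \<le> t" "t < T" for t
    using that by (auto simp: abs_mult intro!: mult_left_mono)
  define W where "W = (\<lambda>z. V z + P z)"
  have est: "(LBINT y. W (t1, x0 + y) * \<rho> y) + a * (t1 - t0) * (LBINT y. W (t1, x0 + y) * \<rho>2 y)
     - a\<^sup>2 * (t1 - t0)\<^sup>2 * ((k + (G + 2 * B)) * (LBINT y. \<bar>\<rho>4 y\<bar>)) \<le> (LBINT y. W (t0, x0 + y) * \<rho> y)"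
    if t: "0 \<le> t0" "t0 \<le> t1" "t1 < T" for t0 t1
  proof (rule heat_supersolution_mollified[OF _ a _ _ _ _ _ _ ker t])
    have "continuous_on UNIV (\<lambda>z. - P z)" using P unfolding C12_test_def by (auto intro: continuous_intros)
    from lsc_on_diff[OF lsc this] show "lsc_on ({0..<T} \<times> UNIV) W" by (simp add: W_def)
    show "0 \<le> - q - a * M" if "subjet T W t x q M" for t x q M
    proof -
      have "c - A * (x - x0)\<^sup>2 \<le> - (q - Pt (t, x)) - a * (M - Pxx (t, x))"
        by (rule jet[OF subjet_add_smooth[OF that[unfolded W_def] P]])
      then show ?thesis by (simp add: Pt_def Pxx_def algebra_simps)
    qed
    show "0 \<le> W (t, x)" if t: "0 \<le> t" "t < T" for t x
    proof -
      define y where "y = x - x0"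
      have x: "x = x0 + y" by (simp add: y_def)
      have "(\<bar>y\<bar> - 1)\<^sup>2 \<ge> 0" by simp
      then have "\<bar>y\<bar> \<le> 1 + y\<^sup>2" by (simp add: power2_diff)
      then have "1 + \<bar>x\<bar> \<le> (2 + \<bar>x0\<bar>) * (1 + y\<^sup>2)"
      proof -
        have "\<bar>x\<bar> \<le> \<bar>x0\<bar> + (1 + y\<^sup>2)" using \<open>\<bar>y\<bar> \<le> 1 + y\<^sup>2\<close> unfolding x by linarith
        moreover have "(2 + \<bar>x0\<bar>) * (1 + y\<^sup>2) = 2 + \<bar>x0\<bar> + 2 * y\<^sup>2 + \<bar>x0\<bar> * y\<^sup>2" by (simp add: algebra_simps)
        moreover have "\<bar>x0\<bar> * y\<^sup>2 \<ge> 0" "y\<^sup>2 \<ge> 0" by simp_all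
        ultimately show ?thesis by linarith
      qed
      then have "Cg * (1 + \<bar>x\<bar>) \<le> Cg * ((2 + \<bar>x0\<bar>) * (1 + y\<^sup>2))" using Cg by (rule mult_left_mono)
      then have v: "V (t, x) \<ge> - (Cg * (2 + \<bar>x0\<bar>) * (1 + y\<^sup>2))" using growth[OF t, of x] by (simp add: mult.assoc abs_le_iff)
      have "P (t, x) \<ge> (Cg * (2 + \<bar>x0\<bar>)) * (1 + y\<^sup>2)"
      proof -
        have "p0 t \<ge> Cg * (2 + \<bar>x0\<bar>)"
        proof -
          have "A * a * t\<^sup>2 \<ge> 0" "B * (2 * a * (T - t)) \<ge> 0" "A * T \<ge> 0" using A a B t by auto
          moreover have "p0 t = c * t + A * a * t\<^sup>2 + B + B * (2 * a * (T - t))" by (simp add: p0_def distrib_left)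
          ultimately show ?thesis using ct[OF t] B_def by linarith
        qed
        moreover have "p2 t * y\<^sup>2 \<ge> (Cg * (2 + \<bar>x0\<bar>)) * y\<^sup>2"
          using p2b(2)[OF t] True by (intro mult_right_mono) (auto intro: order_trans[rotated])
        ultimately show ?thesis unfolding x Py by (simp add: distrib_left)
      qed
      then show ?thesis using v by (simp add: W_def)
    qed
    show "continuous_on UNIV (\<lambda>x. W (t, x))" if "0 \<le> t" "t < T" for t
      unfolding W_def P_def by (intro continuous_intros cont that)
    show "W (t, x + y) + W (t, x - y) \<le> 2 * W (t, x) + (G + 2 * B) * y\<^sup>2" if t: "0 \<le> t" "t < T" for t x y
    proof -
      have "P (t, x + y) + P (t, x - y) = 2 * P (t, x) + 2 * p2 t * y\<^sup>2"
        by (simp add: P_def p2_def power2_eq_square algebra_simps)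
      moreover have "p2 t * y\<^sup>2 \<le> B * y\<^sup>2" using p2b(1)[OF t] by (intro mult_right_mono) auto
      ultimately show ?thesis using sc[OF t, of x y] by (simp add: W_def distrib_right)
    qed
    show "W (t, x0 + y) \<le> k" if t: "0 \<le> t" "t < T" and y: "\<bar>y\<bar> \<le> h" for t y
    proof -
      have "Cg * (1 + \<bar>x0 + y\<bar>) \<le> Cg * (1 + \<bar>x0\<bar> + h)" using Cg y by (intro mult_left_mono) auto
      then have "V (t, x0 + y) \<le> Cg * (1 + \<bar>x0\<bar> + h)" using growth[OF t, of "x0 + y"] by linarith
      moreover have "p0 t \<le> \<bar>c\<bar> * T + A * a * T\<^sup>2 + B * (1 + 2 * a * T)"
        unfolding p0_def using ct[OF t] A a B t
        by (intro add_mono mult_left_mono power_mono) (auto simp: abs_le_iff)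
      moreover have "p2 t * y\<^sup>2 \<le> B * h\<^sup>2"
      proof -
        have "y\<^sup>2 \<le> h\<^sup>2" using y by (metis abs_ge_zero power2_abs power_mono)
        then have "B * y\<^sup>2 \<le> B * h\<^sup>2" using B by (rule mult_left_mono)
        moreover have "p2 t * y\<^sup>2 \<le> B * y\<^sup>2" using p2b(1)[OF t] by (intro mult_right_mono) auto
        ultimately show ?thesis by linarith
      qed
      ultimately show ?thesis unfolding W_def Py k_def by linarith
    qed
  qed (use G B in auto)
  have split: "(LBINT y. W (t, x0 + y) * \<rho> y) = (LBINT y. V (t, x0 + y) * \<rho> y) + p0 t + p2 t * m2"
    "(LBINT y. W (t, x0 + y) * \<rho>2 y) = (LBINT y. V (t, x0 + y) * \<rho>2 y) + 2 * p2 t" if t: "0 \<le> t" "t < T" for t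
  proof -
    have lV: "locally_bdd_borel (\<lambda>y. V (t, x0 + y))"
      by (rule locally_bdd_borel_translate[OF locally_bdd_borel_continuous[OF cont[OF t]]])
    have lP: "locally_bdd_borel (\<lambda>y. p0 t + p2 t * y\<^sup>2)" by (intro locally_bdd_borel_continuous continuous_intros)
    show "(LBINT y. W (t, x0 + y) * \<rho> y) = (LBINT y. V (t, x0 + y) * \<rho> y) + p0 t + p2 t * m2"
      using compact_kernel_integrable[OF lV ck(1)] compact_kernel_integrable[OF lP ck(1)] kernel4_second_moment(2)[OF ker, of "p0 t" "p2 t"]
      unfolding W_def Py m2_def distrib_right[of "V z" for z] by simp
    show "(LBINT y. W (t, x0 + y) * \<rho>2 y) = (LBINT y. V (t, x0 + y) * \<rho>2 y) + 2 * p2 t"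
      using compact_kernel_integrable[OF lV ck(3)] compact_kernel_integrable[OF lP ck(3)] kernel4_second_moment(1)[OF ker, of "p0 t" "p2 t"]
      unfolding W_def Py distrib_right[of "V z" for z] by simp
  qed
  define D where "D = a\<^sup>2 * ((k + (G + 2 * B)) * (LBINT y. \<bar>\<rho>4 y\<bar>)) + A * a"
  show thesis
  proof (rule that[of D])
    fix t0 t1 assume t: "0 \<le> t0" "t0 \<le> t1" "t1 < T"
    define S where "S = t1 - t0"
    define J J2 where "J = (\<lambda>t. LBINT y. V (t, x0 + y) * \<rho> y)" and "J2 = (\<lambda>t. LBINT y. V (t, x0 + y) * \<rho>2 y)"
    have t01: "0 \<le> t1" "t0 < T" using t by auto
    have "J t1 + p0 t1 + p2 t1 * m2 + a * S * (J2 t1 + 2 * p2 t1) - a\<^sup>2 * S\<^sup>2 * ((k + (G + 2 * B)) * (LBINT y. \<bar>\<rho>4 y\<bar>))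
      \<le> J t0 + p0 t0 + p2 t0 * m2"
      using est[OF t] unfolding split[OF t01(1) t(3)] split[OF t(1) t01(2)] J_def J2_def S_def .
    \<comment> \<open>The multiples of \<open>B\<close> cancel because that part of \<open>P\<close>
      is caloric; the terms in \<open>A * a\<close> combine to \<open>- A * a * S\<^sup>2\<close>,
      the second summand of \<open>D\<close>.\<close>
    moreover have "p0 t1 + p2 t1 * m2 + a * S * (2 * p2 t1) - (p0 t0 + p2 t0 * m2) = S * (c - A * m2) - A * a * S\<^sup>2"
      unfolding S_def p0_def p2_def by (simp add: power2_eq_square algebra_simps)
    moreover have "S * (c - A * h\<^sup>2) \<le> S * (c - A * m2)"
      using m2 A t by (intro mult_left_mono diff_left_mono) (auto simp: S_def)
    ultimately have "J t1 + a * S * J2 t1 + S * (c - A * h\<^sup>2) - D * S\<^sup>2 \<le> J t0"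
      unfolding D_def by (simp add: algebra_simps)
    then show "(LBINT y. V (t1, x0 + y) * \<rho> y) + a * (t1 - t0) * (LBINT y. V (t1, x0 + y) * \<rho>2 y)
     + (t1 - t0) * (c - A * h\<^sup>2) - D * (t1 - t0)\<^sup>2 \<le> (LBINT y. V (t0, x0 + y) * \<rho> y)"
      by (simp add: J_def J2_def S_def)
  qed
qed

section \<open>Space-time mollification\<close>


text \<open>The value 0 is a placeholder that makes the function total for space-time integrals. For
  \<open>0 \<le> t\<close> and \<open>t + 2 * h < T\<close> the shifted kernel samples only times at
  which \<open>V\<close> itself is used.\<close>

definition time_cut :: "real \<Rightarrow> (real \<times> real \<Rightarrow> real) \<Rightarrow> real \<times> real \<Rightarrow> real" where
  "time_cut T V z = (if 0 \<le> fst z \<and> fst z < T then V z else 0)"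

text \<open>Lower semicontinuity makes superlevel sets relatively open in the strip, hence Borel;
  linear growth bounds the function on balls.\<close>

lemma locally_bdd_borel_time_cut:
  assumes lsc: "lsc_on ({0..<T} \<times> UNIV) V"
    and growth: "\<And>t x. 0 \<le> t \<Longrightarrow> t < T \<Longrightarrow> \<bar>V (t, x)\<bar> \<le> Cg * (1 + \<bar>x\<bar>)"
  shows "locally_bdd_borel (time_cut T V)"
  unfolding locally_bdd_borel_def
proof (intro conjI allI)
  define S where "S = ({0..<T} \<times> UNIV :: (real \<times> real) set)"
  have S: "S \<in> sets borel"
  proof -
    have "S = {z. 0 \<le> fst z} \<inter> {z. fst z < T}" by (auto simp: S_def)
    moreover have "closed {z::real\<times>real. 0 \<le> fst z}" by (intro closed_Collect_le continuous_intros)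
    moreover have "open {z::real\<times>real. fst z < T}" by (intro open_Collect_less continuous_intros)
    ultimately show ?thesis by (auto intro!: sets.Int)
  qed
  show "time_cut T V \<in> borel_measurable borel"
  proof (rule borel_measurableI_greater)
    fix c
    have "\<exists>d. d > 0 \<and> (\<forall>w\<in>S. dist w z < d \<longrightarrow> c < V w)" if "z \<in> S" "V z > c" for z
      using lsc_onD[OF lsc, of z "V z - c"] that by (auto simp: S_def)
    then obtain d where d: "\<And>z. z \<in> S \<Longrightarrow> V z > c \<Longrightarrow> d z > 0 \<and> (\<forall>w\<in>S. dist w z < d z \<longrightarrow> c < V w)" by metis
    define Op where "Op = (\<Union>z\<in>{z\<in>S. V z > c}. ball z (d z))"
    have "{z\<in>S. V z > c} = S \<inter> Op"
    proof (intro equalityI subsetI)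
      fix z assume z: "z \<in> {z\<in>S. V z > c}"
      then have "z \<in> ball z (d z)" using d[of z] by simp
      then show "z \<in> S \<inter> Op" using z unfolding Op_def by blast
    next
      fix w assume "w \<in> S \<inter> Op"
      then obtain z where "w \<in> S" "z \<in> S" "V z > c" "dist w z < d z" unfolding Op_def by (auto simp: dist_commute)
      then show "w \<in> {z\<in>S. V z > c}" using d[of z] by blast
    qed
    moreover have "open Op" unfolding Op_def by auto
    ultimately have "{z\<in>S. V z > c} \<in> sets borel" using S by auto
    moreover have "{z \<in> space borel. c < time_cut T V z} = {z\<in>S. V z > c} \<union> (if c < 0 then - S else {})"
      by (auto simp: time_cut_def S_def)
    ultimately show "{z \<in> space borel. c < time_cut T V z} \<in> sets borel" using S by auto
  qed
  fix R :: real
  have "\<bar>time_cut T V z\<bar> \<le> \<bar>Cg\<bar> * (1 + R)" if "norm z \<le> R" for z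
  proof (cases "0 \<le> fst z \<and> fst z < T")
    case True
    have "\<bar>snd z\<bar> \<le> R" using that norm_snd_le[of "snd z" "fst z"] by simp
    then have "Cg * (1 + \<bar>snd z\<bar>) \<le> \<bar>Cg\<bar> * (1 + R)" by (intro mult_mono) auto
    then show ?thesis using True growth[of "fst z" "snd z"] by (simp add: time_cut_def)
  next
    case False
    then have "time_cut T V z = 0" by (auto simp: time_cut_def)
    moreover have "R \<ge> 0" using that norm_ge_zero[of z] by linarith
    ultimately show ?thesis by simp
  qed
  then show "\<exists>C. \<forall>z. norm z \<le> R \<longrightarrow> \<bar>time_cut T V z\<bar> \<le> C" by blast
qed

text \<open>The time kernel is shifted by \<open>h\<close>, so that only values of \<open>u\<close> at times in \<open>[t, t + 2h]\<close> enter.\<close>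
definition conv2 :: "real \<Rightarrow> (real \<times> real \<Rightarrow> real) \<Rightarrow> (real \<Rightarrow> real) \<Rightarrow> (real \<Rightarrow> real) \<Rightarrow> real \<times> real \<Rightarrow> real" where
  "conv2 h u \<alpha> \<beta> p = (LBINT z. u z * (\<alpha> (fst z - fst p - h) * \<beta> (snd z - snd p)))"

context
  fixes h :: real and u :: "real \<times> real \<Rightarrow> real"
  assumes u: "locally_bdd_borel u" and h: "h > 0"
begin

lemma conv2_kernel_continuous:
  assumes "compact_kernel h \<alpha>" "compact_kernel h \<beta>"
  shows "continuous_on UNIV (\<lambda>pz. \<alpha> (fst (snd pz) - fst (fst pz) - h) * \<beta> (snd (snd pz) - snd (fst pz)))"
proof -
  have c: "continuous_on UNIV \<alpha>" "continuous_on UNIV \<beta>" using assms unfolding compact_kernel_def by auto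
  show ?thesis
    by (intro continuous_intros continuous_on_compose2[OF c(1)] continuous_on_compose2[OF c(2)]) auto
qed

text \<open>One radius for all \<open>p\<close> within distance 1 of \<open>p0\<close>, as
  differentiation under the integral demands. The time shift accounts for support up to
  \<open>2 * h\<close> in time.\<close>

lemma conv2_kernel_support:
  assumes "compact_kernel h \<alpha>" "compact_kernel h \<beta>" "dist p p0 \<le> 1" "norm p0 + 4 * h + 3 < norm z"
  shows "\<alpha> (fst z - fst p - h) * \<beta> (snd z - snd p) = 0"
proof (rule ccontr)
  assume "\<alpha> (fst z - fst p - h) * \<beta> (snd z - snd p) \<noteq> 0"
  then have "\<bar>fst z - fst p - h\<bar> \<le> h" "\<bar>snd z - snd p\<bar> \<le> h"
    using assms(1,2) unfolding compact_kernel_def by (auto simp: not_le[symmetric])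
  then have "\<bar>fst (z - p)\<bar> + \<bar>snd (z - p)\<bar> \<le> 3 * h" using h by auto
  moreover have "norm (z - p) \<le> \<bar>fst (z - p)\<bar> + \<bar>snd (z - p)\<bar>"
    using norm_Pair_le[of "fst (z - p)" "snd (z - p)"] unfolding prod.collapse real_norm_def .
  moreover have "norm z \<le> norm (z - p) + norm (p - p0) + norm p0"
    using norm_triangle_ineq[of "z - p" p] norm_triangle_ineq[of "p - p0" p0] by simp
  ultimately show False using assms(3,4) h by (simp add: dist_norm)
qed

lemma conv2_continuous:
  assumes k: "compact_kernel h \<alpha>" "compact_kernel h \<beta>"
  shows "continuous_on UNIV (conv2 h u \<alpha> \<beta>)"
  unfolding conv2_def
proof (rule continuous_on_param_integral[OF u conv2_kernel_continuous[OF k]])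
  show "\<exists>R. \<forall>p z. dist p p0 \<le> 1 \<longrightarrow> R < norm z \<longrightarrow> \<alpha> (fst z - fst p - h) * \<beta> (snd z - snd p) = 0" for p0 :: "real \<times> real"
    using conv2_kernel_support[OF k] by blast
qed

lemma conv2_integrable:
  assumes k: "compact_kernel h \<alpha>" "compact_kernel h \<beta>"
  shows "integrable lborel (\<lambda>z. u z * (\<alpha> (fst z - fst p - h) * \<beta> (snd z - snd p)))"
  by (rule integrable_times_kernel[OF u continuous_slice[OF conv2_kernel_continuous[OF k], of p] conv2_kernel_support[OF k, of p p]]) auto

lemma conv2_DERIV_time:
  assumes k: "compact_kernel h \<alpha>" "compact_kernel h \<alpha>'" "compact_kernel h \<beta>"
    and der: "\<And>y. (\<alpha> has_real_derivative \<alpha>' y) (at y)"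
  shows "((\<lambda>t. conv2 h u \<alpha> \<beta> (t, x)) has_real_derivative - conv2 h u \<alpha>' \<beta> (t, x)) (at t)"
proof -
  have c: "continuous_on UNIV \<alpha>" "continuous_on UNIV \<alpha>'" "continuous_on UNIV \<beta>"
    using k unfolding compact_kernel_def by auto
  have "((\<lambda>t. LBINT z. u z * (\<alpha> (fst z - t - h) * \<beta> (snd z - x))) has_real_derivative
      (LBINT z. u z * (- (\<alpha>' (fst z - t - h) * \<beta> (snd z - x))))) (at t)"
  proof (rule DERIV_param_integral[OF u])
    show "continuous_on UNIV (\<lambda>pz. \<alpha> (fst (snd pz) - fst pz - h) * \<beta> (snd (snd pz) - x))"
      by (intro continuous_intros continuous_on_compose2[OF c(1)] continuous_on_compose2[OF c(3)]) auto
    show "continuous_on UNIV (\<lambda>pz. - (\<alpha>' (fst (snd pz) - fst pz - h) * \<beta> (snd (snd pz) - x)))"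
      by (intro continuous_intros continuous_on_compose2[OF c(2)] continuous_on_compose2[OF c(3)]) auto
    show "((\<lambda>t. \<alpha> (fst z - t - h) * \<beta> (snd z - x)) has_real_derivative - (\<alpha>' (fst z - t - h) * \<beta> (snd z - x))) (at t)" for t z
    proof -
      have "((\<lambda>t. \<alpha> (fst z - t - h)) has_real_derivative \<alpha>' (fst z - t - h) * (- 1)) (at t)"
        by (rule DERIV_chain2[OF der]) (auto intro!: derivative_eq_intros)
      from DERIV_cmult_right[OF this, of "\<beta> (snd z - x)"] show ?thesis by simp
    qed
    show "\<exists>R. \<forall>p z. dist p t \<le> 1 \<longrightarrow> R < norm z \<longrightarrow>
        \<alpha> (fst z - p - h) * \<beta> (snd z - x) = 0 \<and> - (\<alpha>' (fst z - p - h) * \<beta> (snd z - x)) = 0"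
      using conv2_kernel_support[OF k(1,3), of "(p, x)" "(t, x)" for p] conv2_kernel_support[OF k(2,3), of "(p, x)" "(t, x)" for p]
      by (intro exI[of _ "norm (t, x) + 4 * h + 3"]) (simp add: dist_Pair_Pair)
  qed
  then show ?thesis by (simp add: conv2_def)
qed

lemma conv2_DERIV_space:
  assumes k: "compact_kernel h \<alpha>" "compact_kernel h \<beta>" "compact_kernel h \<beta>'"
    and der: "\<And>y. (\<beta> has_real_derivative \<beta>' y) (at y)"
  shows "((\<lambda>x. conv2 h u \<alpha> \<beta> (t, x)) has_real_derivative - conv2 h u \<alpha> \<beta>' (t, x)) (at x)"
proof -
  have c: "continuous_on UNIV \<alpha>" "continuous_on UNIV \<beta>" "continuous_on UNIV \<beta>'"
    using k unfolding compact_kernel_def by auto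
  have "((\<lambda>x. LBINT z. u z * (\<alpha> (fst z - t - h) * \<beta> (snd z - x))) has_real_derivative
      (LBINT z. u z * (- (\<alpha> (fst z - t - h) * \<beta>' (snd z - x))))) (at x)"
  proof (rule DERIV_param_integral[OF u])
    show "continuous_on UNIV (\<lambda>pz. \<alpha> (fst (snd pz) - t - h) * \<beta> (snd (snd pz) - fst pz))"
      by (intro continuous_intros continuous_on_compose2[OF c(1)] continuous_on_compose2[OF c(2)]) auto
    show "continuous_on UNIV (\<lambda>pz. - (\<alpha> (fst (snd pz) - t - h) * \<beta>' (snd (snd pz) - fst pz)))"
      by (intro continuous_intros continuous_on_compose2[OF c(1)] continuous_on_compose2[OF c(3)]) auto
    show "((\<lambda>x. \<alpha> (fst z - t - h) * \<beta> (snd z - x)) has_real_derivative - (\<alpha> (fst z - t - h) * \<beta>' (snd z - x))) (at x)" for x z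
    proof -
      have "((\<lambda>x. \<beta> (snd z - x)) has_real_derivative \<beta>' (snd z - x) * (- 1)) (at x)"
        by (rule DERIV_chain2[OF der]) (auto intro!: derivative_eq_intros)
      from DERIV_cmult[OF this, of "\<alpha> (fst z - t - h)"] show ?thesis by simp
    qed
    show "\<exists>R. \<forall>p z. dist p x \<le> 1 \<longrightarrow> R < norm z \<longrightarrow>
        \<alpha> (fst z - t - h) * \<beta> (snd z - p) = 0 \<and> - (\<alpha> (fst z - t - h) * \<beta>' (snd z - p)) = 0"
      using conv2_kernel_support[OF k(1,2), of "(t, p)" "(t, x)" for p] conv2_kernel_support[OF k(1,3), of "(t, p)" "(t, x)" for p]
      by (intro exI[of _ "norm (t, x) + 4 * h + 3"]) (simp add: dist_Pair_Pair)
  qed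
  then show ?thesis by (simp add: conv2_def)
qed

lemma conv2_C12_test:
  assumes ker: "kernel4 h \<rho> \<rho>1 \<rho>2 \<rho>3 \<rho>4"
  shows "C12_test (conv2 h u \<rho> \<rho>) (\<lambda>z. - conv2 h u \<rho>1 \<rho> z) (\<lambda>z. - conv2 h u \<rho> \<rho>1 z) (conv2 h u \<rho> \<rho>2)"
proof -
  note ck = kernel4_compact[OF ker]
  have d: "\<And>y. (\<rho> has_real_derivative \<rho>1 y) (at y)" "\<And>y. (\<rho>1 has_real_derivative \<rho>2 y) (at y)"
    using ker unfolding kernel4_def by auto
  have "((\<lambda>y. - conv2 h u \<rho> \<rho>1 (t, y)) has_real_derivative conv2 h u \<rho> \<rho>2 (t, x)) (at x)" for t x
    using DERIV_minus[OF conv2_DERIV_space[OF ck(1,2,3) d(2)]] by simp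
  then show ?thesis
    unfolding C12_test_def
    by (intro conjI allI conv2_continuous continuous_on_minus ck conv2_DERIV_time conv2_DERIV_space d)
qed

text \<open>Fubini: smoothness is read off the space-time integral, the supersolution inequality off
  the time integral of spatial averages. The spatial average need not be continuous in time, so its
  integrability is also taken from Fubini.\<close>

lemma conv2_iterated:
  assumes k: "compact_kernel h \<alpha>" "compact_kernel h \<beta>"
  shows "conv2 h u \<alpha> \<beta> (t, x) = (LBINT s. (LBINT y. u (t + h + s, x + y) * \<beta> y) * \<alpha> s)"
    and "integrable lborel (\<lambda>s. (LBINT y. u (t + h + s, x + y) * \<beta> y) * \<alpha> s)"
proof -
  define F where "F = (\<lambda>z. u z * (\<alpha> (fst z - t - h) * \<beta> (snd z - x)))"
  have int: "integrable (lborel \<Otimes>\<^sub>M lborel) F"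
    using conv2_integrable[OF k, of "(t, x)"] by (simp add: F_def lborel_prod)
  define J where "J = (\<lambda>s. LBINT y. u (s, x + y) * \<beta> y)"
  have inner: "(LBINT y. F (s, y)) = J s * \<alpha> (s - t - h)" for s
  proof -
    have "(LBINT y. F (s, y)) = (LBINT y. (u (s, y) * \<beta> (y - x)) * \<alpha> (s - t - h))"
      by (intro Bochner_Integration.integral_cong refl) (simp add: F_def)
    also have "\<dots> = (LBINT y. u (s, y) * \<beta> (y - x)) * \<alpha> (s - t - h)" by simp
    finally show ?thesis by (simp add: J_def conv_translate[of "\<lambda>y. u (s, y)"])
  qed
  have i1: "integrable lborel (\<lambda>s. J s * \<alpha> (s - t - h))"
    using lborel_pair.integrable_fst'[OF int] unfolding inner .
  have "conv2 h u \<alpha> \<beta> (t, x) = (\<integral>z. F z \<partial>(lborel \<Otimes>\<^sub>M lborel))"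
    by (simp add: conv2_def F_def lborel_prod)
  also have "\<dots> = (LBINT s. J s * \<alpha> (s - t - h))"
    using lborel_pair.integral_fst'[OF int] unfolding inner by simp
  also have "\<dots> = (LBINT s. J (t + h + s) * \<alpha> s)"
    using lborel_integral_real_affine[of 1 "\<lambda>s. J s * \<alpha> (s - t - h)" "t + h"] by simp
  finally show "conv2 h u \<alpha> \<beta> (t, x) = (LBINT s. (LBINT y. u (t + h + s, x + y) * \<beta> y) * \<alpha> s)"
    by (simp add: J_def)
  have "integrable lborel (\<lambda>s. J (t + h + 1 * s) * \<alpha> (t + h + 1 * s - t - h))"
    by (rule lborel_integrable_real_affine[OF i1]) simp
  then show "integrable lborel (\<lambda>s. (LBINT y. u (t + h + s, x + y) * \<beta> y) * \<alpha> s)"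
    by (simp add: J_def)
qed

end

lemma kernel4_mono_integrable:
  assumes k: "kernel4 h \<rho> \<rho>1 \<rho>2 \<rho>3 \<rho>4" and int: "integrable lborel (\<lambda>s. u s * \<rho> s)" "integrable lborel (\<lambda>s. w s * \<rho> s)"
    and le: "\<And>y. \<bar>y\<bar> \<le> h \<Longrightarrow> u y \<le> w y"
  shows "(LBINT y. u y * \<rho> y) \<le> (LBINT y. w y * \<rho> y)"
proof (rule integral_mono[OF int])
  show "u y * \<rho> y \<le> w y * \<rho> y" for y
    using le[of y] k unfolding kernel4_def by (cases "\<bar>y\<bar> \<le> h") (auto intro!: mult_right_mono)
qed

lemma kernel4_const_integrable: "kernel4 h \<rho> \<rho>1 \<rho>2 \<rho>3 \<rho>4 \<Longrightarrow> integrable lborel (\<lambda>s. c * \<rho> s)"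
  by (rule compact_kernel_integrable[OF locally_bdd_borel_const kernel4_compact(1)])

context
  fixes T :: real and V :: "real \<times> real \<Rightarrow> real" and Cg G h :: real and \<rho> \<rho>1 \<rho>2 \<rho>3 \<rho>4 :: "real \<Rightarrow> real"
  assumes lsc: "lsc_on ({0..<T} \<times> UNIV) V"
    and growth: "\<And>t x. 0 \<le> t \<Longrightarrow> t < T \<Longrightarrow> \<bar>V (t, x)\<bar> \<le> Cg * (1 + \<bar>x\<bar>)"
    and cont: "\<And>t. 0 \<le> t \<Longrightarrow> t < T \<Longrightarrow> continuous_on UNIV (\<lambda>x. V (t, x))"
    and sc: "\<And>t x y. 0 \<le> t \<Longrightarrow> t < T \<Longrightarrow> V (t, x + y) + V (t, x - y) \<le> 2 * V (t, x) + G * y\<^sup>2" and G: "G \<ge> 0"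
    and ker: "kernel4 h \<rho> \<rho>1 \<rho>2 \<rho>3 \<rho>4"
begin

private lemma kernel_pos: "h > 0" using ker by (simp add: kernel4_def)

private lemma cut_eq: "0 \<le> t \<Longrightarrow> t < T \<Longrightarrow> time_cut T V (t, x) = V (t, x)" by (simp add: time_cut_def)

private lemma cut_borel: "locally_bdd_borel (time_cut T V)"
  by (rule locally_bdd_borel_time_cut[OF lsc growth])

private lemmas mollify_iterated = conv2_iterated[OF cut_borel kernel_pos kernel4_compact(1)[OF ker]]

lemma mollify_ge:
  assumes t: "0 \<le> t" "t + 2 * h < T"
    and ge: "\<And>s y. t \<le> s \<Longrightarrow> s \<le> t + 2 * h \<Longrightarrow> \<bar>y\<bar> \<le> h \<Longrightarrow> m \<le> V (s, x + y)"
  shows "m \<le> conv2 h (time_cut T V) \<rho> \<rho> (t, x)"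
proof -
  have "m = (LBINT s. m * \<rho> s)" by (simp only: kernel4_const(1)[OF ker])
  also have "\<dots> \<le> (LBINT s. (LBINT y. time_cut T V (t + h + s, x + y) * \<rho> y) * \<rho> s)"
  proof (rule kernel4_mono_integrable[OF ker kernel4_const_integrable[OF ker] mollify_iterated(2)[OF kernel4_compact(1)[OF ker]]])
    fix s assume s: "\<bar>s\<bar> \<le> h"
    then have r: "0 \<le> t + h + s" "t + h + s < T" using t by auto
    have "m = (LBINT y. m * \<rho> y)" by (simp only: kernel4_const(1)[OF ker])
    also have "\<dots> \<le> (LBINT y. V (t + h + s, x + y) * \<rho> y)"
      by (rule kernel4_mono[OF ker locally_bdd_borel_const
            locally_bdd_borel_translate[OF locally_bdd_borel_continuous[OF cont[OF r]]]]) (use s in \<open>auto intro!: ge\<close>)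
    finally show "m \<le> (LBINT y. time_cut T V (t + h + s, x + y) * \<rho> y)" by (simp add: cut_eq[OF r])
  qed
  also have "\<dots> = conv2 h (time_cut T V) \<rho> \<rho> (t, x)" by (rule mollify_iterated(1)[OF kernel4_compact(1)[OF ker], symmetric])
  finally show ?thesis .
qed

text \<open>Averaging in space raises \<open>V\<close> by at most \<open>G * h\<^sup>2 / 2\<close>
  through semiconcavity, and looking ahead by up to \<open>2 * h\<close> raises it by at most
  \<open>2 * C0 * h\<close>.\<close>

lemma mollify_le:
  assumes t: "0 \<le> t" "t + 2 * h < T" and C0: "C0 \<ge> 0"
    and inc: "\<And>s. t \<le> s \<Longrightarrow> s < T \<Longrightarrow> V (s, x) \<le> V (t, x) + C0 * (s - t)"
  shows "conv2 h (time_cut T V) \<rho> \<rho> (t, x) \<le> V (t, x) + 2 * C0 * h + G * h\<^sup>2 / 2"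
proof -
  define m where "m = V (t, x) + 2 * C0 * h + G * h\<^sup>2 / 2"
  have "conv2 h (time_cut T V) \<rho> \<rho> (t, x) = (LBINT s. (LBINT y. time_cut T V (t + h + s, x + y) * \<rho> y) * \<rho> s)"
    by (rule mollify_iterated(1)[OF kernel4_compact(1)[OF ker]])
  also have "\<dots> \<le> (LBINT s. m * \<rho> s)"
  proof (rule kernel4_mono_integrable[OF ker mollify_iterated(2)[OF kernel4_compact(1)[OF ker]] kernel4_const_integrable[OF ker]])
    fix s assume s: "\<bar>s\<bar> \<le> h"
    then have r: "0 \<le> t + h + s" "t + h + s < T" using t by auto
    have "(LBINT y. time_cut T V (t + h + s, x + y) * \<rho> y) = (LBINT y. V (t + h + s, x + y) * \<rho> y)"
      by (simp add: cut_eq[OF r])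
    also have "\<dots> \<le> V (t + h + s, x) + G * h\<^sup>2 / 2"
      by (rule kernel4_average_le[OF ker locally_bdd_borel_continuous[OF cont[OF r]] sc[OF r] G])
    also have "V (t + h + s, x) \<le> V (t, x) + C0 * (h + s)" using inc[of "t + h + s"] s r by simp
    also have "C0 * (h + s) \<le> C0 * (2 * h)" using s C0 by (intro mult_left_mono) auto
    finally show "(LBINT y. time_cut T V (t + h + s, x + y) * \<rho> y) \<le> m" by (simp add: m_def)
  qed
  also have "\<dots> = m" by (rule kernel4_const(1)[OF ker])
  finally show ?thesis by (simp add: m_def)
qed

text \<open>The fixed-time estimate, averaged in time and divided by the increment \<open>S\<close>,
  becomes a differential inequality as \<open>S\<close> tends to 0. The convolution with
  \<open>\<rho>1\<close> in time is minus the time derivative of the mollification.\<close>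

lemma mollify_linear_supersolution:
  assumes t0: "0 \<le> t0" "t0 + 2 * h < T" and a: "a \<ge> 0" and A: "A \<ge> 0"
    and jet: "\<And>t x q M. subjet T V t x q M \<Longrightarrow> c - A * (x - x0)\<^sup>2 \<le> - q - a * M"
  shows "c - A * h\<^sup>2 \<le> conv2 h (time_cut T V) \<rho>1 \<rho> (t0, x0) - a * conv2 h (time_cut T V) \<rho> \<rho>2 (t0, x0)"
proof -
  note ck = kernel4_compact[OF ker]
  define W where "W = conv2 h (time_cut T V) \<rho> \<rho>"
  define Wxx where "Wxx = conv2 h (time_cut T V) \<rho> \<rho>2"
  define wt where "wt = conv2 h (time_cut T V) \<rho>1 \<rho> (t0, x0)"
  have test: "C12_test W (\<lambda>z. - conv2 h (time_cut T V) \<rho>1 \<rho> z) (\<lambda>z. - conv2 h (time_cut T V) \<rho> \<rho>1 z) Wxx"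
    unfolding W_def Wxx_def by (rule conv2_C12_test[OF cut_borel kernel_pos ker])
  obtain D where D: "\<And>t0 t1. 0 \<le> t0 \<Longrightarrow> t0 \<le> t1 \<Longrightarrow> t1 < T \<Longrightarrow>
     (LBINT y. V (t1, x0 + y) * \<rho> y) + a * (t1 - t0) * (LBINT y. V (t1, x0 + y) * \<rho>2 y)
     + (t1 - t0) * (c - A * h\<^sup>2) - D * (t1 - t0)\<^sup>2 \<le> (LBINT y. V (t0, x0 + y) * \<rho> y)"
    by (rule linear_supersolution_mollified[OF lsc a A jet growth cont sc G ker]) (assumption+, rule that, blast)
  define J J2 where "J = (\<lambda>t. LBINT y. time_cut T V (t, x0 + y) * \<rho> y)"
    and "J2 = (\<lambda>t. LBINT y. time_cut T V (t, x0 + y) * \<rho>2 y)"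
  have W: "W (t, x0) = (LBINT s. J (t + h + s) * \<rho> s)" "integrable lborel (\<lambda>s. J (t + h + s) * \<rho> s)" for t
    unfolding W_def J_def by (rule mollify_iterated[OF ck(1)])+
  have Wxx: "Wxx (t, x0) = (LBINT s. J2 (t + h + s) * \<rho> s)" "integrable lborel (\<lambda>s. J2 (t + h + s) * \<rho> s)" for t
    unfolding Wxx_def J2_def by (rule mollify_iterated[OF ck(3)])+
  have step: "(W (t0 + S, x0) - W (t0, x0)) / S + a * Wxx (t0 + S, x0) + (c - A * h\<^sup>2) - D * S \<le> 0"
    if S: "S > 0" "S < T - t0 - 2 * h" for S
  proof -
    define b where "b = S * (c - A * h\<^sup>2) - D * S\<^sup>2"
    have i: "integrable lborel (\<lambda>s. J (t0 + S + h + s) * \<rho> s)" "integrable lborel (\<lambda>s. a * S * (J2 (t0 + S + h + s) * \<rho> s))"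
        "integrable lborel (\<lambda>s. b * \<rho> s)"
      using W(2)[of "t0 + S"] integrable_mult_right[OF Wxx(2)[of "t0 + S"]] kernel4_const_integrable[OF ker] by blast+
    have "W (t0 + S, x0) + a * S * Wxx (t0 + S, x0) + b
        = (LBINT s. J (t0 + S + h + s) * \<rho> s + a * S * (J2 (t0 + S + h + s) * \<rho> s) + b * \<rho> s)"
      using i kernel4_const(1)[OF ker, of b] by (simp add: W Wxx)
    also have "\<dots> = (LBINT s. (J (t0 + S + h + s) + a * S * J2 (t0 + S + h + s) + b) * \<rho> s)"
      by (intro Bochner_Integration.integral_cong refl) (simp add: algebra_simps)
    also have "\<dots> \<le> (LBINT s. J (t0 + h + s) * \<rho> s)"
    proof (rule kernel4_mono_integrable[OF ker _ W(2)])
      have "integrable lborel (\<lambda>s. J (t0 + S + h + s) * \<rho> s + a * S * (J2 (t0 + S + h + s) * \<rho> s) + b * \<rho> s)"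
        using i by simp
      then show "integrable lborel (\<lambda>s. (J (t0 + S + h + s) + a * S * J2 (t0 + S + h + s) + b) * \<rho> s)"
        by (simp add: algebra_simps)
      fix s assume s: "\<bar>s\<bar> \<le> h"
      then have r: "0 \<le> t0 + h + s" "t0 + h + s \<le> t0 + S + h + s" "t0 + S + h + s < T" "t0 + h + s < T" "0 \<le> t0 + S + h + s" using t0 S by auto
      show "J (t0 + S + h + s) + a * S * J2 (t0 + S + h + s) + b \<le> J (t0 + h + s)"
        using D[OF r(1,2,3)] unfolding J_def J2_def cut_eq[OF r(1,4)] cut_eq[OF r(5,3)] b_def by (simp add: algebra_simps)
    qed
    also have "\<dots> = W (t0, x0)" by (simp add: W)
    finally have "W (t0 + S, x0) - W (t0, x0) + a * S * Wxx (t0 + S, x0) + b \<le> 0" by simp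
    then have "(W (t0 + S, x0) - W (t0, x0) + a * S * Wxx (t0 + S, x0) + b) / S \<le> 0" using S by (simp add: divide_le_0_iff)
    then show ?thesis using S by (simp add: b_def add_divide_distrib diff_divide_distrib power2_eq_square)
  qed
  have "((\<lambda>S. (W (t0 + S, x0) - W (t0, x0)) / S) \<longlongrightarrow> - wt) (at 0)"
    using test unfolding C12_test_def DERIV_def wt_def by blast
  \<comment> \<open>The estimate compares with later times, so only the limit from the right is
    available; differentiability of \<open>W\<close> makes that sufficient.\<close>
  then have l1: "((\<lambda>S. (W (t0 + S, x0) - W (t0, x0)) / S) \<longlongrightarrow> - wt) (at_right 0)"
    by (rule filterlim_mono) (auto simp: at_le)
  have "isCont (\<lambda>S. Wxx (t0 + S, x0)) 0"
  proof -
    have "continuous_on UNIV Wxx" using test unfolding C12_test_def by blast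
    then have "continuous_on UNIV (\<lambda>S. Wxx (t0 + S, x0))" by (rule continuous_on_compose2) (auto intro!: continuous_intros)
    then show ?thesis by (simp add: continuous_on_eq_continuous_at)
  qed
  then have l2: "((\<lambda>S. Wxx (t0 + S, x0)) \<longlongrightarrow> Wxx (t0, x0)) (at_right 0)"
    unfolding isCont_def by (simp add: filterlim_at_split)
  have "((\<lambda>S. (W (t0 + S, x0) - W (t0, x0)) / S + a * Wxx (t0 + S, x0) + (c - A * h\<^sup>2) - D * S)
      \<longlongrightarrow> - wt + a * Wxx (t0, x0) + (c - A * h\<^sup>2) - D * 0) (at_right 0)"
    by (intro tendsto_intros l1 l2)
  moreover have "\<forall>\<^sub>F S in at_right 0. (W (t0 + S, x0) - W (t0, x0)) / S + a * Wxx (t0 + S, x0) + (c - A * h\<^sup>2) - D * S \<le> 0"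
    using t0 step by (intro eventually_at_rightI[of 0 "T - t0 - 2 * h"]) auto
  ultimately have "- wt + a * Wxx (t0, x0) + (c - A * h\<^sup>2) - D * 0 \<le> 0"
    by (rule tendsto_upperbound) simp
  then show ?thesis by (simp add: wt_def Wxx_def)
qed

end

section \<open>The shaken gamma-constrained operator\<close>


text \<open>Far to the right \<open>a * z + b\<close> has constant sign, so \<open>k\<close> is
  affine with slope \<open>\<bar>a\<bar>\<close>. That slope is a value of \<open>k'\<close> and
  inherits the strict bound.\<close>

lemma affine_tail_slope:
  fixes k :: "real \<Rightarrow> real"
  assumes der: "\<And>z. (k has_real_derivative k' z) (at z)" and bd: "\<And>z. \<bar>k' z\<bar> < L"
    and tail: "\<And>z. X \<le> z \<Longrightarrow> k z = \<bar>a * z + b\<bar> + 1"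
  shows "\<bar>a\<bar> < L"
proof (cases "a = 0")
  case True
  then show ?thesis using bd[of 0] by auto
next
  case False
  define w where "w = max X (\<bar>b\<bar> / \<bar>a\<bar>)"
  have eq: "k z = \<bar>a\<bar> * z + sgn a * b + 1" if z: "w \<le> z" for z
  proof -
    have "X \<le> z" "\<bar>b\<bar> / \<bar>a\<bar> \<le> z" using z by (auto simp: w_def)
    then have ba: "\<bar>b\<bar> \<le> \<bar>a\<bar> * z" using False by (simp add: field_simps)
    have "\<bar>a * z + b\<bar> = \<bar>a\<bar> * z + sgn a * b"
      using ba False by (cases "a > 0") (auto simp: sgn_if)
    then show ?thesis using tail[OF \<open>X \<le> z\<close>] by simp
  qed
  obtain \<xi> where "k (w + 1) - k w = (w + 1 - w) * k' \<xi>"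
    using MVT2[of w "w + 1" k k'] der by auto
  then have "\<bar>a\<bar> = k' \<xi>" using eq[of w] eq[of "w + 1"] by (simp add: algebra_simps)
  then show ?thesis using bd[of \<xi>] by simp
qed

definition admissible_shaking :: "(real \<Rightarrow> real) \<Rightarrow> (real \<Rightarrow> real) \<Rightarrow> real \<Rightarrow> bool" where
  "admissible_shaking \<kappa> \<kappa>' \<epsilon>0 \<longleftrightarrow> 0 < \<epsilon>0 \<and> (\<forall>z. (\<kappa> has_real_derivative \<kappa>' z) (at z)) \<and> continuous_on UNIV \<kappa>' \<and>
     (\<forall>z. 0 < \<kappa> z) \<and> (\<forall>z. \<epsilon>0 * \<bar>\<kappa>' z\<bar> < 1) \<and> (\<exists>\<theta> C. 0 \<le> \<theta> \<and> \<theta> < 1 \<and> (\<forall>z. \<epsilon>0 * \<kappa> z \<le> \<theta> * \<bar>z\<bar> + C))"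

text \<open>The derivative bound is strict only pointwise and would by itself allow
  \<open>\<epsilon>0 * \<kappa> z\<close> to grow like \<open>\<bar>z\<bar>\<close>. The affine
  tails exclude this: both slopes are strictly below \<open>1 / \<epsilon>0\<close>, and the larger
  one yields \<open>\<theta> < 1\<close>. The left tail is handled by reflection.\<close>

lemma admissible_shakingI:
  assumes \<epsilon>0: "0 < \<epsilon>0" and smooth: "smooth_bounded_derivs \<kappa>" and inf: "\<exists>c>0. \<forall>x. c \<le> \<kappa> x"
    and gr: "\<exists>a b. \<forall>x. X \<le> x \<longrightarrow> g x = a * x + b" and gl: "\<exists>a b. \<forall>x. x \<le> - X \<longrightarrow> g x = a * x + b"
    and out: "\<forall>x. (x \<le> - X \<or> X \<le> x) \<longrightarrow> \<kappa> x = \<bar>g x\<bar> + 1"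
    and der: "\<forall>x. - 1 / \<epsilon>0 < deriv \<kappa> x \<and> deriv \<kappa> x < 1 / \<epsilon>0"
  shows "admissible_shaking \<kappa> (deriv \<kappa>) \<epsilon>0"
proof -
  have d: "(\<kappa> has_real_derivative deriv \<kappa> z) (at z)" for z
  proof -
    have "(deriv ^^ 0) \<kappa> differentiable at z" using smooth unfolding smooth_bounded_derivs_def by blast
    then show ?thesis by (simp add: DERIV_deriv_iff_real_differentiable)
  qed
  have "(deriv ^^ 1) \<kappa> differentiable at z" for z using smooth unfolding smooth_bounded_derivs_def by blast
  then have "isCont (deriv \<kappa>) z" for z using differentiable_imp_continuous_within[of "deriv \<kappa>" z UNIV] by simp
  then have c: "continuous_on UNIV (deriv \<kappa>)" by (simp add: continuous_on_eq_continuous_at)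
  have b: "\<bar>deriv \<kappa> z\<bar> < 1 / \<epsilon>0" for z using der[rule_format, of z] by (auto simp: abs_less_iff)
  obtain a1 b1 where r: "\<And>x. X \<le> x \<Longrightarrow> g x = a1 * x + b1" using gr by blast
  obtain a2 b2 where l: "\<And>x. x \<le> - X \<Longrightarrow> g x = a2 * x + b2" using gl by blast
  have a1: "\<bar>a1\<bar> < 1 / \<epsilon>0" by (rule affine_tail_slope[OF d b, of X _ b1]) (use out r in auto)
  have "\<bar>- a2\<bar> < 1 / \<epsilon>0"
  proof (rule affine_tail_slope[of "\<lambda>z. \<kappa> (- z)" "\<lambda>z. - deriv \<kappa> (- z)" _ X _ b2])
    show "((\<lambda>z. \<kappa> (- z)) has_real_derivative - deriv \<kappa> (- z)) (at z)" for z
      by (rule DERIV_cong, rule DERIV_chain2[OF d]) (auto intro!: derivative_eq_intros)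
  qed (use b out l in auto)
  then have a2: "\<bar>a2\<bar> < 1 / \<epsilon>0" by simp
  have ck: "continuous_on UNIV \<kappa>" by (rule DERIV_continuous_on, rule has_field_derivative_at_within, rule d)
  obtain Cm where Cm: "\<And>z. norm z \<le> X \<Longrightarrow> \<bar>\<kappa> z\<bar> \<le> Cm"
    using locally_bdd_borel_continuous[OF ck] unfolding locally_bdd_borel_def by blast
  define m where "m = max \<bar>a1\<bar> \<bar>a2\<bar>"
  define C where "C = \<bar>b1\<bar> + \<bar>b2\<bar> + 1 + \<bar>Cm\<bar>"
  have kb: "\<kappa> z \<le> m * \<bar>z\<bar> + C" for z
  proof -
    have m1: "\<bar>a1\<bar> * \<bar>z\<bar> \<le> m * \<bar>z\<bar>" "\<bar>a2\<bar> * \<bar>z\<bar> \<le> m * \<bar>z\<bar>" by (auto simp: m_def intro!: mult_right_mono)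
    have m0: "0 \<le> m * \<bar>z\<bar>" by (simp add: m_def)
    consider "X \<le> z" | "z \<le> - X" | "\<bar>z\<bar> \<le> X" by linarith
    then show ?thesis
    proof cases
      case 1
      then have "\<kappa> z = \<bar>a1 * z + b1\<bar> + 1" using out r by simp
      moreover have "\<bar>a1 * z + b1\<bar> \<le> \<bar>a1\<bar> * \<bar>z\<bar> + \<bar>b1\<bar>" by (metis abs_mult abs_triangle_ineq)
      ultimately show ?thesis using m1 abs_ge_zero[of b1] abs_ge_zero[of b2] abs_ge_zero[of Cm] unfolding C_def by linarith
    next
      case 2
      then have "\<kappa> z = \<bar>a2 * z + b2\<bar> + 1" using out l by simp
      moreover have "\<bar>a2 * z + b2\<bar> \<le> \<bar>a2\<bar> * \<bar>z\<bar> + \<bar>b2\<bar>" by (metis abs_mult abs_triangle_ineq)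
      ultimately show ?thesis using m1 abs_ge_zero[of b1] abs_ge_zero[of b2] abs_ge_zero[of Cm] unfolding C_def by linarith
    next
      case 3
      then show ?thesis using Cm[of z] m0 by (simp add: C_def)
    qed
  qed
  have "\<epsilon>0 * m < 1" using a1 a2 \<epsilon>0 by (simp add: m_def field_simps max_def)
  moreover have "0 \<le> \<epsilon>0 * m" using \<epsilon>0 by (simp add: m_def)
  moreover have "\<epsilon>0 * \<kappa> z \<le> \<epsilon>0 * m * \<bar>z\<bar> + \<epsilon>0 * C" for z
    using mult_left_mono[OF kb[of z], of \<epsilon>0] \<epsilon>0 by (simp add: algebra_simps)
  ultimately have "\<exists>\<theta> C. 0 \<le> \<theta> \<and> \<theta> < 1 \<and> (\<forall>z. \<epsilon>0 * \<kappa> z \<le> \<theta> * \<bar>z\<bar> + C)" by blast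
  moreover have "\<epsilon>0 * \<bar>deriv \<kappa> z\<bar> < 1" for z using b[of z] \<epsilon>0 by (simp add: field_simps)
  moreover have "0 < \<kappa> z" for z using inf by (meson less_le_trans)
  ultimately show ?thesis unfolding admissible_shaking_def using \<epsilon>0 d c by blast
qed

text \<open>Membership gives \<open>\<bar>x - x'\<bar> \<le> \<theta> * \<bar>x'\<bar> + C\<close>,
  and \<open>\<theta> < 1\<close> lets \<open>\<bar>x'\<bar>\<close> be absorbed.\<close>

lemma Dset_bounded:
  assumes k: "admissible_shaking \<kappa> \<kappa>' \<epsilon>0" and \<epsilon>: "0 \<le> \<epsilon>" "\<epsilon> \<le> \<epsilon>0"
  shows "\<exists>R'. \<forall>x x'. \<bar>x\<bar> \<le> R \<longrightarrow> x' \<in> Dset \<kappa> \<epsilon> x \<longrightarrow> \<bar>x'\<bar> \<le> R'"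
proof -
  obtain \<theta> C where \<theta>: "0 \<le> \<theta>" "\<theta> < 1" "\<And>z. \<epsilon>0 * \<kappa> z \<le> \<theta> * \<bar>z\<bar> + C" and pos: "\<And>z. 0 < \<kappa> z"
    using k unfolding admissible_shaking_def by blast
  have "\<bar>x'\<bar> \<le> (R + C) / (1 - \<theta>)" if x: "\<bar>x\<bar> \<le> R" "x' \<in> Dset \<kappa> \<epsilon> x" for x x'
  proof -
    have "\<bar>(x - x') / \<kappa> x'\<bar> \<le> \<epsilon>" using x(2) by (auto simp: Dset_def)
    then have "\<bar>x - x'\<bar> \<le> \<epsilon> * \<kappa> x'" using pos[of x'] by (simp add: abs_div pos_divide_le_eq)
    also have "\<dots> \<le> \<epsilon>0 * \<kappa> x'" using \<epsilon> pos[of x'] by (intro mult_right_mono) auto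
    also have "\<dots> \<le> \<theta> * \<bar>x'\<bar> + C" by (rule \<theta>(3))
    finally have "\<bar>x'\<bar> * (1 - \<theta>) \<le> R + C" using x(1) by (simp add: algebra_simps)
    then show ?thesis using \<theta>(2) by (simp add: pos_le_divide_eq)
  qed
  then show ?thesis by blast
qed

text \<open>\<open>x'\<close> lies in the shaken set of \<open>x\<close> exactly when
  \<open>x = x' + e * \<kappa> x'\<close> for some \<open>\<bar>e\<bar> \<le> \<epsilon>\<close>.
  Keeping \<open>e\<close> and moving \<open>x\<close>, one solves this equation near
  \<open>x0'\<close>, where the map is increasing with slope at least \<open>m\<close>.\<close>

lemma Dset_perturb:
  assumes k: "admissible_shaking \<kappa> \<kappa>' \<epsilon>0" and \<epsilon>: "0 \<le> \<epsilon>" "\<epsilon> \<le> \<epsilon>0" and d: "d > 0"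
  shows "\<exists>r>0. \<forall>x0 x x0'. \<bar>x0\<bar> \<le> R \<longrightarrow> x0' \<in> Dset \<kappa> \<epsilon> x0 \<longrightarrow> \<bar>x - x0\<bar> \<le> r \<longrightarrow> (\<exists>x'\<in>Dset \<kappa> \<epsilon> x. \<bar>x' - x0'\<bar> \<le> d)"
proof -
  have der: "\<And>z. (\<kappa> has_real_derivative \<kappa>' z) (at z)" and c: "continuous_on UNIV \<kappa>'" and pos: "\<And>z. 0 < \<kappa> z"
    and small: "\<And>z. \<epsilon>0 * \<bar>\<kappa>' z\<bar> < 1"
    using k unfolding admissible_shaking_def by auto
  obtain R' where R': "\<And>x x'. \<bar>x\<bar> \<le> R \<Longrightarrow> x' \<in> Dset \<kappa> \<epsilon> x \<Longrightarrow> \<bar>x'\<bar> \<le> R'"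
    using Dset_bounded[OF k \<epsilon>, of R] by blast
  define Q where "Q = cball (0::real) (\<bar>R'\<bar> + d)"
  \<comment> \<open>The slope bound \<open>1 - \<epsilon>0 * \<bar>\<kappa>' z\<bar>\<close> is
    positive at each point but need not be bounded away from 0 on the line, so its minimum over a
    compact set is taken.\<close>
  have "\<exists>z\<in>Q. \<forall>y\<in>Q. 1 - \<epsilon>0 * \<bar>\<kappa>' z\<bar> \<le> 1 - \<epsilon>0 * \<bar>\<kappa>' y\<bar>"
    by (rule continuous_attains_inf) (use d in \<open>auto simp: Q_def intro!: continuous_intros continuous_on_subset[OF c]\<close>)
  then obtain z where z: "\<And>y. y \<in> Q \<Longrightarrow> 1 - \<epsilon>0 * \<bar>\<kappa>' z\<bar> \<le> 1 - \<epsilon>0 * \<bar>\<kappa>' y\<bar>" by blast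
  define m where "m = 1 - \<epsilon>0 * \<bar>\<kappa>' z\<bar>"
  have m: "m > 0" using small[of z] by (simp add: m_def)
  show ?thesis
  proof (intro exI[of _ "m * d"] conjI allI impI)
    show "m * d > 0" using m d by simp
    fix x0 x x0' assume x0: "\<bar>x0\<bar> \<le> R" "x0' \<in> Dset \<kappa> \<epsilon> x0" and x: "\<bar>x - x0\<bar> \<le> m * d"
    define e where "e = (x0 - x0') / \<kappa> x0'"
    have e: "\<bar>e\<bar> \<le> \<epsilon>" using x0(2) by (auto simp: Dset_def e_def)
    define Y where "Y = (\<lambda>z. z + e * \<kappa> z)"
    have Y0: "Y x0' = x0" using pos[of x0'] by (simp add: Y_def e_def)
    have dY: "(Y has_real_derivative 1 + e * \<kappa>' y) (at y)" for y
      unfolding Y_def by (auto intro!: derivative_eq_intros der)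
    have lower: "m \<le> 1 + e * \<kappa>' y" if "\<bar>y - x0'\<bar> \<le> d" for y
    proof -
      have "y \<in> Q" using that R'[OF x0] by (auto simp: Q_def dist_real_def)
      then have "m \<le> 1 - \<epsilon>0 * \<bar>\<kappa>' y\<bar>" using z by (simp add: m_def)
      moreover have "\<bar>e * \<kappa>' y\<bar> \<le> \<epsilon>0 * \<bar>\<kappa>' y\<bar>" using e \<epsilon> by (auto simp: abs_mult intro!: mult_right_mono)
      ultimately show ?thesis by linarith
    qed
    have up: "Y (x0' + d) \<ge> x"
    proof -
      obtain \<xi> where \<xi>: "x0' < \<xi>" "\<xi> < x0' + d" "Y (x0' + d) - Y x0' = (x0' + d - x0') * (1 + e * \<kappa>' \<xi>)"
        using MVT2[of x0' "x0' + d" Y "\<lambda>y. 1 + e * \<kappa>' y"] dY d by auto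
      have "d * m \<le> d * (1 + e * \<kappa>' \<xi>)" using lower[of \<xi>] \<xi> d by (intro mult_left_mono) auto
      then show ?thesis using \<xi>(3) Y0 x by (simp add: mult.commute abs_le_iff)
    qed
    have dn: "Y (x0' - d) \<le> x"
    proof -
      obtain \<xi> where \<xi>: "x0' - d < \<xi>" "\<xi> < x0'" "Y x0' - Y (x0' - d) = (x0' - (x0' - d)) * (1 + e * \<kappa>' \<xi>)"
        using MVT2[of "x0' - d" x0' Y "\<lambda>y. 1 + e * \<kappa>' y"] dY d by auto
      have "d * m \<le> d * (1 + e * \<kappa>' \<xi>)" using lower[of \<xi>] \<xi> d by (intro mult_left_mono) auto
      then show ?thesis using \<xi>(3) Y0 x by (simp add: mult.commute abs_le_iff)
    qed
    obtain x' where x': "x0' - d \<le> x'" "x' \<le> x0' + d" "Y x' = x"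
      using IVT[of Y "x0' - d" x "x0' + d"] up dn d DERIV_isCont[OF dY] by auto
    have "(x - x') / \<kappa> x' = e" using x'(3) pos[of x'] by (simp add: Y_def field_simps)
    moreover have "e \<in> {- \<epsilon>..\<epsilon>}" using e by (auto simp: abs_le_iff)
    ultimately have "x' \<in> Dset \<kappa> \<epsilon> x" by (simp add: Dset_def del: atLeastAtMost_iff)
    then show "\<exists>x'\<in>Dset \<kappa> \<epsilon> x. \<bar>x' - x0'\<bar> \<le> d" using x' by (intro bexI[of _ x']) auto
  qed
qed

section \<open>Convexity of the Hamiltonian and its dependence on the coefficients\<close>

definition Ham :: "real \<Rightarrow> real \<Rightarrow> real \<Rightarrow> real" where
  "Ham s \<phi> M = s * M / (2 * (1 - \<phi> * M))"

text \<open>With \<open>p = 1 - \<phi> * M\<close> and \<open>r = 1 - \<phi> * N\<close> the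
  distance from graph to tangent is the explicit nonnegative quantity
  \<open>s / 2 * (\<phi> * (N - M)\<^sup>2 / (r * p\<^sup>2))\<close>.\<close>

lemma Ham_tangent:
  assumes s: "s \<ge> 0" and \<phi>: "\<phi> > 0" and M: "\<phi> * M < 1" and N: "\<phi> * N < 1"
  shows "Ham s \<phi> M + s / (2 * (1 - \<phi> * M)\<^sup>2) * (N - M) \<le> Ham s \<phi> N"
proof -
  define p where "p = 1 - \<phi> * M"
  define r where "r = 1 - \<phi> * N"
  have p: "p > 0" and r: "r > 0" using M N by (auto simp: p_def r_def)
  have NM: "\<phi> * (N - M) = p - r" by (simp add: p_def r_def algebra_simps)
  have "N / r - (M / p + (N - M) / p\<^sup>2) = (N * p\<^sup>2 - M * p * r - (N - M) * r) / (r * p\<^sup>2)"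
    using p r by (simp add: field_simps power2_eq_square)
  also have "N * p\<^sup>2 - M * p * r - (N - M) * r = \<phi> * (N - M)\<^sup>2"
    unfolding p_def r_def by (simp add: power2_eq_square algebra_simps)
  also have "\<phi> * (N - M)\<^sup>2 / (r * p\<^sup>2) \<ge> 0" using p r \<phi> by auto
  finally have "M / p + (N - M) / p\<^sup>2 \<le> N / r" by linarith
  then have "s / 2 * (M / p + (N - M) / p\<^sup>2) \<le> s / 2 * (N / r)" using s by (intro mult_left_mono) auto
  then show ?thesis unfolding Ham_def p_def[symmetric] r_def[symmetric] by (simp add: distrib_left)
qed

lemma Ham_convex:
  assumes s: "s \<ge> 0" and \<phi>: "\<phi> > 0" and M: "\<phi> * M < 1" and N: "\<phi> * N < 1" and l: "0 \<le> l" "l \<le> 1"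
  shows "Ham s \<phi> ((1 - l) * M + l * N) \<le> (1 - l) * Ham s \<phi> M + l * Ham s \<phi> N"
proof -
  define P where "P = (1 - l) * M + l * N"
  define a where "a = s / (2 * (1 - \<phi> * P)\<^sup>2)"
  have "\<phi> * P < 1"
  proof -
    have "\<phi> * P = (1 - l) * (\<phi> * M) + l * (\<phi> * N)" by (simp add: P_def algebra_simps)
    then show ?thesis using convex_bound_lt[of "\<phi> * M" 1 "\<phi> * N" "1 - l" l] M N l by simp
  qed
  then have "Ham s \<phi> P + a * (M - P) \<le> Ham s \<phi> M" "Ham s \<phi> P + a * (N - P) \<le> Ham s \<phi> N"
    unfolding a_def using Ham_tangent[OF s \<phi>] M N by blast+
  then have "(1 - l) * (Ham s \<phi> P + a * (M - P)) + l * (Ham s \<phi> P + a * (N - P)) \<le> (1 - l) * Ham s \<phi> M + l * Ham s \<phi> N"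
    using l by (intro add_mono mult_left_mono) auto
  moreover have "(1 - l) * (Ham s \<phi> P + a * (M - P)) + l * (Ham s \<phi> P + a * (N - P)) = Ham s \<phi> P + a * ((1 - l) * M + l * N - P)"
    by (simp add: algebra_simps)
  ultimately show ?thesis by (simp add: P_def)
qed

text \<open>\<open>M / (1 - \<phi> * M)\<close> equals
  \<open>(1 / (1 - \<phi> * M) - 1) / \<phi>\<close>. The bound holds however negative
  \<open>M\<close> is, and this is what bounds \<open>q\<close> from above on all subjets.\<close>

lemma Ham_lower:
  assumes s: "s \<ge> 0" and \<phi>: "\<phi> > 0" and M: "\<phi> * M < 1"
  shows "- s / (2 * \<phi>) \<le> Ham s \<phi> M"
proof -
  have "- 1 / \<phi> \<le> M / (1 - \<phi> * M)" using \<phi> M by (simp add: field_simps)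
  then have "s / 2 * (- 1 / \<phi>) \<le> s / 2 * (M / (1 - \<phi> * M))" using s by (intro mult_left_mono) auto
  then show ?thesis by (simp add: Ham_def)
qed

lemma Ham_ratio_bound:
  fixes \<phi> M :: real
  assumes c: "0 < c" "c \<le> \<phi>" and d: "0 < d" "d \<le> 1" "d \<le> 1 - \<phi> * M"
  shows "\<bar>M / (1 - \<phi> * M)\<bar> \<le> 1 / (c * d)"
proof -
  define p where "p = 1 - \<phi> * M"
  have p: "p > 0" using d unfolding p_def by linarith
  have "M / p = (1 / p - 1) / \<phi>" using p c by (simp add: p_def field_simps)
  moreover have "\<bar>1 / p - 1\<bar> \<le> 1 / d"
  proof -
    have "1 / p \<le> 1 / d" using d p by (simp add: p_def frac_le)
    moreover have "1 \<le> 1 / d" using d by simp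
    moreover have "0 < 1 / p" using p by simp
    ultimately show ?thesis by linarith
  qed
  then have "\<bar>1 / p - 1\<bar> / \<phi> \<le> (1 / d) / c" using c d by (intro frac_le) auto
  moreover have "\<bar>(1 / p - 1) / \<phi>\<bar> = \<bar>1 / p - 1\<bar> / \<phi>" using c by simp
  ultimately have "\<bar>M / p\<bar> \<le> (1 / d) / c" by (simp only:)
  then show ?thesis by (simp add: p_def mult.commute)
qed

text \<open>The two ratios differ by their product times \<open>\<phi> - \<phi>'\<close>, and both
  are bounded independently of \<open>M\<close>, even as \<open>M\<close> tends to minus infinity.
  Hence coefficients can be frozen on subjets without a lower bound on \<open>M\<close>.\<close>

lemma Ham_diff:
  assumes c: "0 < c" "c \<le> \<phi>" "c \<le> \<phi>'" and d: "0 < d" "d \<le> 1" "d \<le> 1 - \<phi> * M" "d \<le> 1 - \<phi>' * M" and s: "0 \<le> s'" "s' \<le> S"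
  shows "\<bar>Ham s \<phi> M - Ham s' \<phi>' M\<bar> \<le> \<bar>s - s'\<bar> * (1 / (c * d)) + S * (1 / (c * d))\<^sup>2 * \<bar>\<phi> - \<phi>'\<bar>"
proof -
  define r where "r = M / (1 - \<phi> * M)"
  define r' where "r' = M / (1 - \<phi>' * M)"
  define B where "B = 1 / (c * d)"
  have B: "\<bar>r\<bar> \<le> B" "\<bar>r'\<bar> \<le> B" "B \<ge> 0"
    using Ham_ratio_bound[OF c(1,2) d(1,2,3)] Ham_ratio_bound[OF c(1,3) d(1,2,4)] c d by (simp_all add: r_def r'_def B_def)
  have rr: "r - r' = r * r' * (\<phi> - \<phi>')" using d by (simp add: r_def r'_def field_simps)
  have "Ham s \<phi> M - Ham s' \<phi>' M = ((s - s') * r + s' * (r - r')) / 2"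
    by (simp add: Ham_def r_def r'_def algebra_simps diff_divide_distrib)
  also have "\<bar>\<dots>\<bar> \<le> \<bar>s - s'\<bar> * \<bar>r\<bar> + s' * \<bar>r - r'\<bar>"
  proof -
    have "\<bar>(s - s') * r + s' * (r - r')\<bar> \<le> \<bar>s - s'\<bar> * \<bar>r\<bar> + s' * \<bar>r - r'\<bar>"
      using abs_triangle_ineq[of "(s - s') * r" "s' * (r - r')"] s by (simp add: abs_mult)
    then show ?thesis by simp
  qed
  also have "\<dots> \<le> \<bar>s - s'\<bar> * B + S * (B * B * \<bar>\<phi> - \<phi>'\<bar>)"
    unfolding rr abs_mult using B s by (intro add_mono mult_mono) auto
  finally show ?thesis by (simp add: B_def power2_eq_square mult.assoc)
qed

text \<open>Every \<open>a \<ge> 0\<close> is admissible in the linearised inequality: letting \<open>a\<close> tend to infinity gives the bound on the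
  second derivative, and the slope of \<open>Ham\<close> at the mollified second derivative gives the equation.
  Outside \<open>\<bar>x - x0\<bar> \<le> r\<close> the global bounds on \<open>q\<close> and \<open>M\<close> are compensated by \<open>A (x - x0)\<^sup>2\<close>.\<close>

lemma mollified_supersolution:
  fixes f \<sigma> \<gamma> \<kappa> :: "real \<Rightarrow> real"
  assumes lsc: "lsc_on ({0..<T} \<times> UNIV) V"
    and growth: "\<And>t x. 0 \<le> t \<Longrightarrow> t < T \<Longrightarrow> \<bar>V (t, x)\<bar> \<le> Cg * (1 + \<bar>x\<bar>)"
    and cont: "\<And>t. 0 \<le> t \<Longrightarrow> t < T \<Longrightarrow> continuous_on UNIV (\<lambda>x. V (t, x))"
    and sc: "\<And>t x y. 0 \<le> t \<Longrightarrow> t < T \<Longrightarrow> V (t, x + y) + V (t, x - y) \<le> 2 * V (t, x) + G * y\<^sup>2"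
    and k: "admissible_shaking \<kappa> \<kappa>' \<epsilon>0" and \<epsilon>: "0 \<le> \<epsilon>" "\<epsilon> \<le> \<epsilon>0"
    and cts: "continuous_on UNIV f" "continuous_on UNIV \<sigma>" "continuous_on UNIV \<gamma>"
    and f: "0 < cf" "\<And>x. cf \<le> f x" and \<sigma>: "\<And>x. (\<sigma> x)\<^sup>2 \<le> Bs"
    and \<iota>: "0 < \<iota>" and \<gamma>: "\<And>x. \<iota> \<le> \<gamma> x" "\<And>x. \<gamma> x \<le> 1 / f x - \<iota>" "\<And>x. \<gamma> x \<le> G"
    and qb: "\<And>t x q M. subjet T V t x q M \<Longrightarrow> q \<le> C0" and C0: "C0 \<ge> 0"
    and jet: "\<And>t x q M x'. subjet T V t x q M \<Longrightarrow> x' \<in> Dset \<kappa> \<epsilon> x \<Longrightarrow> M \<le> \<gamma> x' \<and> Ham ((\<sigma> x')\<^sup>2) (f x') M \<le> - q"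
    and \<omega>: "0 < \<omega>" "\<omega> \<le> \<iota> / 2"
  shows "\<exists>h0>0. \<forall>h \<rho> \<rho>1 \<rho>2 \<rho>3 \<rho>4 t0 x0 x0'. h < h0 \<longrightarrow> kernel4 h \<rho> \<rho>1 \<rho>2 \<rho>3 \<rho>4 \<longrightarrow> 0 \<le> t0 \<longrightarrow> t0 + 2 * h < T \<longrightarrow> \<bar>x0\<bar> \<le> R \<longrightarrow> x0' \<in> Dset \<kappa> \<epsilon> x0 \<longrightarrow>
     conv2 h (time_cut T V) \<rho> \<rho>2 (t0, x0) \<le> \<gamma> x0' + \<omega> \<and>
     Ham ((\<sigma> x0')\<^sup>2) (f x0') (conv2 h (time_cut T V) \<rho> \<rho>2 (t0, x0)) - \<omega> \<le> conv2 h (time_cut T V) \<rho>1 \<rho> (t0, x0)"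
proof -
  have G: "G \<ge> 0" using \<gamma>(1,3)[of 0] \<iota> by linarith
  have Bs: "Bs \<ge> 0" using \<sigma>[of 0] zero_le_power2 order_trans by blast
  have fi: "f x * \<iota> \<le> 1 / 2" for x
  proof -
    have "\<iota> \<le> 1 / f x - \<iota>" using \<gamma>(1,2)[of x] by linarith
    then show ?thesis using f(1) f(2)[of x] by (simp add: field_simps)
  qed
  have cfi: "cf * \<iota> \<le> 1 / 2" using fi[of 0] mult_right_mono[OF f(2)[of 0], of \<iota>] \<iota> by linarith
  have gap: "cf * e \<le> 1 - f x * M" if "M \<le> 1 / f x - e" "e \<ge> 0" for x M e
  proof -
    have fx: "f x > 0" using f(1) f(2)[of x] by linarith
    then have "f x * M \<le> f x * (1 / f x - e)" using that by (intro mult_left_mono) auto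
    also have "\<dots> = 1 - f x * e" using fx by (simp add: algebra_simps)
    finally show ?thesis using mult_right_mono[OF f(2)[of x] that(2)] by linarith
  qed
  \<comment> \<open>The constraint \<open>M \<le> 1 / f x - \<iota>\<close> keeps
    \<open>1 - f x * M\<close> above \<open>2 * d0\<close>. One half pays for replacing
    \<open>f x'\<close> by \<open>f x0'\<close> and, in another place, for relaxing the constraint
    by \<open>\<omega> \<le> \<iota> / 2\<close>.\<close>
  define d0 where "d0 = cf * \<iota> / 2"
  have d0: "0 < d0" "d0 \<le> 1" using f \<iota> cfi by (auto simp: d0_def)
  define B where "B = 1 / (cf * d0)"
  have B: "B > 0" using f d0 by (simp add: B_def)
  obtain R' where R': "\<And>x x'. \<bar>x\<bar> \<le> R \<Longrightarrow> x' \<in> Dset \<kappa> \<epsilon> x \<Longrightarrow> \<bar>x'\<bar> \<le> R'"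
    using Dset_bounded[OF k \<epsilon>, of R] by blast
  define Q where "Q = cball (0::real) (\<bar>R'\<bar> + 1)"
  have uc: "\<exists>d>0. \<forall>x\<in>Q. \<forall>y\<in>Q. \<bar>y - x\<bar> < d \<longrightarrow> \<bar>p y - p x\<bar> < e" if "continuous_on UNIV p" "e > 0" for p :: "real \<Rightarrow> real" and e
  proof -
    have "uniformly_continuous_on Q p" unfolding Q_def
      using that(1) by (intro compact_uniformly_continuous) (auto intro: continuous_on_subset)
    then show ?thesis using that(2) unfolding uniformly_continuous_on_def dist_real_def by blast
  qed
  obtain d1 where d1: "d1 > 0" "\<And>x y. x \<in> Q \<Longrightarrow> y \<in> Q \<Longrightarrow> \<bar>y - x\<bar> < d1 \<Longrightarrow> \<bar>\<gamma> y - \<gamma> x\<bar> < \<omega> / 2"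
    using uc[OF cts(3), of "\<omega> / 2"] \<omega> by auto
  define e2 where "e2 = \<omega> / (4 * B)"
  have e2: "e2 > 0" "e2 * B = \<omega> / 4" using \<omega> B by (auto simp: e2_def)
  have "continuous_on UNIV (\<lambda>x. (\<sigma> x)\<^sup>2)" using cts(2) by (intro continuous_intros)
  then obtain d2 where d2: "d2 > 0" "\<And>x y. x \<in> Q \<Longrightarrow> y \<in> Q \<Longrightarrow> \<bar>y - x\<bar> < d2 \<Longrightarrow> \<bar>(\<sigma> y)\<^sup>2 - (\<sigma> x)\<^sup>2\<bar> < e2"
    using uc[of "\<lambda>x. (\<sigma> x)\<^sup>2" e2] e2 by auto
  define E where "E = (Bs + 1) * B\<^sup>2"
  have E: "E > 0" "Bs * B\<^sup>2 \<le> E" using Bs B by (simp_all add: E_def)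
  \<comment> \<open>The first bound keeps \<open>1 - f0 * M\<close> away from 0 after the change of
    coefficient; the second limits the resulting change of the Hamiltonian to
    \<open>\<omega> / 4\<close>, the other quarter being spent on \<open>\<sigma>\<close>.\<close>
  define e3 where "e3 = min (cf * cf * \<iota> / 2) (\<omega> / (4 * E))"
  have e3: "e3 > 0" "e3 \<le> cf * cf * \<iota> / 2" "Bs * B\<^sup>2 * e3 \<le> \<omega> / 4"
  proof -
    show "e3 > 0" using f(1) \<iota> \<omega> E by (simp add: e3_def)
    show "e3 \<le> cf * cf * \<iota> / 2" unfolding e3_def by (rule min.cobounded1)
    have "Bs * B\<^sup>2 * e3 \<le> E * (\<omega> / (4 * E))"
      using E \<open>e3 > 0\<close> by (intro mult_mono) (auto simp: e3_def)
    then show "Bs * B\<^sup>2 * e3 \<le> \<omega> / 4" using E by simp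
  qed
  obtain d3 where d3: "d3 > 0" "\<And>x y. x \<in> Q \<Longrightarrow> y \<in> Q \<Longrightarrow> \<bar>y - x\<bar> < d3 \<Longrightarrow> \<bar>f y - f x\<bar> < e3"
    using uc[OF cts(1) e3(1)] by blast
  define d where "d = min (min d1 d2) (min d3 1) / 2"
  have d: "d > 0" "d < d1" "d < d2" "d < d3" "d < 1" using d1 d2 d3 by (auto simp: d_def min_def)
  obtain r where r: "r > 0" "\<And>x0 x x0'. \<bar>x0\<bar> \<le> R \<Longrightarrow> x0' \<in> Dset \<kappa> \<epsilon> x0 \<Longrightarrow> \<bar>x - x0\<bar> \<le> r \<Longrightarrow> \<exists>x'\<in>Dset \<kappa> \<epsilon> x. \<bar>x' - x0'\<bar> \<le> d"
    using Dset_perturb[OF k \<epsilon> d(1), of R] by blast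
  define am where "am = Bs / (2 * d0\<^sup>2)"
  have am: "am \<ge> 0" using Bs by (simp add: am_def)
  \<comment> \<open>A common bound for two penalties: \<open>(C0 + am * G) / r\<^sup>2\<close> in
    the equation, and \<open>G / r\<^sup>2\<close> per unit of \<open>a\<close> in the constraint.
    \<open>h0\<close> then limits their averaged cost to \<open>\<omega> / 2\<close>, per unit of
    \<open>a\<close> in the second case.\<close>
  define Am where "Am = (C0 + am * G) / r\<^sup>2 + G / r\<^sup>2"
  have Am: "Am \<ge> 0" using C0 am G by (simp add: Am_def)
  define h0 where "h0 = min 1 (\<omega> / (2 * (Am + 1)))"
  have h0: "h0 > 0" using \<omega> Am by (simp add: h0_def)
  have xin: "x \<in> Dset \<kappa> \<epsilon> x" for x using \<epsilon> by (simp add: Dset_def)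
  have key: "conv2 h (time_cut T V) \<rho> \<rho>2 (t0, x0) \<le> \<gamma> x0' + \<omega> \<and>
     Ham ((\<sigma> x0')\<^sup>2) (f x0') (conv2 h (time_cut T V) \<rho> \<rho>2 (t0, x0)) - \<omega> \<le> conv2 h (time_cut T V) \<rho>1 \<rho> (t0, x0)"
    if h: "h < h0" and ker: "kernel4 h \<rho> \<rho>1 \<rho>2 \<rho>3 \<rho>4" and t0: "0 \<le> t0" "t0 + 2 * h < T" and x0: "\<bar>x0\<bar> \<le> R" "x0' \<in> Dset \<kappa> \<epsilon> x0"
    for h \<rho> \<rho>1 \<rho>2 \<rho>3 \<rho>4 t0 x0 x0'
  proof -
    have hp: "h > 0" using ker by (simp add: kernel4_def)
    have Amh: "Am * h\<^sup>2 \<le> \<omega> / 2"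
    proof -
      have "h * h \<le> 1 * h0" using h hp by (intro mult_mono) (auto simp: h0_def)
      then have "h\<^sup>2 \<le> \<omega> / (2 * (Am + 1))" by (simp add: h0_def power2_eq_square)
      then have le: "Am * h\<^sup>2 \<le> (Am + 1) * (\<omega> / (2 * (Am + 1)))" using Am by (intro mult_mono) auto
      have "Am + 1 \<noteq> 0" using Am by simp
      then have "(Am + 1) * (\<omega> / (2 * (Am + 1))) = \<omega> / 2" by (metis mult.commute nonzero_mult_divide_mult_cancel_left times_divide_eq_right)
      then show ?thesis using le by linarith
    qed
    have far: "r\<^sup>2 \<le> (x - x0)\<^sup>2" if "\<not> \<bar>x - x0\<bar> \<le> r" for x
      using that r(1) by (metis abs_ge_zero less_eq_real_def linorder_not_le power2_abs power_mono)
    define M0 where "M0 = conv2 h (time_cut T V) \<rho> \<rho>2 (t0, x0)"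
    define Q0 where "Q0 = conv2 h (time_cut T V) \<rho>1 \<rho> (t0, x0)"
    define s0 where "s0 = (\<sigma> x0')\<^sup>2"
    define f0 where "f0 = f x0'"
    have f0: "cf \<le> f0" "f0 > 0" using f(1) f(2)[of x0'] unfolding f0_def by linarith+
    have s0: "0 \<le> s0" "s0 \<le> Bs" using \<sigma> by (auto simp: s0_def)
    have lin: "c - A * h\<^sup>2 \<le> Q0 - a * M0"
      if "a \<ge> 0" "A \<ge> 0" "\<And>t x q M. subjet T V t x q M \<Longrightarrow> c - A * (x - x0)\<^sup>2 \<le> - q - a * M" for a A c
      unfolding M0_def Q0_def
      by (rule mollify_linear_supersolution[OF lsc growth cont sc G ker t0 that])
    have near: "\<exists>x'\<in>Dset \<kappa> \<epsilon> x. \<bar>\<gamma> x' - \<gamma> x0'\<bar> < \<omega> / 2 \<and>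
        (\<forall>M. M \<le> \<gamma> x' \<longrightarrow> f0 * M < 1 \<and> Ham s0 f0 M - \<omega> / 2 \<le> Ham ((\<sigma> x')\<^sup>2) (f x') M)" if x: "\<bar>x - x0\<bar> \<le> r" for x
    proof -
      obtain x' where x': "x' \<in> Dset \<kappa> \<epsilon> x" "\<bar>x' - x0'\<bar> \<le> d" using r(2)[OF x0 x] by blast
      have Q: "x0' \<in> Q" "x' \<in> Q" using R'[OF x0] x'(2) d by (auto simp: Q_def dist_real_def)
      have df: "\<bar>f x' - f0\<bar> < e3" using d3(2)[OF Q] x'(2) d by (simp add: f0_def)
      have ds: "\<bar>(\<sigma> x')\<^sup>2 - s0\<bar> < e2" using d2(2)[OF Q] x'(2) d by (simp add: s0_def)
      have "f0 * M < 1 \<and> Ham s0 f0 M - \<omega> / 2 \<le> Ham ((\<sigma> x')\<^sup>2) (f x') M" if M: "M \<le> \<gamma> x'" for M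
      proof -
        have g1: "cf * \<iota> \<le> 1 - f x' * M" using gap[of M x' \<iota>] M \<gamma>(2)[of x'] \<iota> by linarith
        have g2: "d0 \<le> 1 - f0 * M"
        \<comment> \<open>A negative \<open>M\<close> may be arbitrarily large in modulus but then
          \<open>1 - f0 * M \<ge> 1\<close>; a positive one is at most \<open>1 / cf\<close>, which
          limits the effect of changing \<open>f\<close>.\<close>
        proof (cases "M \<le> 0")
          case True
          then have "f0 * M \<le> 0" using f0 by (simp add: mult_nonneg_nonpos)
          then show ?thesis using d0 by linarith
        next
          case False
          have "f x' \<ge> cf" by (rule f(2))
          have "1 / f x' \<le> 1 / cf" using f(1) f(2)[of x'] by (simp add: frac_le)
          then have "M \<le> 1 / cf" using M \<gamma>(2)[of x'] \<iota> by linarith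
          then have "\<bar>f x' - f0\<bar> * M \<le> (cf * cf * \<iota> / 2) * (1 / cf)"
            using df e3 False f(1) \<iota> by (intro mult_mono) auto
          also have "\<dots> = d0" using f(1) by (simp add: d0_def)
          finally have "\<bar>f x' - f0\<bar> * M \<le> d0" .
          moreover have "(f x' - f0) * M \<ge> - (\<bar>f x' - f0\<bar> * M)" using False by (metis abs_ge_minus_self abs_mult abs_of_pos linorder_not_le minus_le_iff)
          ultimately have "f0 * M \<le> f x' * M + d0" by (simp add: left_diff_distrib)
          then show ?thesis using g1 by (simp add: d0_def)
        qed
        have g1': "d0 \<le> 1 - f x' * M" using g1 d0(1) unfolding d0_def by linarith
        have "\<bar>Ham ((\<sigma> x')\<^sup>2) (f x') M - Ham s0 f0 M\<bar> \<le> \<bar>(\<sigma> x')\<^sup>2 - s0\<bar> * B + Bs * B\<^sup>2 * \<bar>f x' - f0\<bar>"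
          unfolding B_def by (rule Ham_diff[OF f(1) f(2) f0(1) d0 g1' g2 s0])
        also have "\<dots> \<le> e2 * B + Bs * B\<^sup>2 * e3"
          using ds df B Bs by (intro add_mono mult_right_mono mult_left_mono) auto
        also have "\<dots> \<le> \<omega> / 2" using e2 e3 by linarith
        finally show ?thesis using g2 d0 by linarith
      qed
      moreover have "\<bar>\<gamma> x' - \<gamma> x0'\<bar> < \<omega> / 2" using d1(2)[OF Q] x'(2) d by simp
      ultimately show ?thesis using x'(1) by blast
    qed
    have MG: "M \<le> G" if "subjet T V t x q M" for t x q M using jet[OF that xin] \<gamma>(3)[of x] by linarith
    have M0: "M0 \<le> \<gamma> x0' + \<omega>"
    proof (rule ccontr)
      assume neg: "\<not> M0 \<le> \<gamma> x0' + \<omega>"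
      define gm where "gm = M0 - (\<gamma> x0' + \<omega>)"
      have gm: "gm > 0" using neg by (simp add: gm_def)
      \<comment> \<open>Chosen so that \<open>a * gm\<close> exceeds \<open>C0 + Q0\<close>, whereas
        the linear inequality with this \<open>a\<close> gives
        \<open>a * gm \<le> C0 + Q0\<close>.\<close>
      define a where "a = (C0 + \<bar>Q0\<bar> + 1) / gm"
      have a: "a \<ge> 0" "a * gm = C0 + \<bar>Q0\<bar> + 1" using gm C0 by (auto simp: a_def)
      define A where "A = a * (G / r\<^sup>2)"
      have A: "A \<ge> 0" using a G by (simp add: A_def)
      have "(- C0 - a * (\<gamma> x0' + \<omega> / 2)) - A * h\<^sup>2 \<le> Q0 - a * M0"
      proof (rule lin[OF a(1) A])
        fix t x q M assume j: "subjet T V t x q M"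
        show "- C0 - a * (\<gamma> x0' + \<omega> / 2) - A * (x - x0)\<^sup>2 \<le> - q - a * M"
        proof (cases "\<bar>x - x0\<bar> \<le> r")
          case True
          obtain x' where x': "x' \<in> Dset \<kappa> \<epsilon> x" "\<bar>\<gamma> x' - \<gamma> x0'\<bar> < \<omega> / 2" using near[OF True] by blast
          have "M \<le> \<gamma> x0' + \<omega> / 2" using jet[OF j x'(1)] x'(2) by linarith
          then have "a * M \<le> a * (\<gamma> x0' + \<omega> / 2)" using a(1) by (rule mult_left_mono)
          moreover have "A * (x - x0)\<^sup>2 \<ge> 0" using A by simp
          ultimately show ?thesis using qb[OF j] by linarith
        next
          case False
          have "A * (x - x0)\<^sup>2 \<ge> A * r\<^sup>2" using far[OF False] A by (rule mult_left_mono)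
          moreover have "A * r\<^sup>2 = a * G" using r(1) by (simp add: A_def)
          moreover have "a * M \<le> a * G" using MG[OF j] a(1) by (rule mult_left_mono)
          moreover have "a * (\<gamma> x0' + \<omega> / 2) \<ge> 0" using a(1) \<gamma>(1)[of x0'] \<iota> \<omega> by simp
          ultimately show ?thesis using qb[OF j] by linarith
        qed
      qed
      moreover have "A * h\<^sup>2 \<le> a * (\<omega> / 2)"
      proof -
        have "G / r\<^sup>2 \<le> Am" using C0 am G by (simp add: Am_def)
        then have "G / r\<^sup>2 * h\<^sup>2 \<le> Am * h\<^sup>2" by (intro mult_right_mono) auto
        then have "G / r\<^sup>2 * h\<^sup>2 \<le> \<omega> / 2" using Amh by linarith
        then have "a * (G / r\<^sup>2 * h\<^sup>2) \<le> a * (\<omega> / 2)" using a(1) by (rule mult_left_mono)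
        then show ?thesis by (simp add: A_def mult.assoc)
      qed
      moreover have "a * M0 - a * (\<gamma> x0' + \<omega> / 2) - a * (\<omega> / 2) = a * gm" by (simp add: gm_def algebra_simps)
      ultimately have "a * gm \<le> C0 + Q0" by linarith
      then show False using a(2) by linarith
    qed
    have p0: "d0 \<le> 1 - f0 * M0"
      using gap[of M0 x0' "\<iota> / 2"] M0 \<gamma>(2)[of x0'] \<omega> \<iota> by (simp add: d0_def f0_def)
    \<comment> \<open>The slope of the tangent at the mollified value \<open>M0\<close> itself:
      tangent and graph agree there, so the linear inequality turns back into the nonlinear
      one.\<close>
    define a where "a = s0 / (2 * (1 - f0 * M0)\<^sup>2)"
    have a: "0 \<le> a" "a \<le> am"
    proof -
      show "0 \<le> a" using s0 by (simp add: a_def)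
      have "d0\<^sup>2 \<le> (1 - f0 * M0)\<^sup>2" using p0 d0 by (intro power_mono) auto
      then show "a \<le> am" unfolding a_def am_def using s0 d0 by (intro frac_le) auto
    qed
    have fM: "f0 * M0 < 1" using p0 d0 by linarith
    define c where "c = Ham s0 f0 M0 - a * M0 - \<omega> / 2"
    \<comment> \<open>Comparing the tangent with the graph at 0 gives \<open>c \<le> 0\<close>. In
      the far region the penalty covers just \<open>C0 + am * G\<close>, so a positive
      \<open>c\<close> could not be afforded.\<close>
    have "Ham s0 f0 M0 + a * (0 - M0) \<le> Ham s0 f0 0" unfolding a_def by (rule Ham_tangent[OF s0(1) f0(2) fM]) simp
    moreover have "Ham s0 f0 0 = 0" by (simp add: Ham_def)
    ultimately have c: "c \<le> 0" using \<omega>(1) unfolding c_def by simp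
    define A where "A = (C0 + am * G) / r\<^sup>2"
    have A: "A \<ge> 0" "A \<le> Am" using C0 am G by (auto simp: A_def Am_def)
    have "c - A * h\<^sup>2 \<le> Q0 - a * M0"
    proof (rule lin[OF a(1) A(1)])
      fix t x q M assume j: "subjet T V t x q M"
      show "c - A * (x - x0)\<^sup>2 \<le> - q - a * M"
      proof (cases "\<bar>x - x0\<bar> \<le> r")
        case True
        obtain x' where x': "x' \<in> Dset \<kappa> \<epsilon> x"
          "\<And>M. M \<le> \<gamma> x' \<Longrightarrow> f0 * M < 1 \<and> Ham s0 f0 M - \<omega> / 2 \<le> Ham ((\<sigma> x')\<^sup>2) (f x') M" using near[OF True] by blast
        have j': "M \<le> \<gamma> x'" "Ham ((\<sigma> x')\<^sup>2) (f x') M \<le> - q" using jet[OF j x'(1)] by auto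
        have "Ham s0 f0 M0 + a * (M - M0) \<le> Ham s0 f0 M"
          unfolding a_def using x'(2)[OF j'(1)] by (intro Ham_tangent[OF s0(1) f0(2) fM]) auto
        moreover have "Ham s0 f0 M - \<omega> / 2 \<le> - q" using x'(2)[OF j'(1)] j'(2) by linarith
        moreover have "A * (x - x0)\<^sup>2 \<ge> 0" using A by simp
        ultimately show ?thesis by (simp add: c_def right_diff_distrib)
      next
        case False
        have "A * (x - x0)\<^sup>2 \<ge> A * r\<^sup>2" using far[OF False] A(1) by (rule mult_left_mono)
        moreover have "A * r\<^sup>2 = C0 + am * G" using r(1) by (simp add: A_def)
        moreover have "a * M \<le> a * G" using MG[OF j] a(1) by (rule mult_left_mono)
        moreover have "a * G \<le> am * G" using a(2) G by (rule mult_right_mono)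
        ultimately show ?thesis using qb[OF j] c by linarith
      qed
    qed
    moreover have "A * h\<^sup>2 \<le> \<omega> / 2" using mult_right_mono[OF A(2), of "h\<^sup>2"] Amh by simp
    ultimately have "Ham s0 f0 M0 - \<omega> \<le> Q0" by (simp add: c_def)
    then show ?thesis using M0 by (simp add: M0_def Q0_def s0_def f0_def)
  qed
  then show ?thesis using h0 by blast
qed



section \<open>The comparison argument\<close>

lemma visc_sub_superjet:
  assumes "visc_sub f \<sigma> \<gamma> \<kappa> \<epsilon> T U" "subjet T (\<lambda>z. - U z) t x q M"
  shows "Fop f \<sigma> \<gamma> \<kappa> \<epsilon> t x (- q) (- M) \<le> 0"
proof -
  obtain \<phi> \<phi>t \<phi>x \<phi>xx r where t: "0 \<le> t" "t < T" and \<phi>: "C12_test \<phi> \<phi>t \<phi>x \<phi>xx" "\<phi>t (t, x) = q" "\<phi>xx (t, x) = M"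
    and r: "r > 0" "\<And>s y. 0 \<le> s \<Longrightarrow> s < T \<Longrightarrow> dist (s, y) (t, x) < r \<Longrightarrow> - U (s, y) - \<phi> (s, y) \<ge> - U (t, x) - \<phi> (t, x)"
    using assms(2) unfolding subjet_def by auto
  have C: "C12_test (\<lambda>z. - \<phi> z) (\<lambda>z. - \<phi>t z) (\<lambda>z. - \<phi>x z) (\<lambda>z. - \<phi>xx z)"
    using \<phi>(1) unfolding C12_test_def by (auto intro!: continuous_intros derivative_intros)
  have "\<forall>s y. 0 \<le> s \<and> s < T \<and> dist (s, y) (t, x) < r \<longrightarrow> U (s, y) - - \<phi> (s, y) \<le> U (t, x) - - \<phi> (t, x)"
    using r(2) by fastforce
  then have "Fop f \<sigma> \<gamma> \<kappa> \<epsilon> t x (- \<phi>t (t, x)) (- \<phi>xx (t, x)) \<le> 0"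
    using assms(1)[unfolded visc_sub_def, rule_format, of "\<lambda>z. - \<phi> z" "\<lambda>z. - \<phi>t z" "\<lambda>z. - \<phi>x z" "\<lambda>z. - \<phi>xx z" t x] C t r(1) by blast
  then show ?thesis using \<phi> by simp
qed

lemma visc_super_jet_inequalities:
  assumes "visc_super f \<sigma> \<gamma> \<kappa> \<epsilon> T V" "subjet T V t x q M" "x' \<in> Dset \<kappa> \<epsilon> x"
  shows "M \<le> \<gamma> x' \<and> Ham ((\<sigma> x')\<^sup>2) (f x') M \<le> - q"
proof -
  have "0 \<le> ereal (min (- q - (\<sigma> x')\<^sup>2 * M / (2 * (1 - f x' * M))) (\<gamma> x' - M))"
    using visc_super_subjet[OF assms(1,2)] INF_lower[OF assms(3)] order_trans unfolding Fop_def by blast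
  then show ?thesis by (simp add: Ham_def zero_ereal_def)
qed

lemma usc_on_uminus: "usc_on S U \<Longrightarrow> lsc_on S (\<lambda>z. - U z)"
  unfolding usc_on_def lsc_on_def by (metis add.inverse_inverse diff_conv_add_uminus minus_add_distrib neg_less_iff_less)

text \<open>The mollification near \<open>T\<close> samples a whole neighbourhood, and
  \<open>V\<close> is only lower semicontinuous, so \<open>U\<close> is compared with a lower bound
  \<open>m\<close> of \<open>V\<close> on that neighbourhood. Compactness of
  \<open>\<bar>x\<bar> \<le> R\<close> makes the width \<open>\<eta>\<close> uniform.\<close>

lemma terminal_layer:
  fixes U V \<psi> :: "real \<times> real \<Rightarrow> real"
  assumes T: "T > 0" and U: "usc_on ({0..T} \<times> UNIV) U" and V: "lsc_on ({0..T} \<times> UNIV) V" and \<psi>: "continuous_on UNIV \<psi>"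
    and l: "0 \<le> l" "l \<le> 1" and le: "\<And>x. U (T, x) \<le> (1 - l) * V (T, x) + l * \<psi> (T, x)" and \<mu>: "\<mu> > 0"
  shows "\<exists>\<eta>>0. \<forall>t x. \<bar>x\<bar> \<le> R \<longrightarrow> 0 \<le> t \<longrightarrow> t \<le> T \<longrightarrow> T - \<eta> \<le> t \<longrightarrow>
     (\<exists>m. (\<forall>s y. 0 \<le> s \<longrightarrow> s \<le> T \<longrightarrow> T - \<eta> \<le> s \<longrightarrow> \<bar>y - x\<bar> \<le> \<eta> \<longrightarrow> m \<le> V (s, y)) \<and> U (t, x) \<le> (1 - l) * m + l * \<psi> (t, x) + \<mu>)"
proof -
  let ?S = "{0..T} \<times> (UNIV :: real set)"
  have "\<exists>d>0. \<forall>w\<in>?S. dist w (T, z) < d \<longrightarrow> U w < U (T, z) + \<mu> / 4 \<and> V (T, z) - \<mu> / 4 < V w \<and> \<psi> (T, z) - \<mu> / 4 < \<psi> w" for z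
  proof -
    have Tz: "(T, z) \<in> ?S" using T by simp
    have m4: "\<mu> / 4 > 0" using \<mu> by simp
    obtain d1 where d1: "d1 > 0" "\<forall>w\<in>?S. dist w (T, z) < d1 \<longrightarrow> U w < U (T, z) + \<mu> / 4"
      using U Tz m4 unfolding usc_on_def by blast
    obtain d2 where d2: "d2 > 0" "\<forall>w\<in>?S. dist w (T, z) < d2 \<longrightarrow> V (T, z) - \<mu> / 4 < V w"
      using lsc_onD[OF V Tz m4] by blast
    obtain d3 where d3: "d3 > 0" "\<forall>w. dist w (T, z) < d3 \<longrightarrow> dist (\<psi> w) (\<psi> (T, z)) < \<mu> / 4"
      using \<psi> m4 unfolding continuous_on_iff by blast
    show ?thesis
    proof (intro exI[of _ "min d1 (min d2 d3)"] conjI ballI impI)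
      fix w assume w: "w \<in> ?S" "dist w (T, z) < min d1 (min d2 d3)"
      then show "U w < U (T, z) + \<mu> / 4" "V (T, z) - \<mu> / 4 < V w" using d1 d2 by auto
      have "dist (\<psi> w) (\<psi> (T, z)) < \<mu> / 4" using d3 w by auto
      then show "\<psi> (T, z) - \<mu> / 4 < \<psi> w" unfolding dist_real_def by linarith
    qed (use d1 d2 d3 in auto)
  qed
  then obtain d where d: "\<And>z. d z > 0" "\<And>z w. w \<in> ?S \<Longrightarrow> dist w (T, z) < d z \<Longrightarrow>
     U w < U (T, z) + \<mu> / 4 \<and> V (T, z) - \<mu> / 4 < V w \<and> \<psi> (T, z) - \<mu> / 4 < \<psi> w" by metis
  have "cball 0 R \<subseteq> (\<Union>z\<in>cball 0 R. ball z (d z / 2))" using d(1) by fastforce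
  then obtain F where F: "F \<subseteq> cball 0 R" "finite F" "cball 0 R \<subseteq> (\<Union>z\<in>F. ball z (d z / 2))"
    using compactE_image[OF compact_cball[of 0 R], of "cball 0 R" "\<lambda>z. ball z (d z / 2)"] by auto
  \<comment> \<open>With \<open>d z / 8\<close> the contributions \<open>\<eta>\<close> in time,
    \<open>\<eta>\<close> in space and \<open>d z / 2\<close> from the cover add up to less than
    \<open>d z\<close>.\<close>
  define \<eta> where "\<eta> = Min (insert 1 ((\<lambda>z. d z / 8) ` F))"
  have \<eta>: "\<eta> > 0" "\<And>z. z \<in> F \<Longrightarrow> \<eta> \<le> d z / 8"
  proof -
    show "\<eta> > 0" unfolding \<eta>_def using F(2) d(1) by simp
    show "\<eta> \<le> d z / 8" if "z \<in> F" for z unfolding \<eta>_def by (rule Min_le) (use F(2) that in auto)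
  qed
  show ?thesis
  proof (rule exI[of _ \<eta>], intro conjI allI impI)
    fix t x assume x: "\<bar>x\<bar> \<le> R" and t: "0 \<le> t" "t \<le> T" "T - \<eta> \<le> t"
    then have "x \<in> cball 0 R" by simp
    then obtain z where z: "z \<in> F" "\<bar>z - x\<bar> < d z / 2" using F(3) by (auto simp: dist_real_def)
    have near: "dist (s, y) (T, z) < d z" if "s \<le> T" "T - \<eta> \<le> s" "\<bar>y - x\<bar> \<le> \<eta>" for s y
    proof -
      have "dist (s, y) (T, z) \<le> \<bar>s - T\<bar> + \<bar>y - z\<bar>"
        unfolding dist_Pair_Pair dist_real_def using sqrt_sum_squares_le_sum_abs[of "s - T" "y - z"] by simp
      also have "\<dots> < d z" using that z \<eta>(2)[OF z(1)] d(1)[of z] by linarith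
      finally show ?thesis .
    qed
    define m where "m = V (T, z) - \<mu> / 4"
    have "m \<le> V (s, y)" if "0 \<le> s" "s \<le> T" "T - \<eta> \<le> s" "\<bar>y - x\<bar> \<le> \<eta>" for s y
      using d(2)[OF _ near[OF that(2,3,4)]] that by (simp add: m_def)
    moreover have "U (t, x) \<le> (1 - l) * m + l * \<psi> (t, x) + \<mu>"
    proof -
      have *: "U (t, x) < U (T, z) + \<mu> / 4" "\<psi> (T, z) - \<mu> / 4 < \<psi> (t, x)"
        using d(2)[OF _ near[of t x]] t \<eta>(1) by auto
      have "l * (\<psi> (T, z) - \<mu> / 4) \<le> l * \<psi> (t, x)" using * l by (intro mult_left_mono) auto
      moreover have "(1 - l) * m = (1 - l) * V (T, z) - \<mu> / 4 + l * (\<mu> / 4)" by (simp add: m_def field_simps)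
      moreover have "l * (\<psi> (T, z) - \<mu> / 4) = l * \<psi> (T, z) - l * (\<mu> / 4)" by (simp add: algebra_simps)
      ultimately show ?thesis using le[of z] * \<mu> by linarith
    qed
    ultimately show "\<exists>m. (\<forall>s y. 0 \<le> s \<longrightarrow> s \<le> T \<longrightarrow> T - \<eta> \<le> s \<longrightarrow> \<bar>y - x\<bar> \<le> \<eta> \<longrightarrow> m \<le> V (s, y)) \<and> U (t, x) \<le> (1 - l) * m + l * \<psi> (t, x) + \<mu>"
      by blast
  qed (use \<eta> in auto)
qed

theorem theorem2p2:
  fixes T K xK \<iota> \<epsilon>0 \<epsilon> :: real
    and f \<sigma> \<gamma> gK \<kappa> :: "real \<Rightarrow> real"
    and U V :: "real \<times> real \<Rightarrow> real"
  assumes T_pos: "T > 0"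
    and f_C2: "\<forall>x. f differentiable at x" "\<forall>x. deriv f differentiable at x"
              "continuous_on UNIV (deriv (deriv f))"
    and f_bdd: "\<exists>B. \<forall>x. \<bar>f x\<bar> \<le> B \<and> \<bar>deriv f x\<bar> \<le> B \<and> \<bar>deriv (deriv f) x\<bar> \<le> B"
    and f_inf: "\<exists>c>0. \<forall>x. c \<le> f x"
    and \<sigma>_bdd: "\<exists>B. \<forall>x. \<bar>\<sigma> x\<bar> \<le> B"
    and \<sigma>_lip: "\<exists>L. \<forall>x y. \<bar>\<sigma> x - \<sigma> y\<bar> \<le> L * \<bar>x - y\<bar>"
    and \<sigma>_inf: "\<exists>c>0. \<forall>x. c \<le> \<sigma> x"
    and \<gamma>_bdd: "\<exists>B. \<forall>x. \<bar>\<gamma> x\<bar> \<le> B"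
    and \<gamma>_cont: "continuous_on UNIV \<gamma>"
    and \<iota>_pos: "\<iota> > 0"
    and \<gamma>_bounds: "\<forall>x. \<iota> \<le> \<gamma> x \<and> \<gamma> x \<le> 1 / f x - \<iota>"
    and K_pos: "K > 0" and xK_ge: "xK \<ge> K"
    and gK_uc: "uniformly_continuous_on UNIV gK"
    and gK_aff_right: "\<exists>a b. \<forall>x. xK \<le> x \<longrightarrow> gK x = a * x + b"
    and gK_aff_left: "\<exists>a b. \<forall>x. x \<le> - xK \<longrightarrow> gK x = a * x + b"
    and \<epsilon>0_range: "0 < \<epsilon>0" "\<epsilon>0 < 1"
    and \<kappa>_smooth: "smooth_bounded_derivs \<kappa>"
    and \<kappa>_inf: "\<exists>c>0. \<forall>x. c \<le> \<kappa> x"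
    and \<kappa>_out: "\<forall>x. (x \<le> - xK \<or> xK \<le> x) \<longrightarrow> \<kappa> x = \<bar>gK x\<bar> + 1"
    and \<kappa>_deriv: "\<forall>x. - 1 / \<epsilon>0 < deriv \<kappa> x \<and> deriv \<kappa> x < 1 / \<epsilon>0"
    and \<epsilon>_range: "0 \<le> \<epsilon>" "\<epsilon> \<le> \<epsilon>0"
    and U_usc: "usc_on ({0..T} \<times> UNIV) U"
    and V_lsc: "lsc_on ({0..T} \<times> UNIV) V"
    and U_sub: "visc_sub f \<sigma> \<gamma> \<kappa> \<epsilon> T U"
    and V_super: "visc_super f \<sigma> \<gamma> \<kappa> \<epsilon> T V"
    and U_growth: "linear_growth T U"
    and V_growth: "linear_growth T V"
    and terminal: "\<forall>x. U (T, x) \<le> V (T, x)"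
  shows "\<forall>t x. 0 \<le> t \<and> t \<le> T \<longrightarrow> U (t, x) \<le> V (t, x)"
proof (rule ccontr)
  assume "\<not> ?thesis"
  then obtain ts xs where ts: "0 \<le> ts" "ts \<le> T" and gt: "V (ts, xs) < U (ts, xs)" by (auto simp: not_le)
  have tsT: "ts < T" using ts gt terminal by (cases "ts = T") (auto simp: not_less[symmetric])
  define gap where "gap = U (ts, xs) - V (ts, xs)"
  have gap: "gap > 0" using gt by (simp add: gap_def)
  obtain cf where cf: "0 < cf" "\<And>x. cf \<le> f x" using f_inf by blast
  have fpos: "f x > 0" for x using cf(1) cf(2)[of x] by linarith
  obtain Bsg where Bsg: "\<And>x. \<bar>\<sigma> x\<bar> \<le> Bsg" using \<sigma>_bdd by blast
  define Bs where "Bs = Bsg\<^sup>2"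
  have Bs: "(\<sigma> x)\<^sup>2 \<le> Bs" for x using Bsg[of x] by (metis Bs_def abs_ge_zero power2_abs power_mono)
  have Bs0: "Bs \<ge> 0" by (simp add: Bs_def)
  obtain Cu where Cu: "\<And>t x. 0 \<le> t \<Longrightarrow> t \<le> T \<Longrightarrow> \<bar>U (t, x)\<bar> \<le> Cu * (1 + \<bar>x\<bar>)"
    using U_growth unfolding linear_growth_def by blast
  obtain Cv where Cv: "\<And>t x. 0 \<le> t \<Longrightarrow> t \<le> T \<Longrightarrow> \<bar>V (t, x)\<bar> \<le> Cv * (1 + \<bar>x\<bar>)"
    using V_growth unfolding linear_growth_def by blast
  have Cuv: "Cu \<ge> 0" "Cv \<ge> 0" using Cu[of 0 0] Cv[of 0 0] T_pos by simp_all
  have k: "admissible_shaking \<kappa> (deriv \<kappa>) \<epsilon>0"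
    by (rule admissible_shakingI[OF \<epsilon>0_range(1) \<kappa>_smooth \<kappa>_inf gK_aff_right gK_aff_left \<kappa>_out \<kappa>_deriv])
  have cts: "continuous_on UNIV f" "continuous_on UNIV \<sigma>"
  proof -
    show "continuous_on UNIV f" using f_C2(1)
      by (simp add: continuous_on_eq_continuous_at differentiable_imp_continuous_within)
    obtain L where L: "\<And>x y. \<bar>\<sigma> x - \<sigma> y\<bar> \<le> L * \<bar>x - y\<bar>" using \<sigma>_lip by blast
    have "L \<ge> 0" using L[of 0 1] by simp
    then have "L-lipschitz_on UNIV \<sigma>" using L by (intro lipschitz_onI) (simp_all add: dist_real_def)
    then show "continuous_on UNIV \<sigma>" by (rule lipschitz_on_continuous_on)
  qed
  have jet: "M \<le> \<gamma> x' \<and> Ham ((\<sigma> x')\<^sup>2) (f x') M \<le> - q" if "subjet T V t x q M" "x' \<in> Dset \<kappa> \<epsilon> x" for t x q M x'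
    by (rule visc_super_jet_inequalities[OF V_super that])
  have xin: "x \<in> Dset \<kappa> \<epsilon> x" for x using \<epsilon>_range by (simp add: Dset_def)
  have \<gamma>: "\<iota> \<le> \<gamma> x" "\<gamma> x \<le> 1 / f x - \<iota>" for x using \<gamma>_bounds by auto
  define G where "G = 1 / cf"
  have \<gamma>G: "\<gamma> x \<le> G" for x
  proof -
    have "1 / f x \<le> 1 / cf" using cf by (simp add: frac_le)
    then show ?thesis using \<gamma>(2)[of x] \<iota>_pos by (simp add: G_def)
  qed
  have fM: "f x * M < 1" if "M \<le> 1 / f x - e" "e > 0" for x M e
  proof -
    have "f x * M \<le> f x * (1 / f x - e)" using that fpos[of x] by (intro mult_left_mono) auto
    moreover have "f x * (1 / f x - e) = 1 - f x * e" using fpos[of x] by (simp add: algebra_simps)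
    moreover have "f x * e > 0" using that fpos by simp
    ultimately show ?thesis by linarith
  qed
  \<comment> \<open>An upper bound for \<open>q\<close> on subjets, from the lower bound of the
    Hamiltonian and the bounds on the coefficients.\<close>
  define C0 where "C0 = Bs / (2 * cf)"
  have C0: "C0 \<ge> 0" using Bs0 cf by (simp add: C0_def)
  have MG: "M \<le> G" and qC: "q \<le> C0" if j: "subjet T V t x q M" for t x q M
  proof -
    show "M \<le> G" using jet[OF j xin] \<gamma>G[of x] by linarith
    have "f x * M < 1" using fM[of M x \<iota>] jet[OF j xin] \<gamma>(2)[of x] \<iota>_pos by linarith
    then have "- (\<sigma> x)\<^sup>2 / (2 * f x) \<le> Ham ((\<sigma> x)\<^sup>2) (f x) M" by (intro Ham_lower fpos) auto
    moreover have "(\<sigma> x)\<^sup>2 / (2 * f x) \<le> C0" unfolding C0_def using Bs[of x] Bs0 cf(1) cf(2)[of x] by (intro frac_le) auto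
    ultimately show "q \<le> C0" using jet[OF j xin] by auto
  qed
  have lsc: "lsc_on ({0..<T} \<times> UNIV) V" by (rule lsc_on_subset[OF V_lsc]) auto
  have sc: "V (t, x + y) + V (t, x - y) \<le> 2 * V (t, x) + G * y\<^sup>2" and cont: "continuous_on UNIV (\<lambda>x. V (t, x))"
    if "0 \<le> t" "t < T" for t x y
    using concave_second_difference[OF subjet_semiconcave[OF lsc MG that]] by auto
  have growth: "\<bar>V (t, x)\<bar> \<le> Cv * (1 + \<bar>x\<bar>)" if "0 \<le> t" "t < T" for t x using Cv that by simp
  have G0: "G \<ge> 0" using cf by (simp add: G_def)
  \<comment> \<open>The strict supersolution has second derivative \<open>\<iota> / 2\<close>, for
    which the Hamiltonian is at most \<open>Bs * \<iota>\<close>; the time slope \<open>- A1\<close>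
    leaves margin 1 in the equation, and the constraint has margin at least
    \<open>\<iota> / 2\<close>. \<open>E\<close> completes a square so that \<open>\<psi>\<close>
    lies above the linear growth of \<open>V\<close> at time \<open>T\<close>.\<close>
  define A1 where "A1 = 1 + Bs * \<iota>"
  define E where "E = Cv + Cv\<^sup>2 / \<iota>"
  define \<psi> where "\<psi> = (\<lambda>z. \<iota> / 4 * (snd z)\<^sup>2 + A1 * (T - fst z) + E)"
  have \<psi>T: "V (T, x) \<le> \<psi> (T, x)" for x
  proof -
    have "0 \<le> (\<iota> * \<bar>x\<bar> / 2 - Cv)\<^sup>2 / \<iota>" using \<iota>_pos by simp
    also have "\<dots> = \<iota> / 4 * x\<^sup>2 - Cv * \<bar>x\<bar> + Cv\<^sup>2 / \<iota>" using \<iota>_pos by (simp add: power2_eq_square field_simps)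
    finally show ?thesis using Cv[of T x] T_pos by (simp add: \<psi>_def E_def algebra_simps abs_le_iff)
  qed
  have \<psi>0: "\<psi> (t, x) \<ge> \<iota> / 4 * x\<^sup>2" if "t \<le> T" for t x
    using that Cuv \<iota>_pos Bs0 by (simp add: \<psi>_def A1_def E_def)
  \<comment> \<open>The summand 1 keeps the divisor in \<open>l\<close> positive. With this
    \<open>l\<close>, mixing in \<open>\<psi>\<close> raises the value at \<open>(ts, xs)\<close> by
    at most a quarter of the gap.\<close>
  define bb where "bb = \<bar>\<psi> (ts, xs) - V (ts, xs)\<bar> + 1"
  have bb: "bb > 0" by (simp add: bb_def)
  define l where "l = min (1/2) (gap / (4 * bb))"
  have l: "0 < l" "l < 1" "l * (\<psi> (ts, xs) - V (ts, xs)) \<le> gap / 4"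
  proof -
    show l0: "0 < l" "l < 1" using gap bb by (auto simp: l_def)
    have "l * (\<psi> (ts, xs) - V (ts, xs)) \<le> l * bb" using l0 by (intro mult_left_mono) (auto simp: bb_def)
    also have "\<dots> \<le> gap / (4 * bb) * bb" using bb by (intro mult_right_mono) (auto simp: l_def)
    also have "\<dots> = gap / 4" using bb by simp
    finally show "l * (\<psi> (ts, xs) - V (ts, xs)) \<le> gap / 4" .
  qed
  \<comment> \<open>The weight \<open>l\<close> buys margins \<open>l\<close> in the equation and
    \<open>l * \<iota> / 2\<close> in the constraint; mollification may spend at most
    \<open>l / 4\<close> and \<open>l * \<iota> / 4\<close> of them.\<close>
  define \<omega> where "\<omega> = l * min \<iota> 1 / 4"
  have \<omega>: "0 < \<omega>" "\<omega> \<le> \<iota> / 2" "\<omega> \<le> l * \<iota> / 4" "\<omega> \<le> l / 4"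
  proof -
    show "0 < \<omega>" "\<omega> \<le> l * \<iota> / 4" "\<omega> \<le> l / 4" using l \<iota>_pos by (auto simp: \<omega>_def)
    have "l * \<iota> \<le> 1 * \<iota>" using l \<iota>_pos by (intro mult_right_mono) auto
    then show "\<omega> \<le> \<iota> / 2" using \<open>\<omega> \<le> l * \<iota> / 4\<close> \<iota>_pos by linarith
  qed
  define \<mu> where "\<mu> = gap / 4"
  have \<mu>: "\<mu> > 0" using gap by (simp add: \<mu>_def)
  \<comment> \<open>\<open>2 * Cv\<close>, because values of \<open>V\<close> within distance
    \<open>h < 1\<close> of \<open>x\<close> are bounded by \<open>Cv * (2 + \<bar>x\<bar>)\<close>.
    \<open>R\<close> puts \<open>xs\<close> in the box and lets the quadratic part of
    \<open>l * \<psi>\<close> dominate these linear bounds on its sides.\<close>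
  define C' where "C' = Cu + 2 * Cv"
  define R where "R = max (1 + 8 * C' / (l * \<iota>)) (\<bar>xs\<bar>)"
  have coercive: "C' * (1 + \<bar>x\<bar>) \<le> l * (\<iota> / 4 * x\<^sup>2)" if "\<bar>x\<bar> = R" for x
  proof -
    have li: "l * \<iota> > 0" using l \<iota>_pos by simp
    have C'0: "C' \<ge> 0" using Cuv by (simp add: C'_def)
    have "8 * C' / (l * \<iota>) \<ge> 0" using C'0 li by simp
    then have x1: "1 \<le> \<bar>x\<bar>" "8 * C' / (l * \<iota>) \<le> \<bar>x\<bar>" using that by (auto simp: R_def)
    then have "8 * C' \<le> l * \<iota> * \<bar>x\<bar>" using li by (simp add: pos_divide_le_eq mult.commute)
    then have "8 * C' * \<bar>x\<bar> \<le> l * \<iota> * \<bar>x\<bar> * \<bar>x\<bar>" by (rule mult_right_mono) simp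
    moreover have "\<bar>x\<bar> * \<bar>x\<bar> = x\<^sup>2" by (simp add: power2_eq_square)
    moreover have "C' * 1 \<le> C' * \<bar>x\<bar>" using x1 C'0 by (intro mult_left_mono)
    ultimately show ?thesis by (simp add: algebra_simps)
  qed
  have "\<exists>h0>0. \<forall>h \<rho> \<rho>1 \<rho>2 \<rho>3 \<rho>4 t0 x0 x0'. h < h0 \<longrightarrow> kernel4 h \<rho> \<rho>1 \<rho>2 \<rho>3 \<rho>4 \<longrightarrow> 0 \<le> t0 \<longrightarrow> t0 + 2 * h < T \<longrightarrow> \<bar>x0\<bar> \<le> R \<longrightarrow> x0' \<in> Dset \<kappa> \<epsilon> x0 \<longrightarrow>
     conv2 h (time_cut T V) \<rho> \<rho>2 (t0, x0) \<le> \<gamma> x0' + \<omega> \<and>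
     Ham ((\<sigma> x0')\<^sup>2) (f x0') (conv2 h (time_cut T V) \<rho> \<rho>2 (t0, x0)) - \<omega> \<le> conv2 h (time_cut T V) \<rho>1 \<rho> (t0, x0)"
    by (rule mollified_supersolution[OF lsc growth cont sc k \<epsilon>_range cts \<gamma>_cont cf Bs \<iota>_pos \<gamma> \<gamma>G qC C0 jet \<omega>(1,2)])
  then obtain h0 where h0: "h0 > 0" and moll: "\<And>h \<rho> \<rho>1 \<rho>2 \<rho>3 \<rho>4 t0 x0 x0'. h < h0 \<Longrightarrow> kernel4 h \<rho> \<rho>1 \<rho>2 \<rho>3 \<rho>4 \<Longrightarrow> 0 \<le> t0 \<Longrightarrow> t0 + 2 * h < T \<Longrightarrow> \<bar>x0\<bar> \<le> R \<Longrightarrow> x0' \<in> Dset \<kappa> \<epsilon> x0 \<Longrightarrow>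
     conv2 h (time_cut T V) \<rho> \<rho>2 (t0, x0) \<le> \<gamma> x0' + \<omega> \<and>
     Ham ((\<sigma> x0')\<^sup>2) (f x0') (conv2 h (time_cut T V) \<rho> \<rho>2 (t0, x0)) - \<omega> \<le> conv2 h (time_cut T V) \<rho>1 \<rho> (t0, x0)"
    by blast
  have C\<psi>: "C12_test \<psi> (\<lambda>z. - A1) (\<lambda>z. \<iota> / 2 * snd z) (\<lambda>z. \<iota> / 2)"
    unfolding C12_test_def \<psi>_def by (auto intro!: continuous_intros derivative_eq_intros)
  have c\<psi>: "continuous_on UNIV \<psi>" using C\<psi> unfolding C12_test_def by blast
  have "U (T, x) \<le> (1 - l) * V (T, x) + l * \<psi> (T, x)" for x
  proof -
    have "l * V (T, x) \<le> l * \<psi> (T, x)" using \<psi>T l by (intro mult_left_mono) auto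
    moreover have "(1 - l) * V (T, x) = V (T, x) - l * V (T, x)" by (simp add: algebra_simps)
    moreover have "U (T, x) \<le> V (T, x)" using terminal by blast
    ultimately show ?thesis by linarith
  qed
  then obtain \<eta> where \<eta>: "\<eta> > 0" "\<And>t x. \<bar>x\<bar> \<le> R \<Longrightarrow> 0 \<le> t \<Longrightarrow> t \<le> T \<Longrightarrow> T - \<eta> \<le> t \<Longrightarrow>
     \<exists>m. (\<forall>s y. 0 \<le> s \<longrightarrow> s \<le> T \<longrightarrow> T - \<eta> \<le> s \<longrightarrow> \<bar>y - x\<bar> \<le> \<eta> \<longrightarrow> m \<le> V (s, y)) \<and> U (t, x) \<le> (1 - l) * m + l * \<psi> (t, x) + \<mu>"
    using terminal_layer[OF T_pos U_usc V_lsc c\<psi> _ _ _ \<mu>, of l R] l by (metis less_imp_le)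
  define b where "b = 2 * C0 + G / 2 + 1"
  have b: "b > 0" using C0 G0 by (simp add: b_def)
  \<comment> \<open>The box ends at \<open>T - 3 * h\<close>: samples then reach at most time
    \<open>T - h\<close> and stay in the terminal layer of width \<open>\<eta>\<close>. The excess
    of the mollification over \<open>V\<close> at \<open>(ts, xs)\<close> is at most
    \<open>b * h\<close>, less than a quarter of the gap.\<close>
  define h where "h = Min {1, h0, (T - ts) / 2, \<eta>, gap / (4 * b)} / 4"
  have h: "0 < h" "h < 1" "h < h0" "ts + 3 * h < T" "3 * h \<le> \<eta>" "b * h < gap / 4"
  proof -
    define mn where "mn = Min {1, h0, (T - ts) / 2, \<eta>, gap / (4 * b)}"
    have mn: "mn > 0" "mn \<le> 1" "mn \<le> h0" "mn \<le> (T - ts) / 2" "mn \<le> \<eta>" "mn \<le> gap / (4 * b)"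
    proof -
      show "mn > 0" using h0 tsT \<eta>(1) gap b by (simp add: mn_def)
    qed (unfold mn_def, (rule Min_le; simp)+)
    have hm: "h = mn / 4" by (simp add: h_def mn_def)
    show "0 < h" "h < 1" "h < h0" "3 * h \<le> \<eta>" using mn(1,2,3,5) hm by linarith+
    have "2 * mn \<le> T - ts" using mn(4) by (simp add: field_simps)
    then have "3 * h < T - ts" using mn(1) unfolding hm by simp
    then show "ts + 3 * h < T" by linarith
    have "b * mn \<le> b * (gap / (4 * b))" using mn b by (intro mult_left_mono) auto
    then have "b * mn \<le> gap / 4" using b by simp
    moreover have "b * mn > 0" using b mn by simp
    ultimately show "b * h < gap / 4" unfolding hm by simp
  qed
  obtain \<rho> \<rho>1 \<rho>2 \<rho>3 \<rho>4 where ker: "kernel4 h \<rho> \<rho>1 \<rho>2 \<rho>3 \<rho>4" using kernel4_exists[OF h(1)] by blast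
  define u where "u = time_cut T V"
  have lu: "locally_bdd_borel u" unfolding u_def by (rule locally_bdd_borel_time_cut[OF lsc growth])
  define W where "W = conv2 h u \<rho> \<rho>"
  define Wt where "Wt = (\<lambda>z. - conv2 h u \<rho>1 \<rho> z)"
  define Wx where "Wx = (\<lambda>z. - conv2 h u \<rho> \<rho>1 z)"
  define Wxx where "Wxx = conv2 h u \<rho> \<rho>2"
  have CW: "C12_test W Wt Wx Wxx" unfolding W_def Wt_def Wx_def Wxx_def by (rule conv2_C12_test[OF lu h(1) ker])
  \<comment> \<open>Signs are reversed because the box argument is applied to \<open>- U\<close>;
    \<open>\<mu>\<close> is the slack granted on the top face.\<close>
  define \<phi> where "\<phi> = (\<lambda>z. - ((1 - l) * W z + l * \<psi> z) - \<mu>)"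
  define \<phi>t where "\<phi>t = (\<lambda>z. - ((1 - l) * Wt z - l * A1))"
  define \<phi>x where "\<phi>x = (\<lambda>z. - ((1 - l) * Wx z + l * (\<iota> / 2 * snd z)))"
  define \<phi>xx where "\<phi>xx = (\<lambda>z. - ((1 - l) * Wxx z + l * (\<iota> / 2)))"
  have C\<phi>: "C12_test \<phi> \<phi>t \<phi>x \<phi>xx"
  proof -
    have cW: "continuous_on UNIV W" "continuous_on UNIV Wt" "continuous_on UNIV Wx" "continuous_on UNIV Wxx"
      and dW: "\<And>t x. ((\<lambda>s. W (s, x)) has_real_derivative Wt (t, x)) (at t)"
        "\<And>t x. ((\<lambda>y. W (t, y)) has_real_derivative Wx (t, x)) (at x)"
        "\<And>t x. ((\<lambda>y. Wx (t, y)) has_real_derivative Wxx (t, x)) (at x)"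
      using CW unfolding C12_test_def by blast+
    have dP: "\<And>t x. ((\<lambda>s. \<psi> (s, x)) has_real_derivative - A1) (at t)"
        "\<And>t x. ((\<lambda>y. \<psi> (t, y)) has_real_derivative \<iota> / 2 * x) (at x)"
      using C\<psi> unfolding C12_test_def by simp_all
    show ?thesis unfolding C12_test_def
    proof (intro conjI allI)
      show "continuous_on UNIV \<phi>" "continuous_on UNIV \<phi>t" "continuous_on UNIV \<phi>x" "continuous_on UNIV \<phi>xx"
        unfolding \<phi>_def \<phi>t_def \<phi>x_def \<phi>xx_def
        by (intro continuous_on_diff continuous_on_minus continuous_on_add continuous_on_mult continuous_on_const continuous_on_snd continuous_on_id cW c\<psi>)+
      fix t x
      show "((\<lambda>s. \<phi> (s, x)) has_real_derivative \<phi>t (t, x)) (at t)" unfolding \<phi>_def \<phi>t_def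
        by (rule DERIV_cong[OF DERIV_diff[OF DERIV_minus[OF DERIV_add[OF DERIV_cmult[OF dW(1)] DERIV_cmult[OF dP(1)]]] DERIV_const]]) simp
      show "((\<lambda>y. \<phi> (t, y)) has_real_derivative \<phi>x (t, x)) (at x)" unfolding \<phi>_def \<phi>x_def
        by (rule DERIV_cong[OF DERIV_diff[OF DERIV_minus[OF DERIV_add[OF DERIV_cmult[OF dW(2)] DERIV_cmult[OF dP(2)]]] DERIV_const]]) simp
      show "((\<lambda>y. \<phi>x (t, y)) has_real_derivative \<phi>xx (t, x)) (at x)" unfolding \<phi>x_def \<phi>xx_def snd_conv
        by (rule DERIV_cong[OF DERIV_minus[OF DERIV_add[OF DERIV_cmult[OF dW(3)] DERIV_cmult[OF DERIV_cmult[OF DERIV_ident]]]]]) simp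
    qed
  qed
  have Wge: "m \<le> W (t, x)" if "0 \<le> t" "t + 2 * h < T" "\<And>s y. t \<le> s \<Longrightarrow> s \<le> t + 2 * h \<Longrightarrow> \<bar>y\<bar> \<le> h \<Longrightarrow> m \<le> V (s, x + y)" for t x m
    unfolding W_def u_def by (rule mollify_ge[OF lsc growth cont sc G0 ker that])
  have Wle: "W (ts, xs) \<le> V (ts, xs) + 2 * C0 * h + G * h\<^sup>2 / 2"
    unfolding W_def u_def
  proof (rule mollify_le[OF lsc growth cont sc G0 ker ts(1) _ C0])
    show "ts + 2 * h < T" using h by linarith
    show "V (s, xs) \<le> V (ts, xs) + C0 * (s - ts)" if "ts \<le> s" "s < T" for s
      by (rule subjet_time_growth[OF lsc qC ts(1) that])
  qed
  \<comment> \<open>Of the gap, one quarter goes to mollification, one to the weight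
    \<open>l\<close> and one to \<open>\<mu>\<close>; the last keeps the difference
    negative.\<close>
  have inside: "- U (ts, xs) - \<phi> (ts, xs) < 0"
  proof -
    have "h * h \<le> 1 * h" using h by (intro mult_right_mono) auto
    then have "G / 2 * h\<^sup>2 \<le> G / 2 * h" using G0 by (intro mult_left_mono) (auto simp: power2_eq_square)
    then have "2 * C0 * h + G * h\<^sup>2 / 2 \<le> b * h" using h(1) by (simp add: b_def algebra_simps)
    then have "W (ts, xs) \<le> V (ts, xs) + gap / 4" using Wle h(6) by linarith
    then have "(1 - l) * W (ts, xs) \<le> (1 - l) * (V (ts, xs) + gap / 4)" using l by (intro mult_left_mono) auto
    moreover have "l * (gap / 4) \<ge> 0" using l gap by simp
    moreover have "(1 - l) * (V (ts, xs) + gap / 4) + l * \<psi> (ts, xs) = V (ts, xs) + gap / 4 - l * (gap / 4) + l * (\<psi> (ts, xs) - V (ts, xs))"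
      by (simp add: field_simps)
    ultimately have "(1 - l) * W (ts, xs) + l * \<psi> (ts, xs) \<le> V (ts, xs) + gap / 4 + l * (\<psi> (ts, xs) - V (ts, xs))"
      by linarith
    then show ?thesis using l(3) gap gap_def \<mu>_def unfolding \<phi>_def by linarith
  qed
  have sides: "- U (t, x) - \<phi> (t, x) \<ge> 0" if t: "0 \<le> t" "t \<le> T - 3 * h" and x: "\<bar>x\<bar> = R" for t x
  proof -
    have "- (Cv * (2 + \<bar>x\<bar>)) \<le> W (t, x)"
    proof (rule Wge[OF t(1)])
      show "t + 2 * h < T" using t h by linarith
      fix s y assume s: "t \<le> s" "s \<le> t + 2 * h" "\<bar>y\<bar> \<le> h"
      have "Cv * (1 + \<bar>x + y\<bar>) \<le> Cv * (2 + \<bar>x\<bar>)" using s h Cuv by (intro mult_left_mono) auto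
      then show "- (Cv * (2 + \<bar>x\<bar>)) \<le> V (s, x + y)" using Cv[of s "x + y"] s t h by (simp add: abs_le_iff)
    qed
    then have "(1 - l) * (- (Cv * (2 + \<bar>x\<bar>))) \<le> (1 - l) * W (t, x)" using l by (intro mult_left_mono) auto
    moreover have "l * (Cv * (2 + \<bar>x\<bar>)) \<ge> 0" using l Cuv by simp
    moreover have "(1 - l) * (- (Cv * (2 + \<bar>x\<bar>))) = - (Cv * (2 + \<bar>x\<bar>)) + l * (Cv * (2 + \<bar>x\<bar>))" by (simp add: algebra_simps)
    moreover have "l * (\<iota> / 4 * x\<^sup>2) \<le> l * \<psi> (t, x)" using \<psi>0[of t x] t h l by (intro mult_left_mono) auto
    moreover have "U (t, x) \<le> Cu * (1 + \<bar>x\<bar>)" using Cu[of t x] t h by (simp add: abs_le_iff)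
    moreover have "C' * (1 + \<bar>x\<bar>) = Cu * (1 + \<bar>x\<bar>) + Cv * (2 + \<bar>x\<bar>) + Cv * \<bar>x\<bar>" by (simp add: C'_def algebra_simps)
    moreover have "Cv * \<bar>x\<bar> \<ge> 0" using Cuv by simp
    ultimately show ?thesis using coercive[OF x] \<mu> unfolding \<phi>_def by linarith
  qed
  have top: "- U (T - 3 * h, x) - \<phi> (T - 3 * h, x) \<ge> 0" if x: "- R \<le> x" "x \<le> R" for x
  proof -
    have t: "0 \<le> T - 3 * h" "T - 3 * h \<le> T" "T - \<eta> \<le> T - 3 * h" using h ts by auto
    obtain m where m: "\<And>s y. 0 \<le> s \<Longrightarrow> s \<le> T \<Longrightarrow> T - \<eta> \<le> s \<Longrightarrow> \<bar>y - x\<bar> \<le> \<eta> \<Longrightarrow> m \<le> V (s, y)"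
      "U (T - 3 * h, x) \<le> (1 - l) * m + l * \<psi> (T - 3 * h, x) + \<mu>"
      using \<eta>(2)[OF _ t, of x] x by (auto simp: abs_le_iff)
    have "m \<le> W (T - 3 * h, x)"
      by (rule Wge[OF t(1)]) (use h t in \<open>auto intro!: m(1)\<close>)
    then have "(1 - l) * m \<le> (1 - l) * W (T - 3 * h, x)" using l by (intro mult_left_mono) auto
    then show ?thesis using m(2) by (simp add: \<phi>_def)
  qed
  have lscU: "lsc_on ({0..<T} \<times> UNIV) (\<lambda>z. - U z)"
    by (rule lsc_on_subset[OF usc_on_uminus[OF U_usc]]) auto
  have "\<exists>t x. 0 \<le> t \<and> t < T - 3 * h \<and> - R < x \<and> x < R \<and> subjet T (\<lambda>z. - U z) t x (\<phi>t (t, x)) (\<phi>xx (t, x))"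
  proof (rule box_min_subjet[OF lscU C\<phi>, where ti = ts and xi = xs])
    show "T - 3 * h < T" "ts \<le> T - 3 * h" using h by auto
    show "- R \<le> xs" "xs \<le> R" by (auto simp: R_def)
    have "R \<ge> 0" by (simp add: R_def le_max_iff_disj)
    then show "0 \<le> - U (t, - R) - \<phi> (t, - R)" "0 \<le> - U (t, R) - \<phi> (t, R)" if "0 \<le> t" "t \<le> T - 3 * h" for t
      using sides[OF that] by auto
  qed (use ts inside top in auto)
  then obtain t0 x0 where tx: "0 \<le> t0" "t0 < T - 3 * h" "- R < x0" "x0 < R"
    and sj: "subjet T (\<lambda>z. - U z) t0 x0 (\<phi>t (t0, x0)) (\<phi>xx (t0, x0))" by blast
  have F0: "Fop f \<sigma> \<gamma> \<kappa> \<epsilon> t0 x0 (- \<phi>t (t0, x0)) (- \<phi>xx (t0, x0)) \<le> 0"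
    by (rule visc_sub_superjet[OF U_sub sj])
  define M where "M = - \<phi>xx (t0, x0)"
  define q where "q = - \<phi>t (t0, x0)"
  \<comment> \<open>A margin independent of \<open>x'\<close>, so that it survives the infimum in
    \<open>Fop\<close>.\<close>
  define mg where "mg = min (l / 2) (l * \<iota> / 4)"
  have mg: "mg > 0" using l \<iota>_pos by (simp add: mg_def)
  have "mg \<le> min (- q - (\<sigma> x')\<^sup>2 * M / (2 * (1 - f x' * M))) (\<gamma> x' - M)" if x': "x' \<in> Dset \<kappa> \<epsilon> x0" for x'
  proof -
    define M0 where "M0 = Wxx (t0, x0)"
    define q0 where "q0 = - Wt (t0, x0)"
    define s where "s = (\<sigma> x')\<^sup>2"
    have s: "0 \<le> s" "s \<le> Bs" using Bs by (auto simp: s_def)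
    have W0: "M0 \<le> \<gamma> x' + \<omega>" "Ham s (f x') M0 - \<omega> \<le> q0"
      using moll[OF h(3) ker tx(1) _ _ x'] tx h by (auto simp: M0_def q0_def Wxx_def Wt_def u_def s_def)
    have Meq: "M = (1 - l) * M0 + l * (\<iota> / 2)" by (simp add: M_def \<phi>xx_def M0_def)
    have qeq: "- q = (1 - l) * q0 + l * A1" by (simp add: q_def \<phi>t_def q0_def)
    have M0f: "f x' * M0 < 1" using fM[of M0 x' "\<iota> / 2"] W0(1) \<omega>(2) \<gamma>(2)[of x'] \<iota>_pos by linarith
    have fi: "f x' * \<iota> \<le> 1 / 2"
    proof -
      have "\<iota> \<le> 1 / f x' - \<iota>" using \<gamma>[of x'] by linarith
      then show ?thesis using fpos[of x'] by (simp add: field_simps)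
    qed
    have if1: "f x' * (\<iota> / 2) < 1" using fi by simp
    \<comment> \<open>\<open>f x' * \<iota> \<le> 1 / 2\<close> keeps the denominator
      \<open>4 * (1 - f x' * (\<iota> / 2))\<close> at least 3, well above the 1 used here.\<close>
    have HI: "Ham s (f x') (\<iota> / 2) \<le> Bs * \<iota>"
    proof -
      have "Ham s (f x') (\<iota> / 2) = s * \<iota> / (4 * (1 - f x' * (\<iota> / 2)))" by (simp add: Ham_def)
      also have "\<dots> \<le> s * \<iota> / 1"
      proof (rule divide_left_mono)
        show "1 \<le> 4 * (1 - f x' * (\<iota> / 2))" using fi by (simp add: mult.commute)
        then show "0 < 4 * (1 - f x' * (\<iota> / 2)) * 1" by linarith
      qed (use s \<iota>_pos in simp)
      also have "\<dots> \<le> Bs * \<iota>" using s \<iota>_pos by simp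
      finally show ?thesis .
    qed
    \<comment> \<open>Both jets are evaluated at the same \<open>x'\<close>, so convexity in the
      second derivative is enough to combine the two inequalities.\<close>
    have "Ham s (f x') M \<le> (1 - l) * Ham s (f x') M0 + l * Ham s (f x') (\<iota> / 2)"
      unfolding Meq using l by (intro Ham_convex[OF s(1) fpos M0f if1]) auto
    moreover have "(1 - l) * Ham s (f x') M0 \<le> (1 - l) * (q0 + \<omega>)" using W0(2) l by (intro mult_left_mono) auto
    moreover have "l * Ham s (f x') (\<iota> / 2) \<le> l * (A1 - 1)" using HI l by (intro mult_left_mono) (auto simp: A1_def)
    moreover have "(1 - l) * \<omega> \<le> \<omega>" using l \<omega> by (simp add: algebra_simps)
    ultimately have "Ham s (f x') M \<le> - q + \<omega> - l" unfolding qeq by (simp add: algebra_simps)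
    then have "l / 2 \<le> - q - Ham s (f x') M" using \<omega>(4) l by linarith
    moreover have "l * \<iota> / 4 \<le> \<gamma> x' - M"
    proof -
      have "(1 - l) * M0 \<le> (1 - l) * (\<gamma> x' + \<omega>)" using W0(1) l by (intro mult_left_mono) auto
      moreover have "l * (\<iota> / 2) \<le> l * (\<gamma> x' - \<iota> / 2)" using \<gamma>(1)[of x'] l by (intro mult_left_mono) auto
      moreover have "(1 - l) * \<omega> \<le> \<omega>" using l \<omega> by (simp add: algebra_simps)
      ultimately have "M \<le> \<gamma> x' + \<omega> - l * \<iota> / 2" unfolding Meq by (simp add: algebra_simps)
      then show ?thesis using \<omega>(3) by linarith
    qed
    ultimately show ?thesis unfolding mg_def Ham_def s_def by (intro min.mono)
  qed
  then have "ereal mg \<le> Fop f \<sigma> \<gamma> \<kappa> \<epsilon> t0 x0 q M"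
    unfolding Fop_def by (intro INF_greatest) simp
  then have "ereal mg \<le> 0" using F0 unfolding q_def M_def by (rule order_trans)
  then show False using mg by simp
qed

end
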